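(* Let $\mu$ be a non-negative Radon measure on $\mathbb{R}$ satisfying the Brinck condition, and let $\mathbf{H}_\mu$ be the operator generated by the form $\mathbf{a}_\mu$. Let $$\alpha=\left(\pi^2+\tfrac34\right)^{-1},\qquad \beta=2 .$$ Then, for every $\lambda>0$, the following estimates hold: $$\frac12\,\min_{y\in M_\alpha(4\lambda)}\sqrt{q^*_\alpha(y)}\;\mathcal{L}(M_\alpha(4\lambda))\;\le\; N(-\lambda,\mathbf{H}_\mu)\;\le\;\max_{y\in M_\beta(\lambda/4)}\sqrt{q^*_\beta(y)}\;\mathcal{L}(M_\beta(\lambda/4)),$$ $$\sqrt{\lambda}\;\mathcal{L}(M_\alpha(4\lambda))\;\le\; N(-\lambda,\mathbf{H}_\mu)\;\le\;\sqrt{\|q^*_\beta\|_\infty}\;\mathcal{L}(M_\beta(\lambda/4)),$$ $$\sup_{\eta\ge\lambda}\left(\sqrt{\eta}\;\mathcal{L}(M_\alpha(4\eta))\right)\;\le\; N(-\lambda,\mathbf{H}_\mu)\;\le\;4\int_{M_\beta(\lambda/4)}\sqrt{q^*_\beta(y)}\,dy .$$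
   Context: $\mathcal{L}$ is Lebesgue measure on $\mathbb{R}$; $\Delta_x(d)=[x-\frac d2,x+\frac d2]$. A Radon measure here is a positive Borel measure on $\mathbb{R}$, finite on compact sets (and regular). The Brinck condition: there is $C>0$ with $\mu([x,x+1])<C$ for all $x\in\mathbb{R}$. For $\alpha>0$ the Otelbaev function of $\mu$ is $$q^*_\alpha(x)=\inf\left\{\tfrac1{d^2}:\ d>0,\ \mu(\Delta_x(d))<\tfrac1{\alpha d}\right\},$$ and $M_\alpha(\lambda)=\{x\in\mathbb{R}: q^*_\alpha(x)\ge\lambda\}$; $\|\cdot\|_\infty$ is the supremum norm. The form is $\mathbf{a}_\mu(f,g)=\int_{\mathbb{R}}f'\overline{g'}\,dx-\int_{\mathbb{R}}f\overline{g}\,d\mu$ on $\{f\in H^1(\mathbb{R}):\int|f|^2d\mu<\infty\}$; under the Brinck condition it is densely defined, symmetric, lower semibounded and closed in $L^2(\mathbb{R})$, and $\mathbf{H}_\mu$ is the self-adjoint operator associated with it (first representation theorem). $N(-\lambda,\mathbf{H}_\mu)\in\{0,1,2,\dots\}\cup\{\infty\}$ is the dimension of the spectral subspace of $\mathbf{H}_\mu$ for $(-\infty,-\lambda)$, i.e. the number of eigenvalues below $-\lambda$ with multiplicity when the spectrum there is discrete and finite, and $\infty$ otherwise. All inequalities are between values in $[0,\infty]$: no discreteness of the negative spectrum is assumed. The min/max are understood as infimum/supremum, and the corresponding product is $0$ if the set $M$ is empty. *)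

theory Defs
  imports "HOL-Analysis.Analysis"
begin

section \<open>The measure, the Brinck condition and the Otelbaev function\<close>

text \<open>Regularity is not listed: a Borel measure on the real line that is finite on compact sets
  is automatically regular.\<close>

definition radon_measure :: "real measure \<Rightarrow> bool" where
  "radon_measure \<mu> \<longleftrightarrow> sets \<mu> = sets borel \<and> (\<forall>K. compact K \<longrightarrow> emeasure \<mu> K < \<infinity>)"

definition brinck_condition :: "real measure \<Rightarrow> bool" where
  "brinck_condition \<mu> \<longleftrightarrow> (\<exists>C>0. \<forall>x::real. emeasure \<mu> {x..x + 1} < ennreal C)"

definition Delta :: "real \<Rightarrow> real \<Rightarrow> real set" where
  "Delta x d = {x - d / 2..x + d / 2}"

definition otelbaev :: "real measure \<Rightarrow> real \<Rightarrow> real \<Rightarrow> real" where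
  "otelbaev \<mu> \<alpha> x =
     Inf {1 / d\<^sup>2 | d. d > 0 \<and> emeasure \<mu> (Delta x d) < ennreal (1 / (\<alpha> * d))}"

definition otelbaev_set :: "real measure \<Rightarrow> real \<Rightarrow> real \<Rightarrow> real set" where
  "otelbaev_set \<mu> \<alpha> l = {x. otelbaev \<mu> \<alpha> x \<ge> l}"

text \<open>The next three facts show that neither the real infimum in the definition of the Otelbaev
  function nor its real supremum norm is taken over an empty or unbounded set.\<close>

lemma otelbaev_Inf_bdd_below:
  "bdd_below {1 / d\<^sup>2 | d::real. d > 0 \<and> emeasure \<mu> (Delta x d) < ennreal (1 / (\<alpha> * d))}"
  by (rule bdd_belowI[of _ 0]) auto

lemma otelbaev_uniform_length:
  assumes "radon_measure \<mu>" "brinck_condition \<mu>" "\<alpha> > 0"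
  shows "\<exists>d>0. \<forall>x. emeasure \<mu> (Delta x d) < ennreal (1 / (\<alpha> * d))"
proof -
  obtain C where C: "C > 0" "\<And>x::real. emeasure \<mu> {x..x + 1} < ennreal C"
    using assms(2) unfolding brinck_condition_def by blast
  define d where "d = min 1 (1 / (\<alpha> * C))"
  have d: "d > 0" "d \<le> 1" "d \<le> 1 / (\<alpha> * C)"
    using C(1) assms(3) by (auto simp: d_def)
  have "C \<le> 1 / (\<alpha> * d)"
    using d C(1) assms(3) by (simp add: field_simps)
  moreover have "emeasure \<mu> (Delta x d) < ennreal C" for x
  proof -
    have "emeasure \<mu> (Delta x d) \<le> emeasure \<mu> {x - d / 2..x - d / 2 + 1}"
      by (rule emeasure_mono)
        (use d assms(1) in \<open>auto simp: Delta_def radon_measure_def field_simps\<close>)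
    then show ?thesis using C(2) by (rule le_less_trans)
  qed
  ultimately have "emeasure \<mu> (Delta x d) < ennreal (1 / (\<alpha> * d))" for x
    by (meson ennreal_leI less_le_trans)
  then show ?thesis using d(1) by blast
qed

lemma otelbaev_bounded:
  assumes "radon_measure \<mu>" "brinck_condition \<mu>" "\<alpha> > 0"
  shows "(\<forall>x. otelbaev \<mu> \<alpha> x \<ge> 0) \<and> bdd_above (range (otelbaev \<mu> \<alpha>))"
proof -
  obtain d where d: "d > 0" "\<And>x. emeasure \<mu> (Delta x d) < ennreal (1 / (\<alpha> * d))"
    using otelbaev_uniform_length[OF assms] by blast
  have "otelbaev \<mu> \<alpha> x \<le> 1 / d\<^sup>2" for x
    unfolding otelbaev_def using d by (intro cInf_lower otelbaev_Inf_bdd_below) auto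
  moreover have "otelbaev \<mu> \<alpha> x \<ge> 0" for x
    unfolding otelbaev_def by (rule cInf_greatest) (use d in auto)
  ultimately show ?thesis by (auto intro!: bdd_aboveI2)
qed


section \<open>The Hilbert space\<close>

text \<open>Elements of the space of complex-valued square-integrable functions are represented by
  functions; equality of elements is equality almost everywhere.\<close>

definition L2 :: "(real \<Rightarrow> complex) set" where
  "L2 = {f. f \<in> borel_measurable lborel \<and> integrable lborel (\<lambda>x. (cmod (f x))\<^sup>2)}"

definition L2_eq :: "(real \<Rightarrow> complex) \<Rightarrow> (real \<Rightarrow> complex) \<Rightarrow> bool" where
  "L2_eq f g \<longleftrightarrow> (AE x in lborel. f x = g x)"

definition L2_inner :: "(real \<Rightarrow> complex) \<Rightarrow> (real \<Rightarrow> complex) \<Rightarrow> complex" where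
  "L2_inner f g = (LINT x|lborel. f x * cnj (g x))"

definition L2_independent :: "nat \<Rightarrow> (nat \<Rightarrow> real \<Rightarrow> complex) \<Rightarrow> bool" where
  "L2_independent n v \<longleftrightarrow>
     (\<forall>c::nat \<Rightarrow> complex. L2_eq (\<lambda>x. \<Sum>i<n. c i * v i x) (\<lambda>x. 0) \<longrightarrow> (\<forall>i<n. c i = 0))"

text \<open>The complex dimension of a subspace; all infinite dimensions are identified.\<close>

definition L2_dim :: "(real \<Rightarrow> complex) set \<Rightarrow> enat" where
  "L2_dim V = Sup {enat n | n. \<exists>v. (\<forall>i<n. v i \<in> V) \<and> L2_independent n v}"


section \<open>The form and the operator associated with it\<close>

text \<open>A function in the first-order Sobolev space is represented by its continuous (locally
  absolutely continuous) representative, as is needed to integrate it against a measure that may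
  charge Lebesgue null sets. The derivative is determined almost everywhere.\<close>

definition has_H1_deriv :: "(real \<Rightarrow> complex) \<Rightarrow> (real \<Rightarrow> complex) \<Rightarrow> bool" where
  "has_H1_deriv f f' \<longleftrightarrow> f \<in> L2 \<and> f' \<in> L2 \<and>
     (\<forall>a b. a \<le> b \<longrightarrow> f b - f a = (LINT x:{a..b}|lborel. f' x))"

definition H1 :: "(real \<Rightarrow> complex) set" where
  "H1 = {f. \<exists>f'. has_H1_deriv f f'}"

definition H1_deriv :: "(real \<Rightarrow> complex) \<Rightarrow> real \<Rightarrow> complex" where
  "H1_deriv f = (SOME f'. has_H1_deriv f f')"

definition form_domain :: "real measure \<Rightarrow> (real \<Rightarrow> complex) set" where
  "form_domain \<mu> = {f \<in> H1. integrable \<mu> (\<lambda>x. (cmod (f x))\<^sup>2)}"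

definition form :: "real measure \<Rightarrow> (real \<Rightarrow> complex) \<Rightarrow> (real \<Rightarrow> complex) \<Rightarrow> complex" where
  "form \<mu> f g =
     (LINT x|lborel. H1_deriv f x * cnj (H1_deriv g x)) - (LINT x|\<mu>. f x * cnj (g x))"

text \<open>The operator that the first representation theorem associates with the form, as a graph:
  \<open>u\<close> is in the domain and is mapped to \<open>h\<close> iff \<open>u\<close> has a representative \<open>f\<close> in the form domain such
  that the form of \<open>f\<close> and \<open>g\<close> is the inner product of \<open>h\<close> and \<open>g\<close>, for all \<open>g\<close> in the form domain.
  The graph is closed under equality almost everywhere in both components.\<close>

definition form_operator :: "real measure \<Rightarrow> ((real \<Rightarrow> complex) \<times> (real \<Rightarrow> complex)) set" where
  "form_operator \<mu> = {(u, h). u \<in> L2 \<and> h \<in> L2 \<and>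
     (\<exists>f \<in> form_domain \<mu>. L2_eq u f \<and> (\<forall>g \<in> form_domain \<mu>. form \<mu> f g = L2_inner h g))}"


section \<open>Spectral measures and spectral subspaces\<close>

definition orthogonal_projection :: "((real \<Rightarrow> complex) \<Rightarrow> real \<Rightarrow> complex) \<Rightarrow> bool" where
  "orthogonal_projection P \<longleftrightarrow>
     (\<forall>f\<in>L2. P f \<in> L2) \<and>
     (\<forall>f\<in>L2. \<forall>g\<in>L2. L2_eq f g \<longrightarrow> L2_eq (P f) (P g)) \<and>
     (\<forall>f\<in>L2. \<forall>g\<in>L2. \<forall>a b. L2_eq (P (\<lambda>x. a * f x + b * g x)) (\<lambda>x. a * P f x + b * P g x)) \<and>
     (\<forall>f\<in>L2. L2_eq (P (P f)) (P f)) \<and>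
     (\<forall>f\<in>L2. \<forall>g\<in>L2. L2_inner (P f) g = L2_inner f (P g))"

definition projection_valued_measure ::
  "(real set \<Rightarrow> (real \<Rightarrow> complex) \<Rightarrow> real \<Rightarrow> complex) \<Rightarrow> bool" where
  "projection_valued_measure E \<longleftrightarrow>
     (\<forall>A\<in>sets borel. orthogonal_projection (E A)) \<and>
     (\<forall>f\<in>L2. L2_eq (E {} f) (\<lambda>x. 0)) \<and>
     (\<forall>f\<in>L2. L2_eq (E UNIV f) f) \<and>
     (\<forall>A\<in>sets borel. \<forall>B\<in>sets borel. \<forall>f\<in>L2. L2_eq (E (A \<inter> B) f) (E A (E B f))) \<and>
     (\<forall>A::nat \<Rightarrow> real set. range A \<subseteq> sets borel \<longrightarrow> disjoint_family A \<longrightarrow>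
        (\<forall>f\<in>L2. \<forall>g\<in>L2. (\<lambda>n. L2_inner (E (A n) f) g) sums L2_inner (E (\<Union>n. A n) f) g))"

definition scalar_spectral_measure ::
  "(real set \<Rightarrow> (real \<Rightarrow> complex) \<Rightarrow> real \<Rightarrow> complex) \<Rightarrow> (real \<Rightarrow> complex) \<Rightarrow> real measure" where
  "scalar_spectral_measure E f =
     measure_of UNIV (sets borel) (\<lambda>A. ennreal (Re (L2_inner (E A f) f)))"

text \<open>\<open>E\<close> is the spectral measure of the operator with graph \<open>T\<close>, that is, \<open>T\<close> is the integral of
  \<open>t\<close> with respect to \<open>E\<close>: the domain consists of those \<open>f\<close> for which \<open>t\<^sup>2\<close> is integrable with
  respect to the scalar spectral measure of \<open>f\<close>, and on it the quadratic form of \<open>T\<close> is the integral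
  of \<open>t\<close>; the latter determines the operator by polarization. By the spectral theorem
  every self-adjoint operator has exactly one spectral measure (up to equality almost everywhere).\<close>

definition spectral_measure_of ::
  "((real \<Rightarrow> complex) \<times> (real \<Rightarrow> complex)) set \<Rightarrow>
   (real set \<Rightarrow> (real \<Rightarrow> complex) \<Rightarrow> real \<Rightarrow> complex) \<Rightarrow> bool" where
  "spectral_measure_of T E \<longleftrightarrow> projection_valued_measure E \<and>
     (\<forall>f\<in>L2. (\<exists>h. (f, h) \<in> T) \<longleftrightarrow> integrable (scalar_spectral_measure E f) (\<lambda>t. t\<^sup>2)) \<and>
     (\<forall>(f, h)\<in>T. L2_inner h f = complex_of_real (LINT t|scalar_spectral_measure E f. t))"

definition spectral_subspace ::
  "(real set \<Rightarrow> (real \<Rightarrow> complex) \<Rightarrow> real \<Rightarrow> complex) \<Rightarrow> real set \<Rightarrow> (real \<Rightarrow> complex) set" where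
  "spectral_subspace E A = E A ` L2"

text \<open>The counting function, for an operator with spectral measure \<open>E\<close>; the argument \<open>s\<close> is
  \<open>-\<lambda>\<close> in the application.\<close>

definition spectral_count ::
  "real \<Rightarrow> (real set \<Rightarrow> (real \<Rightarrow> complex) \<Rightarrow> real \<Rightarrow> complex) \<Rightarrow> ennreal" where
  "spectral_count s E = ennreal_of_enat (L2_dim (spectral_subspace E {..<s}))"

end

theory Submission
  imports Defs
begin

text \<open>Both bounds are variational. If \<open>f\<close> lies in the form domain and \<open>E {..<s} f = 0\<close>, split
  \<open>f = r + g\<close> with \<open>r = E {s..<s + n} f\<close> in the operator domain. The operator maps \<open>r\<close> into the
  range of \<open>E {s..<s + n}\<close>, so the form is additive on this splitting. It is at least \<open>s \<parallel>r\<parallel>\<^sup>2\<close> on \<open>r\<close>,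
  and semiboundedness controls \<open>g\<close>, whose norm tends to 0. Hence a subspace on which the form is
  below \<open>s\<close> injects into the spectral subspace; conversely, finitely many point conditions
  \<open>f x = 0\<close> that force the form to be at least \<open>s\<close> bound its dimension.

  Lower bound: at a point \<open>x\<close> with \<open>q\<^sup>* x \<ge> 4 \<eta>\<close> the interval of length \<open>r = 1 / (2 sqrt \<eta>)\<close> has mass
  at least \<open>(\<pi>\<^sup>2 + 3/4) / r\<close>, so the tent of half-width \<open>r\<close> over \<open>x\<close> brings the form below \<open>-\<eta>\<close>;
  points at distance at least \<open>2 r\<close> have orthogonal tents, and a set of measure \<open>m\<close> contains
  at least \<open>m / (2 r)\<close> of them.

  Upper bound: let \<open>h = 1 / sqrt \<lambda>\<close>. Off the set \<open>M\<close> the intervals of length \<open>2 h\<close> are so light that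
  the union of all of them costs at most \<open>\<lambda> \<integral>\<bar>f\<bar>\<^sup>2 + 1/2 \<integral>\<bar>f'\<bar>\<^sup>2\<close>. The remaining core has distance
  at least \<open>h\<close> from the complement of \<open>M\<close>. It is covered greedily from the left by disjoint intervals
  \<open>{x..<x + len x}\<close> with \<open>len x\<close> times the mass at most \<open>1/2\<close>; if \<open>f\<close> vanishes at their left end points
  they cost at most \<open>1/2 \<integral>\<bar>f'\<bar>\<^sup>2\<close>. The two integral bounds for their number come from a constant
  \<open>len\<close>, respectively from \<open>len = 1 / (2 sqrt q\<^sup>*)\<close>.\<close>

section \<open>Square-integrable functions and the form\<close>

text \<open>Closed intervals form an intersection-stable generator of the Borel sets, so a Dynkin
  argument extends the vanishing of integrals to all Borel sets, which forces the function to vanish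
  almost everywhere.\<close>

lemma AE_zero_of_interval_integrals:
  fixes k :: "real \<Rightarrow> 'b::{banach, second_countable_topology}"
  assumes int: "\<And>a b. set_integrable lborel {a..b} k"
    and zero: "\<And>a b. a \<le> b \<Longrightarrow> (LINT x:{a..b}|lborel. k x) = 0"
  shows "AE x in lborel. k x = 0"
proof -
  have AE: "AE x in lborel. x \<in> {- real n..real n} \<longrightarrow> k x = 0" for n
  proof -
    define I where "I = {- real n..real n}"
    \<comment> \<open>\<open>k\<close> is only locally integrable, while the complement step of the
      induction needs an integral over the whole line; hence the truncation.\<close>
    define h where "h x = indicator I x *\<^sub>R k x" for x
    have h: "integrable lborel h"
      using int[of "- real n" "real n"] by (simp add: h_def[abs_def] I_def set_integrable_def)
    have hs: "set_integrable lborel A h" if "A \<in> sets borel" for A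
      unfolding set_integrable_def using that h by (intro integrable_mult_indicator) auto
    define E where "E = range (\<lambda>(a, b). {a..b::real})"
    have box: "sets (borel :: real measure) = sigma_sets UNIV E"
      unfolding E_def borel_eq_atLeastAtMost by (simp add: split_def)
    have "(LINT x:A|lborel. h x) = 0" if "A \<in> sets borel" for A
    proof -
      have "Int_stable E"
        by (auto simp: Int_stable_def E_def)
      moreover have "E \<subseteq> Pow UNIV" by simp
      moreover have "A \<in> sigma_sets UNIV E" using that box by simp
      ultimately show ?thesis
      proof (induct rule: sigma_sets_induct_disjoint[consumes 3])
        case (basic A)
        then obtain a b where A: "A = {a..b}" by (auto simp: E_def)
        have "(LINT x:A|lborel. h x) = (LINT x:{max a (- real n)..min b (real n)}|lborel. k x)"
          unfolding set_lebesgue_integral_def h_def A I_def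
          by (rule arg_cong[where f="integral\<^sup>L lborel"]) (auto simp: fun_eq_iff indicator_def)
        also have "\<dots> = 0"
        proof (cases "max a (- real n) \<le> min b (real n)")
          case False
          then have "{max a (- real n)..min b (real n)} = {}" by auto
          then show ?thesis by (simp add: set_lebesgue_integral_def)
        qed (rule zero)
        finally show ?case .
      next
        case empty
        show ?case by (simp add: set_lebesgue_integral_def)
      next
        case (compl A)
        then have A: "A \<in> sets borel" using box by simp
        have "(LINT x:UNIV|lborel. h x) = (LINT x:A \<union> (UNIV - A)|lborel. h x)" by simp
        also have "\<dots> = (LINT x:A|lborel. h x) + (LINT x:UNIV - A|lborel. h x)"
          using A by (intro set_integral_Un hs) auto
        also have "(LINT x:UNIV|lborel. h x) = (LINT x:I|lborel. k x)"
          unfolding set_lebesgue_integral_def h_def by simp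
        also have "\<dots> = 0" unfolding I_def by (rule zero) simp
        finally show ?case using compl by simp
      next
        case (union A)
        then have A: "A i \<in> sets borel" for i using box by auto
        have "(LINT x:(\<Union>i. A i)|lborel. h x) = (\<Sum>i. (LINT x:A i|lborel. h x))"
          using A union(1) hs by (intro lebesgue_integral_countable_add) (auto simp: disjoint_family_on_def)
        then show ?case using union by simp
      qed
    qed
    then have "AE x in lborel. h x = 0"
      by (intro sigma_finite_measure.density_zero[OF sigma_finite_lborel] h) simp
    then show ?thesis
      by (rule AE_mp) (auto simp: h_def I_def)
  qed
  then have "AE x in lborel. \<forall>n. x \<in> {- real n..real n} \<longrightarrow> k x = 0"
    by (subst AE_all_countable) blast
  then show ?thesis
  proof (rule AE_mp, intro AE_I2 impI)
    fix x assume *: "\<forall>n. x \<in> {- real n..real n} \<longrightarrow> k x = 0"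
    obtain n where "\<bar>x\<bar> \<le> real n" using real_arch_simple by blast
    then have "x \<in> {- real n..real n}" by auto
    then show "k x = 0" using * by blast
  qed
qed

section \<open>Square integrability and the inner product\<close>

text \<open>An arbitrary measure is allowed because the same algebra is needed for Lebesgue measure
  and for \<mu>.\<close>

definition sq_integrable :: "'a measure \<Rightarrow> ('a \<Rightarrow> complex) \<Rightarrow> bool" where
  "sq_integrable M f \<longleftrightarrow> f \<in> borel_measurable M \<and> integrable M (\<lambda>x. (cmod (f x))\<^sup>2)"

lemma L2_iff: "f \<in> L2 \<longleftrightarrow> sq_integrable lborel f"
  by (simp add: L2_def sq_integrable_def)

lemma borel_measurable_cnj [measurable]: "cnj \<in> borel_measurable borel"
  by (intro borel_measurable_continuous_onI continuous_intros)

lemma sq_integrable_prod: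
  assumes "sq_integrable M f" "sq_integrable M g"
  shows "integrable M (\<lambda>x. f x * cnj (g x))"
proof -
  have [measurable]: "f \<in> borel_measurable M" "g \<in> borel_measurable M"
    using assms by (auto simp: sq_integrable_def)
  have "integrable M (\<lambda>x. (cmod (f x))\<^sup>2 + (cmod (g x))\<^sup>2)"
    using assms by (auto simp: sq_integrable_def)
  then show ?thesis
  proof (rule Bochner_Integration.integrable_bound, goal_cases)
    case 2
    have "cmod (f x) * cmod (g x) \<le> (cmod (f x))\<^sup>2 + (cmod (g x))\<^sup>2" for x
      using sum_squares_bound[of "cmod (f x)" "cmod (g x)"]
        mult_nonneg_nonneg[OF norm_ge_zero[of "f x"] norm_ge_zero[of "g x"]] by linarith
    then show ?case by (auto simp: norm_mult)
  qed measurable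
qed

lemma sq_integrable_lincomb:
  assumes "sq_integrable M f" "sq_integrable M g"
  shows "sq_integrable M (\<lambda>x. a * f x + b * g x)"
proof -
  have [measurable]: "f \<in> borel_measurable M" "g \<in> borel_measurable M"
    using assms by (auto simp: sq_integrable_def)
  have "integrable M (\<lambda>x. 2 * (cmod a)\<^sup>2 * (cmod (f x))\<^sup>2 + 2 * (cmod b)\<^sup>2 * (cmod (g x))\<^sup>2)"
    using assms by (auto simp: sq_integrable_def)
  then have "integrable M (\<lambda>x. (cmod (a * f x + b * g x))\<^sup>2)"
  proof (rule Bochner_Integration.integrable_bound, goal_cases)
    case 2
    have "(cmod (a * f x + b * g x))\<^sup>2
      \<le> 2 * (cmod a)\<^sup>2 * (cmod (f x))\<^sup>2 + 2 * (cmod b)\<^sup>2 * (cmod (g x))\<^sup>2" for x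
    proof -
      have "(cmod (a * f x + b * g x))\<^sup>2 \<le> (cmod (a * f x) + cmod (b * g x))\<^sup>2"
        by (intro power_mono norm_triangle_ineq) auto
      also have "\<dots> \<le> 2 * (cmod (a * f x))\<^sup>2 + 2 * (cmod (b * g x))\<^sup>2"
        using sum_squares_bound[of "cmod (a * f x)" "cmod (b * g x)"] by (simp add: power2_sum)
      finally show ?thesis by (simp add: norm_mult power_mult_distrib)
    qed
    then show ?case by (auto intro!: AE_I2)
  qed measurable
  then show ?thesis by (simp add: sq_integrable_def)
qed

lemma sq_integrable_zero [simp]: "sq_integrable M (\<lambda>x. 0)"
  by (simp add: sq_integrable_def)

lemma sq_integrable_sum:
  assumes "finite I" "\<And>i. i \<in> I \<Longrightarrow> sq_integrable M (f i)"
  shows "sq_integrable M (\<lambda>x. \<Sum>i\<in>I. c i * f i x)"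
  using assms
proof (induction rule: finite_induct)
  case (insert i I)
  then show ?case
    using sq_integrable_lincomb[of M "f i" "\<lambda>x. \<Sum>i\<in>I. c i * f i x" "c i" 1] by simp
qed simp

lemma L2_lincomb: "f \<in> L2 \<Longrightarrow> g \<in> L2 \<Longrightarrow> (\<lambda>x. a * f x + b * g x) \<in> L2"
  unfolding L2_iff by (rule sq_integrable_lincomb)

lemma L2_sum: "finite I \<Longrightarrow> (\<And>i. i \<in> I \<Longrightarrow> f i \<in> L2) \<Longrightarrow> (\<lambda>x. \<Sum>i\<in>I. c i * f i x) \<in> L2"
  unfolding L2_iff by (rule sq_integrable_sum)

lemma L2_prod: "f \<in> L2 \<Longrightarrow> g \<in> L2 \<Longrightarrow> integrable lborel (\<lambda>x. f x * cnj (g x))"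
  unfolding L2_iff by (rule sq_integrable_prod)

lemma L2_zero: "(\<lambda>x. 0) \<in> L2"
  by (simp add: L2_iff)

lemma L2_measurable: "f \<in> L2 \<Longrightarrow> f \<in> borel_measurable lborel"
  by (simp add: L2_def)

lemma L2_inner_lincomb_left:
  assumes "f \<in> L2" "g \<in> L2" "h \<in> L2"
  shows "L2_inner (\<lambda>x. a * f x + b * g x) h = a * L2_inner f h + b * L2_inner g h"
proof -
  have "L2_inner (\<lambda>x. a * f x + b * g x) h
      = (LINT x|lborel. a * (f x * cnj (h x)) + b * (g x * cnj (h x)))"
    unfolding L2_inner_def by (simp add: algebra_simps)
  also have "\<dots> = a * L2_inner f h + b * L2_inner g h"
    unfolding L2_inner_def using assms by (simp add: L2_prod)
  finally show ?thesis .
qed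

lemma L2_inner_cnj: "L2_inner g f = cnj (L2_inner f g)"
  unfolding L2_inner_def by (subst Bochner_Integration.integral_cnj[symmetric]) (simp del: Bochner_Integration.integral_cnj add: mult.commute)

lemma L2_inner_lincomb_right:
  assumes "f \<in> L2" "g \<in> L2" "h \<in> L2"
  shows "L2_inner h (\<lambda>x. a * f x + b * g x) = cnj a * L2_inner h f + cnj b * L2_inner h g"
  using L2_inner_lincomb_left[OF assms, of a b]
  by (subst (1 2 3) L2_inner_cnj) simp

lemma L2_inner_cong:
  assumes "L2_eq f f'" "L2_eq g g'" "f \<in> L2" "f' \<in> L2" "g \<in> L2" "g' \<in> L2"
  shows "L2_inner f g = L2_inner f' g'"
  unfolding L2_inner_def
proof (rule integral_cong_AE)
  show "AE x in lborel. f x * cnj (g x) = f' x * cnj (g' x)"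
    using assms(1,2) unfolding L2_eq_def by eventually_elim simp
qed (use assms L2_measurable in auto)

lemma L2_inner_zero [simp]: "L2_inner (\<lambda>x. 0) f = 0" "L2_inner f (\<lambda>x. 0) = 0"
  by (simp_all add: L2_inner_def)

definition nsq :: "(real \<Rightarrow> complex) \<Rightarrow> real" where
  "nsq f = (LINT x|lborel. (cmod (f x))\<^sup>2)"

lemma mult_cnj_self: "z * cnj z = complex_of_real ((cmod z)\<^sup>2)"
  by (simp add: complex_mult_cnj cmod_power2)

lemma L2_inner_self: "L2_inner f f = complex_of_real (nsq f)"
  unfolding L2_inner_def nsq_def mult_cnj_self by (rule integral_complex_of_real)

lemma nsq_nonneg: "nsq f \<ge> 0"
  by (simp add: nsq_def)

lemma nsq_eq_0_iff: "f \<in> L2 \<Longrightarrow> nsq f = 0 \<longleftrightarrow> L2_eq f (\<lambda>x. 0)"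
  unfolding nsq_def L2_eq_def L2_def by (subst integral_nonneg_eq_0_iff_AE) auto

lemma L2_eq_refl [simp]: "L2_eq f f"
  by (simp add: L2_eq_def)

lemma L2_eq_sym: "L2_eq f g \<Longrightarrow> L2_eq g f"
  by (simp add: L2_eq_def eq_commute)

lemma L2_eq_trans [trans]: "L2_eq f g \<Longrightarrow> L2_eq g h \<Longrightarrow> L2_eq f h"
  unfolding L2_eq_def by (rule AE_mp, assumption, erule AE_mp) simp

lemma L2_eq_lincomb:
  "L2_eq f f' \<Longrightarrow> L2_eq g g' \<Longrightarrow> L2_eq (\<lambda>x. a * f x + b * g x) (\<lambda>x. a * f' x + b * g' x)"
  unfolding L2_eq_def by (rule AE_mp, assumption, erule AE_mp) simp

lemma nsq_cong: "L2_eq f g \<Longrightarrow> f \<in> L2 \<Longrightarrow> g \<in> L2 \<Longrightarrow> nsq f = nsq g"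
  using L2_inner_cong[of f g f g] by (simp add: L2_inner_self)

lemma nsq_zero [simp]: "nsq (\<lambda>x. 0) = 0"
  by (simp add: nsq_def)

text \<open>Testing against the difference of the two functions makes its squared norm vanish. This
  later turns the weak additivity of a spectral measure into an identity almost everywhere.\<close>

lemma L2_eq_of_inner:
  assumes "f \<in> L2" "g \<in> L2" "\<And>h. h \<in> L2 \<Longrightarrow> L2_inner f h = L2_inner g h"
  shows "L2_eq f g"
proof -
  \<comment> \<open>The trivial coefficients are written out so that the rules for linear
    combinations apply literally.\<close>
  define k where "k = (\<lambda>x. 1 * f x + (-1) * g x)"
  have k: "k \<in> L2" unfolding k_def using assms by (intro L2_lincomb)
  have "L2_inner k k = 1 * L2_inner f k + (-1) * L2_inner g k"
    unfolding k_def using assms(1,2) k[unfolded k_def] by (intro L2_inner_lincomb_left)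
  then have "nsq k = 0" using assms(3)[OF k] by (simp add: L2_inner_self)
  then have "L2_eq k (\<lambda>x. 0)" using nsq_eq_0_iff[OF k] by simp
  then show ?thesis unfolding L2_eq_def k_def by (rule AE_mp) (auto intro!: AE_I2)
qed

lemma L2_eq_sum:
  assumes "finite I" "\<And>i. i \<in> I \<Longrightarrow> L2_eq (f i) (g i)"
  shows "L2_eq (\<lambda>x. \<Sum>i\<in>I. c i * f i x) (\<lambda>x. \<Sum>i\<in>I. c i * g i x)"
proof -
  have "AE x in lborel. \<forall>i\<in>I. f i x = g i x"
    using assms by (simp add: L2_eq_def AE_finite_all)
  then show ?thesis unfolding L2_eq_def by eventually_elim simp
qed

section \<open>Weak derivatives and sesquilinearity of the form\<close>

lemma L2_set_integrable:
  assumes "f \<in> L2"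
  shows "set_integrable lborel {a..b} f"
proof -
  have [measurable]: "f \<in> borel_measurable borel" using assms by (simp add: L2_def)
  have "sq_integrable lborel (\<lambda>x. indicator {a..b} x :: complex)"
  proof -
    have "(\<lambda>x. (cmod (indicator {a..b} x :: complex))\<^sup>2) = indicat_real {a..b}"
      by (auto simp: indicator_def)
    then show ?thesis
      by (auto simp: sq_integrable_def emeasure_lborel_Icc_eq intro!: integrable_real_indicator)
  qed
  moreover have "(\<lambda>x. f x * cnj (indicator {a..b} x)) = (\<lambda>x. indicator {a..b} x *\<^sub>R f x)"
    by (auto simp: indicator_def fun_eq_iff)
  ultimately show ?thesis
    using sq_integrable_prod[of lborel f "indicator {a..b}"] assms
    by (simp add: set_integrable_def L2_iff)
qed

text \<open>Two derivatives have the same integral over every interval. As \<open>H1_deriv\<close>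
  is merely a chosen derivative, this makes \<open>form\<close> independent of the choice.\<close>

lemma has_H1_deriv_unique:
  assumes "has_H1_deriv f g" "has_H1_deriv f h"
  shows "L2_eq g h"
proof -
  have i: "set_integrable lborel {a..b} g" "set_integrable lborel {a..b} h" for a b
    using assms by (auto simp: has_H1_deriv_def intro: L2_set_integrable)
  have "AE x in lborel. g x - h x = 0"
  proof (rule AE_zero_of_interval_integrals)
    show "set_integrable lborel {a..b} (\<lambda>x. g x - h x)" for a b
      using i by (rule set_integral_diff)
    show "(LINT x:{a..b}|lborel. g x - h x) = 0" if "a \<le> b" for a b
    proof -
      have "(LINT x:{a..b}|lborel. g x) = (LINT x:{a..b}|lborel. h x)"
        using assms that unfolding has_H1_deriv_def by metis
      then show ?thesis by (simp add: set_integral_diff(2)[OF i])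
    qed
  qed
  then show ?thesis by (simp add: L2_eq_def)
qed

lemma has_H1_deriv_lincomb:
  assumes "has_H1_deriv f f'" "has_H1_deriv g g'"
  shows "has_H1_deriv (\<lambda>x. a * f x + b * g x) (\<lambda>x. a * f' x + b * g' x)"
proof -
  have "(LINT x:{u..v}|lborel. a * f' x + b * g' x)
      = a * (LINT x:{u..v}|lborel. f' x) + b * (LINT x:{u..v}|lborel. g' x)" for u v
  proof -
    have "set_integrable lborel {u..v} f'" "set_integrable lborel {u..v} g'"
      using assms by (auto simp: has_H1_deriv_def intro: L2_set_integrable)
    then show ?thesis by (subst set_integral_add) auto
  qed
  then show ?thesis
    using assms unfolding has_H1_deriv_def
    by (auto simp: L2_lincomb algebra_simps simp flip: right_diff_distrib)
qed

lemma has_H1_deriv_H1_deriv: "f \<in> H1 \<Longrightarrow> has_H1_deriv f (H1_deriv f)"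
  unfolding H1_def H1_deriv_def by (metis (mono_tags, lifting) mem_Collect_eq someI_ex)

lemma form_domain_lincomb:
  assumes "f \<in> form_domain \<mu>" "g \<in> form_domain \<mu>" "sets \<mu> = sets borel"
  shows "(\<lambda>x. a * f x + b * g x) \<in> form_domain \<mu>"
proof -
  have "sq_integrable \<mu> f" "sq_integrable \<mu> g"
    using assms measurable_cong_sets[OF assms(3) refl]
    by (auto simp: form_domain_def sq_integrable_def H1_def has_H1_deriv_def L2_def)
  from sq_integrable_lincomb[OF this, of a b] show ?thesis
    using assms(1,2) has_H1_deriv_lincomb
    unfolding form_domain_def H1_def sq_integrable_def by blast
qed

lemma form_domain_zero: "(\<lambda>x. 0) \<in> form_domain \<mu>"
proof -
  have "has_H1_deriv (\<lambda>x. 0) (\<lambda>x. 0)"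
    by (simp add: has_H1_deriv_def L2_zero set_lebesgue_integral_def)
  then show ?thesis by (auto simp: form_domain_def H1_def)
qed

lemma form_domain_sum:
  assumes "finite I" "\<And>i. i \<in> I \<Longrightarrow> f i \<in> form_domain \<mu>" "sets \<mu> = sets borel"
  shows "(\<lambda>x. \<Sum>i\<in>I. c i * f i x) \<in> form_domain \<mu>"
  using assms(1,2)
proof (induction rule: finite_induct)
  case (insert i I)
  then show ?case
    using form_domain_lincomb[OF _ _ assms(3), of "f i" "\<lambda>x. \<Sum>i\<in>I. c i * f i x" "c i" 1] by simp
qed (simp add: form_domain_zero)

lemma form_domain_sq:
  assumes "f \<in> form_domain \<mu>" "sets \<mu> = sets borel"
  shows "sq_integrable \<mu> f" "has_H1_deriv f (H1_deriv f)" "H1_deriv f \<in> L2" "f \<in> L2"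
proof -
  show 1: "has_H1_deriv f (H1_deriv f)"
    using assms(1) by (intro has_H1_deriv_H1_deriv) (simp add: form_domain_def)
  then show "H1_deriv f \<in> L2" "f \<in> L2" by (auto simp: has_H1_deriv_def)
  then show "sq_integrable \<mu> f"
    using assms measurable_cong_sets[OF assms(2) refl]
    by (auto simp: form_domain_def sq_integrable_def L2_def)
qed

lemma form_alt: "form \<mu> f g = L2_inner (H1_deriv f) (H1_deriv g) - (LINT x|\<mu>. f x * cnj (g x))"
  by (simp add: form_def L2_inner_def)

lemma form_cnj: "form \<mu> g f = cnj (form \<mu> f g)"
  unfolding form_def complex_cnj_diff
  by (subst (1 2) Bochner_Integration.integral_cnj[symmetric]) (simp del: Bochner_Integration.integral_cnj add: mult.commute)

text \<open>The chosen derivative of a combination agrees with the combination of the chosen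
  derivatives only almost everywhere, which suffices inside the inner product.\<close>

lemma form_lincomb_left:
  assumes "f \<in> form_domain \<mu>" "g \<in> form_domain \<mu>" "h \<in> form_domain \<mu>" "sets \<mu> = sets borel"
  shows "form \<mu> (\<lambda>x. a * f x + b * g x) h = a * form \<mu> f h + b * form \<mu> g h"
proof -
  note F = form_domain_sq[OF assms(1,4)]
  note G = form_domain_sq[OF assms(2,4)]
  note H = form_domain_sq[OF assms(3,4)]
  have C: "(\<lambda>x. a * f x + b * g x) \<in> form_domain \<mu>"
    using assms by (intro form_domain_lincomb)
  note C' = form_domain_sq[OF C assms(4)]
  have "L2_inner (H1_deriv (\<lambda>x. a * f x + b * g x)) (H1_deriv h)
      = L2_inner (\<lambda>x. a * H1_deriv f x + b * H1_deriv g x) (H1_deriv h)"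
    using F G H C' by (intro L2_inner_cong has_H1_deriv_unique[OF C'(2)] has_H1_deriv_lincomb)
      (auto intro: L2_lincomb)
  also have "\<dots> = a * L2_inner (H1_deriv f) (H1_deriv h) + b * L2_inner (H1_deriv g) (H1_deriv h)"
    using F G H by (intro L2_inner_lincomb_left)
  moreover have "(LINT x|\<mu>. (a * f x + b * g x) * cnj (h x))
      = a * (LINT x|\<mu>. f x * cnj (h x)) + b * (LINT x|\<mu>. g x * cnj (h x))"
  proof -
    have "(LINT x|\<mu>. (a * f x + b * g x) * cnj (h x))
        = (LINT x|\<mu>. a * (f x * cnj (h x)) + b * (g x * cnj (h x)))"
      by (simp add: algebra_simps)
    then show ?thesis
      using F G H by (simp add: sq_integrable_prod)
  qed
  ultimately show ?thesis by (simp add: form_alt algebra_simps)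
qed

lemma form_lincomb_right:
  assumes "f \<in> form_domain \<mu>" "g \<in> form_domain \<mu>" "h \<in> form_domain \<mu>" "sets \<mu> = sets borel"
  shows "form \<mu> h (\<lambda>x. a * f x + b * g x) = cnj a * form \<mu> h f + cnj b * form \<mu> h g"
  using form_lincomb_left[OF assms, of a b]
  by (subst (1 2 3) form_cnj) simp

text \<open>By uniqueness any explicit derivative may replace the chosen one; this is how the form
  is evaluated on tents.\<close>

lemma form_self:
  assumes "f \<in> form_domain \<mu>" "sets \<mu> = sets borel" "has_H1_deriv f f'"
  shows "form \<mu> f f = complex_of_real (nsq f' - (LINT x|\<mu>. (cmod (f x))\<^sup>2))"
proof -
  note F = form_domain_sq[OF assms(1,2)]
  have "L2_inner (H1_deriv f) (H1_deriv f) = L2_inner f' f'"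
    using F assms(3) by (intro L2_inner_cong has_H1_deriv_unique[OF F(2)])
      (auto simp: has_H1_deriv_def)
  then show ?thesis
    unfolding form_alt L2_inner_self mult_cnj_self integral_complex_of_real by simp
qed

section \<open>Energy estimates\<close>

text \<open>With values in \<open>ennreal\<close>, pieces can be added and compared before
  integrability is known.\<close>

definition energy :: "real measure \<Rightarrow> real set \<Rightarrow> (real \<Rightarrow> complex) \<Rightarrow> ennreal" where
  "energy M S f = (\<integral>\<^sup>+x\<in>S. ennreal ((cmod (f x))\<^sup>2) \<partial>M)"

lemma energy_mono: "S \<subseteq> T \<Longrightarrow> energy M S f \<le> energy M T f"
  unfolding energy_def by (rule nn_set_integral_set_mono)

lemma energy_UNIV_lborel: "f \<in> L2 \<Longrightarrow> energy lborel UNIV f = ennreal (nsq f)"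
  unfolding energy_def nsq_def by (simp add: L2_def nn_integral_eq_integral)

lemma energy_Un_le:
  assumes "sets M = sets borel" "S \<in> sets borel" "T \<in> sets borel" "f \<in> borel_measurable borel"
  shows "energy M (S \<union> T) f \<le> energy M S f + energy M T f"
proof -
  have [measurable]: "f \<in> borel_measurable M" "S \<in> sets M" "T \<in> sets M"
    using assms measurable_cong_sets[OF assms(1) refl] by auto
  have "energy M (S \<union> T) f \<le> (\<integral>\<^sup>+x. ennreal ((cmod (f x))\<^sup>2) * indicator S x
      + ennreal ((cmod (f x))\<^sup>2) * indicator T x \<partial>M)"
    unfolding energy_def by (intro nn_integral_mono) (auto simp: indicator_def)
  also have "\<dots> = energy M S f + energy M T f"
    unfolding energy_def by (intro nn_integral_add) measurable
  finally show ?thesis .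
qed

text \<open>The increment is the integral of \<open>f'\<close> over \<open>{x..y}\<close>;
  Cauchy-Schwarz against the indicator of that interval gives the factor
  \<open>y - x\<close>.\<close>

lemma H1_increment:
  assumes f: "has_H1_deriv f f'" and "x \<le> y" "{x..y} \<subseteq> S"
  shows "ennreal ((cmod (f y - f x))\<^sup>2) \<le> ennreal (y - x) * energy lborel S f'"
proof -
  have [measurable]: "f' \<in> borel_measurable borel" using f by (simp add: has_H1_deriv_def L2_def)
  have "f y - f x = (LINT t:{x..y}|lborel. f' t)"
    using f \<open>x \<le> y\<close> by (simp add: has_H1_deriv_def)
  then have "ennreal (cmod (f y - f x)) \<le> (\<integral>\<^sup>+t. norm (indicator {x..y} t *\<^sub>R f' t) \<partial>lborel)"
    using f integral_norm_bound_ennreal[OF L2_set_integrable[of f' x y, unfolded set_integrable_def]]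
    by (simp add: has_H1_deriv_def set_lebesgue_integral_def)
  also have "\<dots> = (\<integral>\<^sup>+t. indicator {x..y} t * (ennreal (cmod (f' t)) * indicator {x..y} t) \<partial>lborel)"
    by (intro nn_integral_cong) (auto simp: indicator_def)
  finally have "(ennreal (cmod (f y - f x)))\<^sup>2
      \<le> (\<integral>\<^sup>+t. indicator {x..y} t * (ennreal (cmod (f' t)) * indicator {x..y} t) \<partial>lborel)\<^sup>2"
    by (intro power_mono) auto
  also have "\<dots> \<le> (\<integral>\<^sup>+t. (indicator {x..y} t)\<^sup>2 \<partial>lborel)
      * (\<integral>\<^sup>+t. (ennreal (cmod (f' t)) * indicator {x..y} t)\<^sup>2 \<partial>lborel)"
    by (rule Cauchy_Schwarz_nn_integral) measurable
  also have "(\<integral>\<^sup>+t. (indicator {x..y} t)\<^sup>2 \<partial>lborel) = (\<integral>\<^sup>+t. indicator {x..y} t \<partial>lborel)"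
    by (intro nn_integral_cong) (auto simp: indicator_def)
  also have "\<dots> = ennreal (y - x)"
    using \<open>x \<le> y\<close> by simp
  also have "(\<integral>\<^sup>+t. (ennreal (cmod (f' t)) * indicator {x..y} t)\<^sup>2 \<partial>lborel) = energy lborel {x..y} f'"
    unfolding energy_def by (intro nn_integral_cong) (auto simp: indicator_def ennreal_power)
  also have "\<dots> \<le> energy lborel S f'"
    using assms(3) by (rule energy_mono)
  finally show ?thesis
    by (simp add: ennreal_power mult_left_mono)
qed

text \<open>Integrating on both sides of \<open>y\<close> gives half the sum of the squared
  distances to the two ends, and these distances add up to \<open>s\<close>.\<close>

lemma nn_integral_dist_le:
  fixes a s y :: real
  assumes "a \<le> y" "y \<le> a + s"
  shows "(\<integral>\<^sup>+x\<in>{a..<a + s}. ennreal \<bar>y - x\<bar> \<partial>lborel) \<le> ennreal (s\<^sup>2 / 2)"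
proof -
  have "(\<integral>\<^sup>+x\<in>{a..<a + s}. ennreal \<bar>y - x\<bar> \<partial>lborel)
      \<le> (\<integral>\<^sup>+x. ennreal (y - x) * indicator {a..y} x + ennreal (x - y) * indicator {y..a + s} x \<partial>lborel)"
    by (intro nn_integral_mono) (auto simp: indicator_def)
  also have "\<dots> = (\<integral>\<^sup>+x. ennreal (y - x) * indicator {a..y} x \<partial>lborel)
      + (\<integral>\<^sup>+x. ennreal (x - y) * indicator {y..a + s} x \<partial>lborel)"
    by (rule nn_integral_add) measurable
  also have "(\<integral>\<^sup>+x. ennreal (y - x) * indicator {a..y} x \<partial>lborel)
      = ennreal (- (y - y)\<^sup>2 / 2 - (- (y - a)\<^sup>2 / 2))"
    using assms by (intro nn_integral_FTC_Icc) (auto intro!: derivative_eq_intros simp: field_simps)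
  also have "(\<integral>\<^sup>+x. ennreal (x - y) * indicator {y..a + s} x \<partial>lborel)
      = ennreal ((a + s - y)\<^sup>2 / 2 - (y - y)\<^sup>2 / 2)"
    using assms by (intro nn_integral_FTC_Icc) (auto intro!: derivative_eq_intros simp: field_simps)
  also have "ennreal (- (y - y)\<^sup>2 / 2 - (- (y - a)\<^sup>2 / 2)) + ennreal ((a + s - y)\<^sup>2 / 2 - (y - y)\<^sup>2 / 2)
      = ennreal ((y - a)\<^sup>2 / 2 + (a + s - y)\<^sup>2 / 2)"
    by (simp add: ennreal_plus[symmetric] del: ennreal_plus)
  also have "\<dots> \<le> ennreal (s\<^sup>2 / 2)"
  proof (rule ennreal_leI)
    have "(y - a) * (a + s - y) \<ge> 0" using assms by simp
    then show "(y - a)\<^sup>2 / 2 + (a + s - y)\<^sup>2 / 2 \<le> s\<^sup>2 / 2"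
      by (simp add: power2_eq_square field_simps)
  qed
  finally show ?thesis .
qed

text \<open>The bound comes from averaging
  \<open>\<bar>f y\<bar>\<^sup>2 \<le> 2 \<bar>f x\<bar>\<^sup>2 + 2 \<bar>y - x\<bar> \<integral>\<bar>f'\<bar>\<^sup>2\<close> over \<open>x\<close> in the interval.\<close>

lemma H1_pointwise:
  assumes f: "has_H1_deriv f f'" and y: "y \<in> {a..<a + s}"
  shows "ennreal ((cmod (f y))\<^sup>2)
    \<le> ennreal (2 / s) * energy lborel {a..<a + s} f + ennreal s * energy lborel {a..<a + s} f'"
proof -
  let ?I = "{a..<a + s}"
  have s: "s > 0" using y by auto
  have [measurable]: "f \<in> borel_measurable borel" using f by (simp add: has_H1_deriv_def L2_def)
  define P where "P = energy lborel ?I f'"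
  have pt: "ennreal ((cmod (f y))\<^sup>2) \<le> 2 * ennreal ((cmod (f x))\<^sup>2) + 2 * P * ennreal \<bar>y - x\<bar>"
    if x: "x \<in> ?I" for x
  proof -
    have "ennreal ((cmod (f y - f x))\<^sup>2) \<le> ennreal \<bar>y - x\<bar> * P"
    proof (cases "x \<le> y")
      case True
      moreover have "{x..y} \<subseteq> ?I" using x y by auto
      ultimately show ?thesis unfolding P_def using H1_increment[OF f True, of ?I] by simp
    next
      case False
      then have "y \<le> x" by simp
      moreover have "{y..x} \<subseteq> ?I" using x y by auto
      ultimately show ?thesis unfolding P_def using H1_increment[OF f \<open>y \<le> x\<close>, of ?I]
        by (simp add: norm_minus_commute)
    qed
    moreover have "(cmod (f y))\<^sup>2 \<le> 2 * (cmod (f x))\<^sup>2 + 2 * (cmod (f y - f x))\<^sup>2"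
    proof -
      have "(cmod (f y))\<^sup>2 \<le> (cmod (f x) + cmod (f y - f x))\<^sup>2"
        using norm_triangle_ineq[of "f x" "f y - f x"] by (intro power_mono) auto
      also have "\<dots> \<le> 2 * (cmod (f x))\<^sup>2 + 2 * (cmod (f y - f x))\<^sup>2"
        using sum_squares_bound[of "cmod (f x)" "cmod (f y - f x)"] by (simp add: power2_sum)
      finally show ?thesis .
    qed
    then have "ennreal ((cmod (f y))\<^sup>2)
        \<le> 2 * ennreal ((cmod (f x))\<^sup>2) + 2 * ennreal ((cmod (f y - f x))\<^sup>2)"
      using ennreal_leI by (fastforce simp: ennreal_mult' ennreal_plus)
    ultimately show ?thesis
      by (smt (verit, ccfv_threshold) add_left_mono mult.assoc mult.commute mult_left_mono order_trans zero_le)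
  qed
  have "ennreal ((cmod (f y))\<^sup>2) * ennreal s = (\<integral>\<^sup>+x\<in>?I. ennreal ((cmod (f y))\<^sup>2) \<partial>lborel)"
    using s by (simp add: nn_integral_cmult_indicator)
  also have "\<dots> \<le> (\<integral>\<^sup>+x. 2 * (ennreal ((cmod (f x))\<^sup>2) * indicator ?I x)
      + 2 * P * (ennreal \<bar>y - x\<bar> * indicator ?I x) \<partial>lborel)"
    using pt by (intro nn_integral_mono) (auto simp: indicator_def)
  also have "\<dots> = 2 * energy lborel ?I f + 2 * P * (\<integral>\<^sup>+x\<in>?I. ennreal \<bar>y - x\<bar> \<partial>lborel)"
    unfolding energy_def by (simp add: nn_integral_add nn_integral_cmult)
  also have "\<dots> \<le> 2 * energy lborel ?I f + 2 * P * ennreal (s\<^sup>2 / 2)"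
    using y by (intro add_left_mono mult_left_mono nn_integral_dist_le) auto
  finally have "ennreal (1 / s) * (ennreal ((cmod (f y))\<^sup>2) * ennreal s)
      \<le> ennreal (1 / s) * (2 * energy lborel ?I f + 2 * P * ennreal (s\<^sup>2 / 2))"
    by (rule mult_left_mono) simp
  also have "ennreal (1 / s) * (ennreal ((cmod (f y))\<^sup>2) * ennreal s) = ennreal ((cmod (f y))\<^sup>2)"
    using s by (simp add: ennreal_mult[symmetric])
  also have "ennreal (1 / s) * (2 * energy lborel ?I f + 2 * P * ennreal (s\<^sup>2 / 2))
      = (ennreal (1 / s) * ennreal 2) * energy lborel ?I f
        + (ennreal (1 / s) * ennreal 2 * ennreal (s\<^sup>2 / 2)) * P"
    by (simp add: algebra_simps)
  also have "\<dots> = ennreal (2 / s) * energy lborel ?I f + ennreal s * P"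
    using s by (simp add: ennreal_mult[symmetric] power2_eq_square del: ennreal_numeral)
  finally show ?thesis by (simp add: P_def)
qed

section \<open>Summation over tiles of equal length\<close>

text \<open>The integers are enumerated by \<open>int_decode\<close>, so that sums over all tiles
  are series over the naturals.\<close>

definition tile :: "real \<Rightarrow> nat \<Rightarrow> real set" where
  "tile s n = {s * of_int (int_decode n)..<s * of_int (int_decode n) + s}"

text \<open>Membership determines the index, which yields disjointness and covering
  together.\<close>

lemma tile_floor:
  assumes "s > 0"
  shows "x \<in> tile s n \<longleftrightarrow> n = int_encode \<lfloor>x / s\<rfloor>"
proof -
  have "x \<in> tile s n \<longleftrightarrow> of_int (int_decode n) \<le> x / s \<and> x / s < of_int (int_decode n) + 1"
    using assms by (simp add: tile_def field_simps)
  also have "\<dots> \<longleftrightarrow> \<lfloor>x / s\<rfloor> = int_decode n"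
    by (simp add: floor_eq_iff)
  also have "\<dots> \<longleftrightarrow> n = int_encode \<lfloor>x / s\<rfloor>"
    by (metis int_decode_inverse int_encode_inverse)
  finally show ?thesis .
qed

lemma nn_integral_tiles:
  assumes "sets M = sets borel" "s > 0" "g \<in> borel_measurable M"
  shows "(\<integral>\<^sup>+x. g x \<partial>M) = (\<Sum>n. \<integral>\<^sup>+x\<in>tile s n. g x \<partial>M)"
proof -
  have d: "disjoint_family (tile s)"
    by (auto simp: disjoint_family_on_def tile_floor[OF assms(2)])
  have u: "(\<Union>n. tile s n) = UNIV"
    by (auto simp: tile_floor[OF assms(2)])
  have [measurable]: "tile s n \<in> sets M" for n
    by (simp add: assms(1) tile_def)
  note assms(3)[measurable]
  have "(\<integral>\<^sup>+x. g x \<partial>M) = (\<integral>\<^sup>+x. (\<Sum>n. g x * indicator (tile s n) x) \<partial>M)"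
    using suminf_indicator[OF d] u by (simp add: ennreal_suminf_cmult)
  also have "\<dots> = (\<Sum>n. \<integral>\<^sup>+x\<in>tile s n. g x \<partial>M)"
    by (rule nn_integral_suminf) measurable
  finally show ?thesis .
qed

text \<open>On each tile the pointwise bound is a constant, so integrating it over the part of
  \<open>S\<close> in the tile costs at most a factor \<open>m\<close>; the Lebesgue energies of the
  tiles then add up. With \<open>S = UNIV\<close> this gives semiboundedness, with the complement of
  the core it handles the light part in the upper bounds.\<close>

lemma energy_le_of_tiles:
  assumes M: "sets M = sets borel" and f: "has_H1_deriv f f'" and s: "s > 0"
    and S: "S \<in> sets borel" and m: "\<And>a. emeasure M (S \<inter> {a..<a + s}) \<le> m"
  shows "energy M S f
    \<le> m * (ennreal (2 / s) * energy lborel UNIV f + ennreal s * energy lborel UNIV f')"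
proof -
  have L: "f \<in> borel_measurable borel" "f' \<in> borel_measurable borel"
    using f by (auto simp: has_H1_deriv_def L2_def)
  have [measurable]: "f \<in> borel_measurable M" "S \<in> sets M"
    using L S measurable_cong_sets[OF M refl] M by auto
  note L[measurable]
  define K where "K n = ennreal (2 / s) * energy lborel (tile s n) f
      + ennreal s * energy lborel (tile s n) f'" for n
  have sum: "(\<Sum>n. energy lborel (tile s n) g) = energy lborel UNIV g" if "g \<in> borel_measurable borel" for g
    using nn_integral_tiles[of lborel s "\<lambda>x. ennreal ((cmod (g x))\<^sup>2)"] that s
    by (simp add: energy_def)
  have "energy M S f = (\<Sum>n. \<integral>\<^sup>+x\<in>tile s n. ennreal ((cmod (f x))\<^sup>2) * indicator S x \<partial>M)"
    unfolding energy_def using s M by (intro nn_integral_tiles) measurable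
  also have "\<dots> \<le> (\<Sum>n. m * K n)"
  proof (intro suminf_le summableI)
    fix n
    have [measurable]: "tile s n \<in> sets M" by (simp add: M tile_def)
    have "(\<integral>\<^sup>+x\<in>tile s n. ennreal ((cmod (f x))\<^sup>2) * indicator S x \<partial>M)
        \<le> (\<integral>\<^sup>+x. K n * indicator (S \<inter> tile s n) x \<partial>M)"
      using H1_pointwise[OF f, of _ "s * of_int (int_decode n)" s]
      by (intro nn_integral_mono) (auto simp: indicator_def K_def tile_def)
    also have "\<dots> = K n * emeasure M (S \<inter> tile s n)"
      by (rule nn_integral_cmult_indicator) measurable
    also have "\<dots> \<le> K n * m"
      unfolding tile_def by (intro mult_left_mono m) auto
    finally show "(\<integral>\<^sup>+x\<in>tile s n. ennreal ((cmod (f x))\<^sup>2) * indicator S x \<partial>M) \<le> m * K n"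
      by (simp add: mult.commute)
  qed
  also have "\<dots> = m * (ennreal (2 / s) * energy lborel UNIV f + ennreal s * energy lborel UNIV f')"
    unfolding ennreal_suminf_cmult K_def
    by (subst suminf_add[symmetric]) (auto simp: ennreal_suminf_cmult sum L)
  finally show ?thesis .
qed

lemma form_domain_energy:
  assumes "f \<in> form_domain \<mu>" "sets \<mu> = sets borel"
  shows "energy \<mu> UNIV f = ennreal (LINT x|\<mu>. (cmod (f x))\<^sup>2)"
  using assms by (simp add: form_domain_def energy_def nn_integral_eq_integral)

section \<open>Consequences of the Brinck condition for the form\<close>

lemma brinck_energy_bound:
  assumes "radon_measure \<mu>" "brinck_condition \<mu>"
  obtains K where "K \<ge> 0"
    "\<And>f f'. has_H1_deriv f f' \<Longrightarrow> energy \<mu> UNIV f \<le> ennreal (K * nsq f + nsq f')"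
proof -
  have M: "sets \<mu> = sets borel" using assms(1) by (simp add: radon_measure_def)
  obtain C where C: "C > 0" "\<And>x. emeasure \<mu> {x..x + 1} < ennreal C"
    using assms(2) by (auto simp: brinck_condition_def)
  \<comment> \<open>\<open>s \<le> 1\<close> puts a tile inside a unit window, and
    \<open>s \<le> 1 / C\<close> makes the coefficient \<open>C * s\<close> of \<open>nsq f'\<close>
    at most 1, so that the derivative term of the form absorbs it.\<close>
  define s where "s = min 1 (1 / C)"
  have s: "s > 0" "s \<le> 1" "s \<le> 1 / C" using C(1) by (auto simp: s_def)
  define K where "K = C * (2 / s)"
  show thesis
  proof (rule that)
    show "K \<ge> 0" using C(1) s(1) by (simp add: K_def)
  next
    fix f f' assume f: "has_H1_deriv f f'"
    then have L: "f \<in> L2" "f' \<in> L2" by (auto simp: has_H1_deriv_def)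
    have "emeasure \<mu> (UNIV \<inter> {a..<a + s}) \<le> ennreal C" for a
    proof -
      have "emeasure \<mu> (UNIV \<inter> {a..<a + s}) \<le> emeasure \<mu> {a..a + 1}"
        using s M by (intro emeasure_mono) auto
      then show ?thesis using C(2)[of a] by simp
    qed
    then have "energy \<mu> UNIV f \<le> ennreal C * (ennreal (2 / s) * ennreal (nsq f) + ennreal s * ennreal (nsq f'))"
      using energy_le_of_tiles[OF M f s(1), of UNIV "ennreal C"] L by (simp add: energy_UNIV_lborel)
    also have "\<dots> = ennreal (K * nsq f + C * s * nsq f')"
      using C(1) s(1) nsq_nonneg[of f] nsq_nonneg[of f']
      by (simp add: ennreal_mult[symmetric] ennreal_plus[symmetric] K_def algebra_simps del: ennreal_plus)
    also have "\<dots> \<le> ennreal (K * nsq f + nsq f')"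
    proof -
      have "C * s \<le> 1" using s(3) C(1) by (simp add: field_simps)
      then show ?thesis using nsq_nonneg[of f'] by (intro ennreal_leI add_left_mono mult_left_le_one_le) (use C s in auto)
    qed
    finally show "energy \<mu> UNIV f \<le> ennreal (K * nsq f + nsq f')" .
  qed
qed

text \<open>The energy bound makes integrability against \<mu> automatic, so a trial function only
  needs an explicit derivative.\<close>

lemma H1_subset_form_domain:
  assumes "radon_measure \<mu>" "brinck_condition \<mu>" "has_H1_deriv f f'"
  shows "f \<in> form_domain \<mu>"
proof -
  obtain K where "energy \<mu> UNIV f \<le> ennreal (K * nsq f + nsq f')"
    using brinck_energy_bound[OF assms(1,2)] assms(3) by metis
  then have "energy \<mu> UNIV f < \<infinity>"
    by (rule le_less_trans) simp
  moreover have "f \<in> borel_measurable \<mu>"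
    using assms(1,3) measurable_cong_sets[of \<mu> borel]
    by (auto simp: radon_measure_def has_H1_deriv_def L2_def)
  ultimately have "integrable \<mu> (\<lambda>x. (cmod (f x))\<^sup>2)"
    by (intro integrableI_bounded) (auto simp: energy_def)
  then show ?thesis using assms(3) by (auto simp: form_domain_def H1_def)
qed

lemma form_semibounded:
  assumes "radon_measure \<mu>" "brinck_condition \<mu>"
  obtains K where "K \<ge> 0" "\<And>f. f \<in> form_domain \<mu> \<Longrightarrow> Re (form \<mu> f f) \<ge> - K * nsq f"
proof -
  have M: "sets \<mu> = sets borel" using assms(1) by (simp add: radon_measure_def)
  obtain K where K: "K \<ge> 0"
    "\<And>f f'. has_H1_deriv f f' \<Longrightarrow> energy \<mu> UNIV f \<le> ennreal (K * nsq f + nsq f')"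
    using brinck_energy_bound[OF assms] by metis
  show thesis
  proof (rule that[OF K(1)])
    fix f assume f: "f \<in> form_domain \<mu>"
    note F = form_domain_sq[OF f M]
    have "ennreal (LINT x|\<mu>. (cmod (f x))\<^sup>2) \<le> ennreal (K * nsq f + nsq (H1_deriv f))"
      using K(2)[OF F(2)] form_domain_energy[OF f M] by simp
    then have "(LINT x|\<mu>. (cmod (f x))\<^sup>2) \<le> K * nsq f + nsq (H1_deriv f)"
      using K(1) nsq_nonneg by (subst (asm) ennreal_le_iff) auto
    then show "Re (form \<mu> f f) \<ge> - K * nsq f"
      using form_self[OF f M F(2)] by simp
  qed
qed

section \<open>Spectral subspaces and the form\<close>

text \<open>Gaussian elimination: an unknown \<open>j\<close> with nonzero coefficient in the
  equation at \<open>x\<close> is solved for, which removes one equation and one unknown.\<close>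

lemma homogeneous_system_nontrivial:
  fixes f :: "'i \<Rightarrow> 'x \<Rightarrow> 'a::field"
  assumes "finite X" "finite I" "card X < card I"
  shows "\<exists>c. (\<exists>i\<in>I. c i \<noteq> 0) \<and> (\<forall>x\<in>X. (\<Sum>i\<in>I. c i * f i x) = 0)"
  using assms
proof (induction X arbitrary: I f rule: finite_induct)
  case empty
  then have "I \<noteq> {}" by auto
  then show ?case by (intro exI[of _ "\<lambda>_. 1"]) auto
next
  case (insert x X)
  show ?case
  proof (cases "\<forall>i\<in>I. f i x = 0")
    case True
    then show ?thesis using insert.IH[of I f] insert.hyps insert.prems by auto
  next
    case False
    then obtain j where j: "j \<in> I" "f j x \<noteq> 0" by blast
    define g where "g i y = f i y - f i x / f j x * f j y" for i y
    have "card X < card (I - {j})"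
      using insert.prems insert.hyps j by (auto simp: card_Diff_singleton)
    then obtain c where c: "\<exists>i\<in>I - {j}. c i \<noteq> 0" "\<forall>y\<in>X. (\<Sum>i\<in>I - {j}. c i * g i y) = 0"
      using insert.IH[of "I - {j}" g] insert.prems by auto
    \<comment> \<open>The eliminated coefficient takes the value forced by the equation at
      \<open>x\<close>.\<close>
    define d where "d i = (if i = j then - (\<Sum>i\<in>I - {j}. c i * (f i x / f j x)) else c i)" for i
    have sum: "(\<Sum>i\<in>I. d i * f i y) = (\<Sum>i\<in>I - {j}. c i * g i y)" for y
    proof -
      have "(\<Sum>i\<in>I. d i * f i y) = d j * f j y + (\<Sum>i\<in>I - {j}. d i * f i y)"
        using j insert.prems by (intro sum.remove) auto
      also have "(\<Sum>i\<in>I - {j}. d i * f i y) = (\<Sum>i\<in>I - {j}. c i * f i y)"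
        by (intro sum.cong) (auto simp: d_def)
      also have "d j * f j y = - (\<Sum>i\<in>I - {j}. c i * (f i x / f j x * f j y))"
        by (simp add: d_def sum_distrib_right sum_distrib_left algebra_simps)
      finally show ?thesis
        by (simp add: g_def algebra_simps sum_subtractf)
    qed
    have "(\<Sum>i\<in>I. d i * f i x) = 0"
      unfolding sum using j by (simp add: g_def)
    moreover have "\<exists>i\<in>I. d i \<noteq> 0" using c(1) by (auto simp: d_def)
    ultimately show ?thesis using c(2) sum by (intro exI[of _ d]) auto
  qed
qed

section \<open>Calculus of the spectral projections\<close>

locale brinck_measure =
  fixes \<mu> :: "real measure"
  assumes radon: "radon_measure \<mu>" and brinck: "brinck_condition \<mu>"
begin

lemma sets_mu: "sets \<mu> = sets borel"
  using radon by (simp add: radon_measure_def)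

end

locale form_spectral = brinck_measure +
  fixes E :: "real set \<Rightarrow> (real \<Rightarrow> complex) \<Rightarrow> real \<Rightarrow> complex"
  assumes spectral: "spectral_measure_of (form_operator \<mu>) E"
begin

lemma pvm: "projection_valued_measure E"
  using spectral by (simp add: spectral_measure_of_def)

lemma proj: "A \<in> sets borel \<Longrightarrow> orthogonal_projection (E A)"
  using pvm[unfolded projection_valued_measure_def, THEN conjunct1] by blast

lemma proj_L2: "A \<in> sets borel \<Longrightarrow> f \<in> L2 \<Longrightarrow> E A f \<in> L2"
  using proj[of A, unfolded orthogonal_projection_def, THEN conjunct1] by blast

lemma proj_cong:
  "A \<in> sets borel \<Longrightarrow> f \<in> L2 \<Longrightarrow> g \<in> L2 \<Longrightarrow> L2_eq f g \<Longrightarrow> L2_eq (E A f) (E A g)"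
  using proj[of A, unfolded orthogonal_projection_def, THEN conjunct2, THEN conjunct1] by blast

lemma proj_lincomb:
  "A \<in> sets borel \<Longrightarrow> f \<in> L2 \<Longrightarrow> g \<in> L2
    \<Longrightarrow> L2_eq (E A (\<lambda>x. a * f x + b * g x)) (\<lambda>x. a * E A f x + b * E A g x)"
  using proj[of A, unfolded orthogonal_projection_def, THEN conjunct2, THEN conjunct2, THEN conjunct1] by blast

lemma proj_selfadjoint:
  "A \<in> sets borel \<Longrightarrow> f \<in> L2 \<Longrightarrow> g \<in> L2 \<Longrightarrow> L2_inner (E A f) g = L2_inner f (E A g)"
  using proj[of A, unfolded orthogonal_projection_def, THEN conjunct2, THEN conjunct2, THEN conjunct2, THEN conjunct2] by blast

lemma proj_Int:
  "A \<in> sets borel \<Longrightarrow> B \<in> sets borel \<Longrightarrow> f \<in> L2 \<Longrightarrow> L2_eq (E (A \<inter> B) f) (E A (E B f))"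
  using pvm[unfolded projection_valued_measure_def, THEN conjunct2, THEN conjunct2, THEN conjunct2, THEN conjunct1] by blast

lemma proj_empty: "f \<in> L2 \<Longrightarrow> L2_eq (E {} f) (\<lambda>x. 0)"
  using pvm[unfolded projection_valued_measure_def, THEN conjunct2, THEN conjunct1] by blast

lemma proj_UNIV: "f \<in> L2 \<Longrightarrow> L2_eq (E UNIV f) f"
  using pvm[unfolded projection_valued_measure_def, THEN conjunct2, THEN conjunct2, THEN conjunct1] by blast

lemma proj_sums:
  "range A \<subseteq> sets borel \<Longrightarrow> disjoint_family A \<Longrightarrow> f \<in> L2 \<Longrightarrow> g \<in> L2
    \<Longrightarrow> (\<lambda>n. L2_inner (E (A n) f) g) sums L2_inner (E (\<Union>n. A n) f) g"
  for A :: "nat \<Rightarrow> real set"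
  using pvm[unfolded projection_valued_measure_def, THEN conjunct2, THEN conjunct2, THEN conjunct2, THEN conjunct2] by blast

lemma proj_zero: "A \<in> sets borel \<Longrightarrow> L2_eq (E A (\<lambda>x. 0)) (\<lambda>x. 0)"
  using proj_lincomb[of A "\<lambda>x. 0" "\<lambda>x. 0" 0 0] by (simp add: L2_zero)

text \<open>Idempotence, obtained from \<open>A \<inter> A = A\<close>, and self-adjointness turn
  the values of the scalar spectral measure into squared norms.\<close>

lemma proj_inner_self:
  assumes "A \<in> sets borel" "f \<in> L2"
  shows "L2_inner (E A f) f = complex_of_real (nsq (E A f))"
proof -
  have "L2_inner (E A f) f = L2_inner (E (A \<inter> A) f) f" by simp
  also have "\<dots> = L2_inner (E A (E A f)) f"
    using proj_Int[OF assms(1,1,2)] assms by (intro L2_inner_cong proj_L2) auto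
  also have "\<dots> = L2_inner (E A f) (E A f)"
    by (intro proj_selfadjoint assms proj_L2)
  finally show ?thesis by (simp add: L2_inner_self)
qed

section \<open>Scalar spectral measures\<close>

abbreviation "sm \<equiv> scalar_spectral_measure E"

lemma sets_sm [simp, measurable_cong]: "sets (sm f) = sets borel"
  using sets.sets_measure_of_eq[of "borel :: real measure"]
  by (simp add: scalar_spectral_measure_def)

lemma space_sm [simp]: "space (sm f) = UNIV"
  using sets_eq_imp_space_eq[OF sets_sm] by simp

text \<open>\<open>measure_of\<close> returns the prescribed values only after positivity and
  countable additivity are checked. The latter is the weak countable additivity of \<open>E\<close>
  with \<open>f\<close> tested against itself.\<close>

lemma emeasure_sm:
  assumes f: "f \<in> L2" and A: "A \<in> sets borel"
  shows "emeasure (sm f) A = ennreal (nsq (E A f))"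
proof -
  have eq: "ennreal (Re (L2_inner (E B f) f)) = ennreal (nsq (E B f))" if "B \<in> sets borel" for B
    using that f by (simp add: proj_inner_self)
  have "emeasure (sm f) A = ennreal (Re (L2_inner (E A f) f))"
  proof (rule emeasure_measure_of[OF scalar_spectral_measure_def])
    show "sets borel \<subseteq> Pow (UNIV :: real set)" by simp
    show "A \<in> sets (sm f)" using A by simp
    show "positive (sets (sm f)) (\<lambda>A. ennreal (Re (L2_inner (E A f) f)))"
      using nsq_cong[OF proj_empty[OF f] proj_L2[OF _ f] L2_zero]
      by (simp add: positive_def eq)
    show "countably_additive (sets (sm f)) (\<lambda>A. ennreal (Re (L2_inner (E A f) f)))"
    proof (rule countably_additiveI)
      fix B :: "nat \<Rightarrow> real set"
      assume B: "range B \<subseteq> sets (sm f)" "disjoint_family B" "(\<Union>i. B i) \<in> sets (sm f)"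
      have "(\<lambda>i. L2_inner (E (B i) f) f) sums L2_inner (E (\<Union>i. B i) f) f"
        using B f by (intro proj_sums) auto
      then have "(\<lambda>i. Re (L2_inner (E (B i) f) f)) sums Re (L2_inner (E (\<Union>i. B i) f) f)"
        by (rule sums_Re)
      moreover have "Re (L2_inner (E (B i) f) f) \<ge> 0" for i
        using B(1) f nsq_nonneg by (subst proj_inner_self) auto
      ultimately show "(\<Sum>i. ennreal (Re (L2_inner (E (B i) f) f)))
          = ennreal (Re (L2_inner (E (\<Union>i. B i) f) f))"
        by (intro suminf_ennreal_eq)
    qed
  qed
  then show ?thesis using eq A by simp
qed

lemma measure_sm: "f \<in> L2 \<Longrightarrow> A \<in> sets borel \<Longrightarrow> measure (sm f) A = nsq (E A f)"
  using emeasure_sm[of f A] nsq_nonneg by (simp add: measure_def)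

lemma measure_sm_UNIV: "f \<in> L2 \<Longrightarrow> measure (sm f) UNIV = nsq f"
  using measure_sm[of f UNIV] nsq_cong[OF proj_UNIV proj_L2] by simp

lemma finite_measure_sm: "f \<in> L2 \<Longrightarrow> finite_measure (sm f)"
  by (intro finite_measureI) (simp add: emeasure_sm)

text \<open>Finite additivity comes from the countable one by padding with empty sets; as that holds
  only weakly, both sides are tested against all \<open>h\<close>.\<close>

lemma proj_Un:
  assumes "A \<in> sets borel" "B \<in> sets borel" "A \<inter> B = {}" "f \<in> L2"
  shows "L2_eq (E (A \<union> B) f) (\<lambda>x. 1 * E A f x + 1 * E B f x)"
proof (rule L2_eq_of_inner)
  show "E (A \<union> B) f \<in> L2" using assms by (intro proj_L2) auto
  show "(\<lambda>x. 1 * E A f x + 1 * E B f x) \<in> L2" using assms by (intro L2_lincomb proj_L2)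
  fix h assume h: "h \<in> L2"
  define C :: "nat \<Rightarrow> real set" where "C n = (if n = 0 then A else if n = 1 then B else {})" for n
  have "(\<lambda>n. L2_inner (E (C n) f) h) sums L2_inner (E (\<Union>n. C n) f) h"
    using assms h by (intro proj_sums) (auto simp: C_def disjoint_family_on_def)
  moreover have "(\<Union>n. C n) = A \<union> B"
    by (auto simp: C_def split: if_splits)
  moreover have "(\<lambda>n. L2_inner (E (C n) f) h) sums (\<Sum>n\<in>{0,1}. L2_inner (E (C n) f) h)"
  proof (rule sums_finite)
    fix n :: nat assume "n \<notin> {0, 1}"
    then show "L2_inner (E (C n) f) h = 0"
      using L2_inner_cong[OF proj_empty[OF assms(4)] L2_eq_refl[of h]] h assms
      by (simp add: C_def proj_L2 L2_zero)
  qed simp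
  ultimately have "L2_inner (E (A \<union> B) f) h = (\<Sum>n\<in>{0,1}. L2_inner (E (C n) f) h)"
    by (metis sums_unique2)
  also have "\<dots> = L2_inner (\<lambda>x. 1 * E A f x + 1 * E B f x) h"
    using assms h by (subst L2_inner_lincomb_left) (auto simp: C_def proj_L2)
  finally show "L2_inner (E (A \<union> B) f) h = L2_inner (\<lambda>x. 1 * E A f x + 1 * E B f x) h" .
qed

lemma proj_disjoint_zero:
  assumes "A \<in> sets borel" "B \<in> sets borel" "A \<inter> B = {}" "f \<in> L2" "L2_eq (E A f) f"
  shows "L2_eq (E B f) (\<lambda>x. 0)"
proof -
  have "L2_eq (E B f) (E B (E A f))"
    using assms by (intro proj_cong proj_L2 L2_eq_sym[OF assms(5)])
  also have "L2_eq (E B (E A f)) (E (B \<inter> A) f)"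
    using assms by (intro L2_eq_sym[OF proj_Int])
  finally (L2_eq_trans) show ?thesis
    using proj_empty[OF assms(4)] assms(3) L2_eq_trans by (simp add: Int_commute)
qed

lemma proj_subset_fixed:
  assumes "A \<in> sets borel" "B \<in> sets borel" "A \<subseteq> B" "f \<in> L2"
  shows "L2_eq (E B (E A f)) (E A f)"
proof -
  have "B \<inter> A = A" using assms(3) by blast
  then show ?thesis using proj_Int[OF assms(2,1,4)] by (simp add: L2_eq_sym)
qed

lemma AE_sm:
  assumes "A \<in> sets borel" "f \<in> L2" "L2_eq (E A f) f"
  shows "AE t in sm f. t \<in> A"
proof -
  have "nsq (E (- A) f) = 0"
    using nsq_cong[OF proj_disjoint_zero[of A "- A" f] proj_L2 L2_zero] assms by auto
  then have "- A \<in> null_sets (sm f)"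
    using assms by (simp add: null_sets_def emeasure_sm)
  then show ?thesis using AE_not_in by fastforce
qed

section \<open>The operator and its spectral representation\<close>

lemma in_domain_iff: "f \<in> L2 \<Longrightarrow> (\<exists>h. (f, h) \<in> form_operator \<mu>) \<longleftrightarrow> integrable (sm f) (\<lambda>t. t\<^sup>2)"
  using spectral[unfolded spectral_measure_of_def, THEN conjunct2, THEN conjunct1] by blast

lemma inner_eq_integral:
  "(f, h) \<in> form_operator \<mu> \<Longrightarrow> L2_inner h f = complex_of_real (LINT t|sm f. t)"
  using spectral[unfolded spectral_measure_of_def, THEN conjunct2, THEN conjunct2] by blast

lemma operator_L2: "(f, h) \<in> form_operator \<mu> \<Longrightarrow> f \<in> L2 \<and> h \<in> L2"
  by (simp add: form_operator_def)

lemma integrable_sm_id: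
  assumes "(f, h) \<in> form_operator \<mu>"
  shows "integrable (sm f) (\<lambda>t. t)"
proof -
  have f: "f \<in> L2" using operator_L2 assms by blast
  interpret finite_measure "sm f" using f by (rule finite_measure_sm)
  have "integrable (sm f) (\<lambda>t. 1 + t\<^sup>2)" using in_domain_iff[OF f] assms by auto
  then show ?thesis
  proof (rule Bochner_Integration.integrable_bound, goal_cases)
    case 2
    have "\<bar>t\<bar> \<le> 1 + t\<^sup>2" for t :: real
    proof -
      have "0 \<le> (\<bar>t\<bar> - 1)\<^sup>2" by simp
      then show ?thesis by (simp add: power2_eq_square algebra_simps abs_if split: if_splits)
    qed
    then show ?case by (auto intro!: AE_I2)
  qed simp
qed

text \<open>The scalar spectral measure is finite and carried by \<open>A\<close>, where the square
  of \<open>t\<close> is bounded. This is the source of vectors in the operator domain.\<close>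

lemma bounded_in_domain:
  assumes "A \<in> sets borel" "A \<subseteq> {- R..R}" "f \<in> L2" "L2_eq (E A f) f"
  shows "\<exists>h. (f, h) \<in> form_operator \<mu>"
proof -
  interpret finite_measure "sm f" using assms(3) by (rule finite_measure_sm)
  have "AE t in sm f. t \<in> A" using assms by (intro AE_sm)
  then have "AE t in sm f. norm (t\<^sup>2) \<le> R\<^sup>2"
  proof (rule AE_mp, intro AE_I2 impI)
    fix t assume "t \<in> A"
    then have "t \<in> {- R..R}" using assms(2) by blast
    then have "\<bar>t\<bar> \<le> R" by auto
    then have "\<bar>t\<bar>\<^sup>2 \<le> R\<^sup>2" by (intro power_mono) auto
    then show "norm (t\<^sup>2) \<le> R\<^sup>2" by simp
  qed
  then have "integrable (sm f) (\<lambda>t. t\<^sup>2)" by (intro integrable_const_bound) auto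
  then show ?thesis using in_domain_iff assms by blast
qed

text \<open>Linearity is read off from the form, because the spectral description of the operator
  only fixes quadratic quantities.\<close>

lemma operator_lincomb:
  assumes "(f, h) \<in> form_operator \<mu>" "(g, k) \<in> form_operator \<mu>"
  shows "((\<lambda>x. a * f x + b * g x), (\<lambda>x. a * h x + b * k x)) \<in> form_operator \<mu>"
proof -
  obtain r where r: "r \<in> form_domain \<mu>" "L2_eq f r" "\<And>v. v \<in> form_domain \<mu> \<Longrightarrow> form \<mu> r v = L2_inner h v"
    using assms(1) by (auto simp: form_operator_def)
  obtain p where p: "p \<in> form_domain \<mu>" "L2_eq g p" "\<And>v. v \<in> form_domain \<mu> \<Longrightarrow> form \<mu> p v = L2_inner k v"
    using assms(2) by (auto simp: form_operator_def)
  have L: "f \<in> L2" "g \<in> L2" "h \<in> L2" "k \<in> L2" using operator_L2 assms by auto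
  have "form \<mu> (\<lambda>x. a * r x + b * p x) v = L2_inner (\<lambda>x. a * h x + b * k x) v"
    if v: "v \<in> form_domain \<mu>" for v
    using form_lincomb_left[OF r(1) p(1) v sets_mu] L2_inner_lincomb_left[OF L(3,4)]
      r(3) p(3) v form_domain_sq[OF v sets_mu] by simp
  moreover have "L2_eq (\<lambda>x. a * f x + b * g x) (\<lambda>x. a * r x + b * p x)"
    using r(2) p(2) by (rule L2_eq_lincomb)
  ultimately show ?thesis
    using L r(1) p(1) form_domain_lincomb[OF r(1) p(1) sets_mu]
    unfolding form_operator_def by (auto intro!: L2_lincomb bexI)
qed

lemma form_zero_left: "v \<in> form_domain \<mu> \<Longrightarrow> form \<mu> (\<lambda>x. 0) v = 0"
  using form_lincomb_left[OF form_domain_zero form_domain_zero _ sets_mu, of v 0 0] by simp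

lemma operator_zero: "((\<lambda>x. 0), (\<lambda>x. 0)) \<in> form_operator \<mu>"
  using form_domain_zero[of \<mu>] form_zero_left unfolding form_operator_def
  by (auto simp: L2_zero intro!: bexI[of _ "\<lambda>x. 0"])

section \<open>Orthogonality across complementary spectral sets\<close>

text \<open>For the sum \<open>w\<close> of the two vectors \<open>E A w\<close> is
  \<open>u\<close>, so \<open>E B u\<close> and \<open>E (B \<inter> A) w\<close> agree. This allows
  spectral integrals of \<open>w\<close> to be split along \<open>A\<close> and its
  complement.\<close>

lemma sm_restrict:
  assumes A: "A \<in> sets borel" and u: "u \<in> L2" "L2_eq (E A u) u"
    and v: "v \<in> L2" "L2_eq (E A v) (\<lambda>x. 0)"
  shows "sm u = density (sm (\<lambda>x. 1 * u x + 1 * v x)) (indicator A)"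
proof (rule measure_eqI)
  fix B assume "B \<in> sets (sm u)"
  then have B: "B \<in> sets borel" by simp
  define w where "w = (\<lambda>x. 1 * u x + 1 * v x)"
  have w: "w \<in> L2" unfolding w_def using u v by (intro L2_lincomb)
  have "L2_eq (E A w) (\<lambda>x. 1 * E A u x + 1 * E A v x)"
    unfolding w_def using A u v by (intro proj_lincomb)
  also have "L2_eq \<dots> (\<lambda>x. 1 * u x + 1 * 0)"
    by (intro L2_eq_lincomb u v)
  finally (L2_eq_trans) have w_u: "L2_eq (E A w) u" by simp
  have "L2_eq (E (B \<inter> A) w) (E B (E A w))"
    using A B w by (intro proj_Int)
  also have "L2_eq \<dots> (E B u)"
    using A B w u by (intro proj_cong proj_L2 w_u)
  finally (L2_eq_trans) have "nsq (E (B \<inter> A) w) = nsq (E B u)"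
    using A B w u by (intro nsq_cong proj_L2) auto
  moreover have "emeasure (density (sm w) (indicator A)) B = emeasure (sm w) (B \<inter> A)"
    using A B by (subst emeasure_density) (auto simp: indicator_inter_arith[symmetric] Int_commute
        simp del: indicator_inter_arith)
  ultimately show "emeasure (sm u) B = emeasure (density (sm (\<lambda>x. 1 * u x + 1 * v x)) (indicator A)) B"
    unfolding w_def[symmetric] using A B w u by (simp add: emeasure_sm)
qed simp

text \<open>The spectral integral of the sum \<open>w\<close> splits along \<open>A\<close> and
  \<open>- A\<close> into those of \<open>u\<close> and \<open>v\<close>. Expanding the inner
  product of its image \<open>m\<close> with \<open>w\<close> therefore leaves exactly the cross
  terms.\<close>

lemma operator_orthogonal_add:
  assumes A: "A \<in> sets borel"
    and u: "(u, h) \<in> form_operator \<mu>" "L2_eq (E A u) u"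
    and v: "(v, k) \<in> form_operator \<mu>" "L2_eq (E (- A) v) v"
  shows "L2_inner h v + L2_inner k u = 0"
proof -
  have L: "u \<in> L2" "h \<in> L2" "v \<in> L2" "k \<in> L2" using operator_L2 u v by auto
  have A': "- A \<in> sets borel" using A by auto
  define w where "w = (\<lambda>x. 1 * u x + 1 * v x)"
  define m where "m = (\<lambda>x. 1 * h x + 1 * k x)"
  have T: "(w, m) \<in> form_operator \<mu>"
    unfolding w_def m_def using u v by (intro operator_lincomb)
  then have Lw: "w \<in> L2" "m \<in> L2" using operator_L2 by auto
  have "L2_eq (E A v) (\<lambda>x. 0)" "L2_eq (E (- A) u) (\<lambda>x. 0)"
    using proj_disjoint_zero[of "- A" A v] proj_disjoint_zero[of A "- A" u] A A' L u v by auto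
  then have d: "sm u = density (sm w) (indicator A)" "sm v = density (sm w) (indicator (- A))"
    using sm_restrict[OF A, of u v] sm_restrict[OF A', of v u] L u v
    by (auto simp: w_def add.commute)
  note int = integrable_sm_id[OF T]
  have 1: "(LINT t|sm u. t) = (LINT t|sm w. indicator A t * t)"
    unfolding d using A by (subst integral_real_density[symmetric]) (auto simp: ennreal_indicator)
  have 2: "(LINT t|sm v. t) = (LINT t|sm w. indicator (- A) t * t)"
    unfolding d using A by (subst integral_real_density[symmetric]) (auto simp: ennreal_indicator)
  have "(LINT t|sm w. t) = (LINT t|sm w. indicator A t * t + indicator (- A) t * t)"
    by (rule Bochner_Integration.integral_cong) (auto simp: indicator_def)
  also have "\<dots> = (LINT t|sm u. t) + (LINT t|sm v. t)"
    unfolding 1 2 using A integrable_mult_indicator[OF _ int]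
    by (intro Bochner_Integration.integral_add) auto
  finally have "L2_inner m w = L2_inner h u + L2_inner k v"
    using inner_eq_integral[OF T] inner_eq_integral[OF u(1)] inner_eq_integral[OF v(1)] by simp
  moreover have "L2_inner m w = L2_inner h u + L2_inner h v + L2_inner k u + L2_inner k v"
  proof -
    have "L2_inner m w = 1 * L2_inner h w + 1 * L2_inner k w"
      unfolding m_def using L Lw by (intro L2_inner_lincomb_left)
    moreover have "L2_inner h w = cnj 1 * L2_inner h u + cnj 1 * L2_inner h v"
      unfolding w_def using L by (intro L2_inner_lincomb_right)
    moreover have "L2_inner k w = cnj 1 * L2_inner k u + cnj 1 * L2_inner k v"
      unfolding w_def using L by (intro L2_inner_lincomb_right)
    ultimately show ?thesis by simp
  qed
  ultimately show ?thesis by simp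
qed

text \<open>Polarization of the quadratic form only yields a symmetric identity; replacing \<open>v\<close> by
  \<open>\<i> v\<close> separates its two terms.\<close>

lemma operator_orthogonal_domain:
  assumes A: "A \<in> sets borel"
    and u: "(u, h) \<in> form_operator \<mu>" "L2_eq (E A u) u"
    and v: "(v, k) \<in> form_operator \<mu>" "L2_eq (E (- A) v) v"
  shows "L2_inner h v = 0"
proof -
  have L: "u \<in> L2" "h \<in> L2" "v \<in> L2" "k \<in> L2" using operator_L2 u v by auto
  define w where "w = (\<lambda>x. \<i> * v x + 0 * v x)"
  define m where "m = (\<lambda>x. \<i> * k x + 0 * k x)"
  have T: "(w, m) \<in> form_operator \<mu>"
    unfolding w_def m_def using v by (intro operator_lincomb)
  have "L2_eq (E (- A) w) (\<lambda>x. \<i> * E (- A) v x + 0 * E (- A) v x)"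
    unfolding w_def using A L by (intro proj_lincomb) auto
  also have "L2_eq \<dots> w"
    unfolding w_def by (intro L2_eq_lincomb v)
  finally (L2_eq_trans) have "L2_inner h w + L2_inner m u = 0"
    using A u T by (intro operator_orthogonal_add)
  moreover have "L2_inner h w = - \<i> * L2_inner h v"
    unfolding w_def using L by (subst L2_inner_lincomb_right) auto
  moreover have "L2_inner m u = \<i> * L2_inner k u"
    unfolding m_def using L by (subst L2_inner_lincomb_left) auto
  ultimately have "\<i> * (L2_inner k u - L2_inner h v) = 0" by (simp add: algebra_simps)
  then have "L2_inner k u = L2_inner h v" by simp
  then show ?thesis using operator_orthogonal_add[OF A u v] by simp
qed

text \<open>\<open>E (- A) f\<close> need not lie in the domain, so it is cut into pieces with bounded spectral
  support.\<close>

lemma operator_orthogonal: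
  assumes A: "A \<in> sets borel"
    and u: "(u, h) \<in> form_operator \<mu>" "L2_eq (E A u) u" and f: "f \<in> L2"
  shows "L2_inner h (E (- A) f) = 0"
proof -
  define P where "P n = {t. nat \<lfloor>\<bar>t\<bar>\<rfloor> = n} \<inter> - A" for n
  have [measurable]: "A \<in> sets borel" by fact
  have P: "P n \<in> sets borel" for n
    unfolding P_def by measurable
  have h: "h \<in> L2" using u operator_L2 by blast
  have zero: "L2_inner h (E (P n) f) = 0" for n
  proof -
    have "P n \<subseteq> {- real (Suc n)..real (Suc n)}"
    proof
      fix t assume "t \<in> P n"
      then have "\<bar>t\<bar> < real n + 1" by (auto simp: P_def)
      then show "t \<in> {- real (Suc n)..real (Suc n)}" by auto
    qed
    then obtain k where k: "(E (P n) f, k) \<in> form_operator \<mu>"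
      using bounded_in_domain[OF P _ proj_L2[OF P f] proj_subset_fixed[OF P P order_refl f]] by blast
    moreover have "L2_eq (E (- A) (E (P n) f)) (E (P n) f)"
      using A by (intro proj_subset_fixed P f) (auto simp: P_def)
    ultimately show ?thesis
      using operator_orthogonal_domain[OF A u] by blast
  qed
  have "(\<lambda>n. L2_inner (E (P n) f) h) sums L2_inner (E (\<Union>n. P n) f) h"
    using P f h by (intro proj_sums) (auto simp: disjoint_family_on_def P_def)
  moreover have "(\<Union>n. P n) = - A" by (auto simp: P_def)
  moreover have "L2_inner (E (P n) f) h = 0" for n
    using zero[of n] by (subst L2_inner_cnj) simp
  ultimately have "L2_inner (E (- A) f) h = 0"
    by (simp add: sums_iff)
  then show ?thesis by (subst L2_inner_cnj) simp
qed

section \<open>Form values and spectral thresholds\<close>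

text \<open>The integrand is below \<open>s\<close> almost everywhere on a measure of positive total
  mass \<open>nsq u\<close>. The strictness is what later contradicts lower bounds for the
  form.\<close>

lemma integral_sm_less:
  assumes A: "A \<in> sets borel" "A \<subseteq> {..<s}"
    and u: "(u, h) \<in> form_operator \<mu>" "L2_eq (E A u) u" "nsq u \<noteq> 0"
  shows "(LINT t|sm u. t) < s * nsq u"
proof -
  have L: "u \<in> L2" using u operator_L2 by blast
  interpret finite_measure "sm u" using L by (rule finite_measure_sm)
  have "(LINT t|sm u. t) < (LINT t|sm u. s)"
  proof (rule integral_less_AE_space)
    show "AE t in sm u. t < s"
      using AE_sm[OF A(1) L u(2)] by (rule AE_mp) (use A(2) in \<open>auto intro!: AE_I2\<close>)
    show "emeasure (sm u) (space (sm u)) \<noteq> 0"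
      using measure_sm_UNIV[OF L] u(3) by (auto simp: measure_def)
  qed (use integrable_sm_id u in auto)
  then show ?thesis using measure_sm_UNIV[OF L] by (simp add: mult.commute)
qed

lemma integral_sm_ge:
  assumes A: "A \<in> sets borel" "A \<subseteq> {s..}"
    and u: "(u, h) \<in> form_operator \<mu>" "L2_eq (E A u) u"
  shows "(LINT t|sm u. t) \<ge> s * nsq u"
proof -
  have L: "u \<in> L2" using u operator_L2 by blast
  interpret finite_measure "sm u" using L by (rule finite_measure_sm)
  have "(LINT t|sm u. s) \<le> (LINT t|sm u. t)"
  proof (rule integral_mono_AE)
    show "AE t in sm u. s \<le> t"
      using AE_sm[OF A(1) L u(2)] by (rule AE_mp) (use A(2) in \<open>auto intro!: AE_I2\<close>)
  qed (use integrable_sm_id u in auto)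
  then show ?thesis using measure_sm_UNIV[OF L] by (simp add: mult.commute)
qed

text \<open>The graph is closed under equality almost everywhere, whereas the form and point
  evaluations need a representative in the form domain; later arguments use \<open>r\<close> in
  place of \<open>u\<close>.\<close>

lemma operator_representative:
  assumes "(u, h) \<in> form_operator \<mu>"
  obtains r where "r \<in> form_domain \<mu>" "r \<in> L2" "L2_eq u r" "nsq r = nsq u"
    "\<And>g. g \<in> form_domain \<mu> \<Longrightarrow> form \<mu> r g = L2_inner h g" "form \<mu> r r = complex_of_real (LINT t|sm u. t)"
proof -
  obtain r where r: "r \<in> form_domain \<mu>" "L2_eq u r" "\<And>g. g \<in> form_domain \<mu> \<Longrightarrow> form \<mu> r g = L2_inner h g"
    using assms by (auto simp: form_operator_def)
  have L: "u \<in> L2" "h \<in> L2" "r \<in> L2" using assms operator_L2 form_domain_sq[OF r(1) sets_mu] by auto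
  have "form \<mu> r r = L2_inner h u"
    using r(3)[OF r(1)] L2_inner_cong[OF L2_eq_refl L2_eq_sym[OF r(2)], of h] L by simp
  then show thesis
    using that[OF r(1) L(3) r(2) nsq_cong r(3)] L r(2) inner_eq_integral[OF assms] L2_eq_sym by metis
qed

text \<open>The half-line below \<open>- K\<close> is cut into bounded bands. A nonzero vector with
  spectral support in a band lies in the operator domain and would violate semiboundedness of the
  form.\<close>

lemma spectrum_bounded_below:
  obtains K where "K \<ge> 0" "K \<ge> - s" "\<And>f. f \<in> form_domain \<mu> \<Longrightarrow> Re (form \<mu> f f) \<ge> - K * nsq f"
    "\<And>f. f \<in> L2 \<Longrightarrow> L2_eq (E {..<- K} f) (\<lambda>x. 0)"
proof -
  obtain K0 where K0: "K0 \<ge> 0" "\<And>f. f \<in> form_domain \<mu> \<Longrightarrow> Re (form \<mu> f f) \<ge> - K0 * nsq f"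
    using form_semibounded[OF radon brinck] by metis
  \<comment> \<open>The maximum with \<open>- s\<close> ensures that \<open>- K\<close> does not
    exceed \<open>s\<close>, so that \<open>{..<s}\<close> splits at \<open>- K\<close>.\<close>
  define K where "K = max K0 (- s)"
  have K: "Re (form \<mu> f f) \<ge> - K * nsq f" if "f \<in> form_domain \<mu>" for f
  proof -
    have "K0 * nsq f \<le> K * nsq f" by (intro mult_right_mono nsq_nonneg) (simp add: K_def)
    then show ?thesis using K0(2)[OF that] by linarith
  qed
  show thesis
  proof (rule that)
    show "K \<ge> 0" "K \<ge> - s" using K0(1) by (auto simp: K_def)
    show "\<And>f. f \<in> form_domain \<mu> \<Longrightarrow> Re (form \<mu> f f) \<ge> - K * nsq f" by (rule K)
    fix f assume f: "f \<in> L2"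
    define B where "B n = {- K - real n - 1..<- K - real n}" for n
    have B: "B n \<in> sets borel" for n by (simp add: B_def)
    have "emeasure (sm f) (B n) = 0" for n
    proof -
      let ?u = "E (B n) f"
      have u: "?u \<in> L2" "L2_eq (E (B n) ?u) ?u"
        using B f by (auto intro: proj_L2 proj_subset_fixed)
      have "B n \<subseteq> {- (K + real n + 1)..K + real n + 1}"
        using K0(1) by (auto simp: B_def K_def)
      then obtain h where h: "(?u, h) \<in> form_operator \<mu>"
        using bounded_in_domain[OF B _ u] by blast
      obtain r where r: "r \<in> form_domain \<mu>" "nsq r = nsq ?u" "form \<mu> r r = complex_of_real (LINT t|sm ?u. t)"
        using operator_representative[OF h] by metis
      have "nsq ?u = 0"
      proof (rule ccontr)
        assume "nsq ?u \<noteq> 0"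
        then have "(LINT t|sm ?u. t) < - K * nsq ?u"
          using B h u by (intro integral_sm_less[of "B n"]) (auto simp: B_def)
        then show False using K[OF r(1)] r(2,3) by simp
      qed
      then show ?thesis using B f by (simp add: emeasure_sm)
    qed
    then have "emeasure (sm f) (\<Union>n. B n) = 0"
      using B by (intro emeasure_UN_eq_0) auto
    moreover have "(\<Union>n. B n) = {..<- K}"
    proof (intro set_eqI iffI)
      fix t assume "t \<in> {..<- K}"
      then have t: "- K - t > 0" by simp
      \<comment> \<open>The half-open band asks for \<open>n < - K - t\<close> and
        \<open>- K - t \<le> n + 1\<close>, hence the ceiling minus one.\<close>
      define n where "n = nat (\<lceil>- K - t\<rceil> - 1)"
      have "real n = of_int \<lceil>- K - t\<rceil> - 1" using t by (simp add: n_def)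
      then have "t \<in> B n" unfolding B_def by simp linarith
      then show "t \<in> (\<Union>n. B n)" by blast
    qed (auto simp: B_def)
    ultimately have "nsq (E {..<- K} f) = 0"
      using f nsq_nonneg[of "E {..<- K} f"] by (simp add: emeasure_sm)
    then show "L2_eq (E {..<- K} f) (\<lambda>x. 0)"
      using nsq_eq_0_iff proj_L2[OF _ f] by simp
  qed
qed

text \<open>Semiboundedness removes the spectrum below \<open>- K\<close>, so the spectral support
  reduces to the bounded set \<open>{- K..<s}\<close>.\<close>

lemma low_in_domain:
  assumes f: "f \<in> L2" and E: "L2_eq (E {..<s} f) f"
  shows "\<exists>h. (f, h) \<in> form_operator \<mu>"
proof -
  obtain K where K: "K \<ge> 0" "K \<ge> - s" "L2_eq (E {..<- K} f) (\<lambda>x. 0)"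
    using spectrum_bounded_below[of s] f by metis
  have "L2_eq f (E {..<s} f)" using E by (rule L2_eq_sym)
  also have "{..<s} = {..<- K} \<union> {- K..<s}" using K by auto
  also have "L2_eq (E ({..<- K} \<union> {- K..<s}) f) (\<lambda>x. 1 * E {..<- K} f x + 1 * E {- K..<s} f x)"
    using f by (intro proj_Un) auto
  also have "L2_eq \<dots> (\<lambda>x. 1 * 0 + 1 * E {- K..<s} f x)"
    by (intro L2_eq_lincomb K L2_eq_refl)
  finally (L2_eq_trans) have "L2_eq (E {- K..<s} f) f" by (simp add: L2_eq_sym)
  moreover have "{- K..<s} \<subseteq> {- max K s..max K s}" by auto
  ultimately show ?thesis using bounded_in_domain[of "{- K..<s}"] f by auto
qed

text \<open>\<open>f\<close> need not lie in the operator domain, so its form is not directly a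
  spectral integral. The bound is first proved up to multiples of the spectral mass
  \<open>e n\<close> beyond \<open>s + n\<close>, which tends to 0.\<close>

lemma form_ge_of_proj_zero:
  assumes f: "f \<in> form_domain \<mu>" and E: "L2_eq (E {..<s} f) (\<lambda>x. 0)"
  shows "Re (form \<mu> f f) \<ge> s * nsq f"
proof -
  have Lf: "f \<in> L2" using form_domain_sq[OF f sets_mu] by simp
  interpret finite_measure "sm f" using Lf by (rule finite_measure_sm)
  obtain K where K: "\<And>f. f \<in> form_domain \<mu> \<Longrightarrow> Re (form \<mu> f f) \<ge> - K * nsq f"
    using form_semibounded[OF radon brinck] by metis
  define e where "e n = measure (sm f) {s + real n..}" for n
  have "e \<longlonglongrightarrow> measure (sm f) (\<Inter>n. {s + real n..})"
    unfolding e_def by (intro finite_Lim_measure_decseq) (auto simp: decseq_def)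
  also have "(\<Inter>n. {s + real n..}) = {}"
  proof -
    have "\<exists>n. t < s + real n" for t
      using reals_Archimedean2[of "t - s"] by (auto simp: algebra_simps)
    then have "t \<notin> (\<Inter>n. {s + real n..})" for t by (auto simp: not_le)
    then show ?thesis by blast
  qed
  finally have e: "e \<longlonglongrightarrow> 0" by simp
  have low0: "measure (sm f) {..<s} = 0"
    using nsq_cong[OF E proj_L2 L2_zero] Lf by (simp add: measure_sm)
  have step: "Re (form \<mu> f f) \<ge> s * (nsq f - e n) - K * e n" for n
  proof -
    define A where "A = {s..<s + real n}"
    have A: "A \<in> sets borel" "- A \<in> sets borel" by (auto simp: A_def)
    let ?u = "E A f"
    have u: "?u \<in> L2" "L2_eq (E A ?u) ?u"
      using A Lf by (auto intro: proj_L2 proj_subset_fixed)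
    have "A \<subseteq> {- (\<bar>s\<bar> + real n)..\<bar>s\<bar> + real n}" by (auto simp: A_def)
    then obtain h where h: "(?u, h) \<in> form_operator \<mu>"
      using bounded_in_domain[OF A(1) _ u] by blast
    then have Lh: "h \<in> L2" using operator_L2 by blast
    obtain r where r: "r \<in> form_domain \<mu>" "r \<in> L2" "L2_eq ?u r" "nsq r = nsq ?u"
      "\<And>g. g \<in> form_domain \<mu> \<Longrightarrow> form \<mu> r g = L2_inner h g"
      "form \<mu> r r = complex_of_real (LINT t|sm ?u. t)"
      using operator_representative[OF h] by metis
    define g where "g = (\<lambda>x. 1 * f x + (-1) * r x)"
    have g: "g \<in> form_domain \<mu>" unfolding g_def using f r(1) sets_mu by (intro form_domain_lincomb)
    then have Lg: "g \<in> L2" using form_domain_sq sets_mu by blast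
    have "L2_eq f (E UNIV f)" using Lf by (simp add: proj_UNIV L2_eq_sym)
    also have "UNIV = A \<union> - A" by auto
    also have "L2_eq (E (A \<union> - A) f) (\<lambda>x. 1 * E A f x + 1 * E (- A) f x)"
      using A Lf by (intro proj_Un) auto
    finally (L2_eq_trans) have "L2_eq f (\<lambda>x. E A f x + E (- A) f x)" by simp
    then have "AE x in lborel. f x = E A f x + E (- A) f x \<and> E A f x = r x"
      using r(3) unfolding L2_eq_def by (rule AE_conjI)
    then have gE: "L2_eq g (E (- A) f)"
      unfolding L2_eq_def g_def by (rule AE_mp) (auto intro!: AE_I2)
    \<comment> \<open>The image \<open>h\<close> is orthogonal to the range of
      \<open>E (- A)\<close>, and \<open>g\<close> is \<open>E (- A) f\<close> up to a null set;
      hence the cross terms vanish.\<close>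
    have "form \<mu> r g = L2_inner h (E (- A) f)"
      using r(5)[OF g] L2_inner_cong[OF L2_eq_refl gE, of h] Lh Lg proj_L2[OF A(2) Lf] by simp
    also have "\<dots> = 0" using A u h Lf by (intro operator_orthogonal)
    finally have rg: "form \<mu> r g = 0" .
    then have gr: "form \<mu> g r = 0" by (subst form_cnj) simp
    have "f = (\<lambda>x. 1 * r x + 1 * g x)" by (simp add: g_def)
    then have "form \<mu> f f = form \<mu> (\<lambda>x. 1 * r x + 1 * g x) f" by simp
    also have "\<dots> = 1 * form \<mu> r f + 1 * form \<mu> g f"
      using r g f sets_mu by (intro form_lincomb_left)
    also have "form \<mu> r f = form \<mu> r (\<lambda>x. 1 * r x + 1 * g x)"
      using \<open>f = (\<lambda>x. 1 * r x + 1 * g x)\<close> by simp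
    also have "\<dots> = cnj 1 * form \<mu> r r + cnj 1 * form \<mu> r g"
      using r g f sets_mu by (intro form_lincomb_right)
    also have "form \<mu> g f = form \<mu> g (\<lambda>x. 1 * r x + 1 * g x)"
      using \<open>f = (\<lambda>x. 1 * r x + 1 * g x)\<close> by simp
    also have "\<dots> = cnj 1 * form \<mu> g r + cnj 1 * form \<mu> g g"
      using r g f sets_mu by (intro form_lincomb_right)
    finally have "form \<mu> f f = form \<mu> r r + form \<mu> g g" using rg gr by simp
    moreover have "(LINT t|sm ?u. t) \<ge> s * nsq ?u"
      using A h u by (intro integral_sm_ge[of A]) (auto simp: A_def)
    ultimately have "Re (form \<mu> f f) \<ge> s * nsq ?u - K * nsq g"
      using K[OF g] r(6) by simp
    \<comment> \<open>The complement of \<open>A\<close> also contains \<open>{..<s}\<close>, which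
      carries no mass by assumption, so only the tail remains.\<close>
    moreover have "nsq g = e n"
    proof -
      have "nsq g = measure (sm f) (- A)"
        using nsq_cong[OF gE Lg proj_L2[OF A(2) Lf]] A Lf by (simp add: measure_sm)
      also have "- A = {..<s} \<union> {s + real n..}" by (auto simp: A_def)
      also have "measure (sm f) \<dots> = measure (sm f) {..<s} + e n"
        unfolding e_def by (intro finite_measure_Union) auto
      finally show ?thesis using low0 by simp
    qed
    moreover have "nsq ?u = nsq f - nsq g"
    proof -
      have "measure (sm f) (- A) = measure (sm f) (space (sm f)) - measure (sm f) A"
        using A finite_measure_compl[of A] by (simp add: Compl_eq_Diff_UNIV)
      then have "nsq (E (- A) f) = nsq f - nsq ?u"
        using A Lf measure_sm_UNIV by (simp add: measure_sm)
      then show ?thesis using nsq_cong[OF gE Lg proj_L2[OF A(2) Lf]] by simp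
    qed
    ultimately show ?thesis by simp
  qed
  have "(\<lambda>n. s * (nsq f - e n) - K * e n) \<longlonglongrightarrow> s * (nsq f - 0) - K * 0"
    by (intro tendsto_intros e)
  then show ?thesis using step by (intro LIMSEQ_le_const2) auto
qed

section \<open>Counting by trial functions and by point conditions\<close>

text \<open>A nontrivial relation between the projected functions gives a combination with
  projection zero, whose form is then at least \<open>s * nsq f\<close>, against the assumption. So
  projection is injective on the trial space.\<close>

lemma spectral_count_ge:
  assumes \<phi>: "\<And>i. i < n \<Longrightarrow> \<phi> i \<in> form_domain \<mu>"
    and neg: "\<And>c f. f = (\<lambda>x. \<Sum>i<n. c i * \<phi> i x) \<Longrightarrow> \<exists>i<n. c i \<noteq> 0 \<Longrightarrow> Re (form \<mu> f f) < s * nsq f"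
  shows "ennreal (real n) \<le> spectral_count s E"
proof -
  define A where "A = {..<s}"
  have A: "A \<in> sets borel" by (simp add: A_def)
  have L: "\<phi> i \<in> L2" if "i < n" for i using form_domain_sq[OF \<phi>[OF that] sets_mu] by simp
  have Esum: "L2_eq (E A (\<lambda>x. \<Sum>i\<in>I. c i * \<phi> i x)) (\<lambda>x. \<Sum>i\<in>I. c i * E A (\<phi> i) x)"
    if "finite I" "I \<subseteq> {..<n}" for I c
    using that
  proof (induction rule: finite_induct)
    case (insert j I)
    have "L2_eq (E A (\<lambda>x. c j * \<phi> j x + 1 * (\<Sum>i\<in>I. c i * \<phi> i x)))
        (\<lambda>x. c j * E A (\<phi> j) x + 1 * E A (\<lambda>x. \<Sum>i\<in>I. c i * \<phi> i x) x)"
      using insert A L by (intro proj_lincomb L2_sum) auto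
    also have "L2_eq \<dots> (\<lambda>x. c j * E A (\<phi> j) x + 1 * (\<Sum>i\<in>I. c i * E A (\<phi> i) x))"
      using insert by (intro L2_eq_lincomb L2_eq_refl) auto
    finally (L2_eq_trans) show ?case using insert by simp
  qed (simp add: A proj_zero)
  have "L2_independent n (\<lambda>i. E A (\<phi> i))"
    unfolding L2_independent_def
  proof (intro allI impI, rule ccontr)
    fix c i
    assume z: "L2_eq (\<lambda>x. \<Sum>i<n. c i * E A (\<phi> i) x) (\<lambda>x. 0)" and i: "i < n" "c i \<noteq> 0"
    define f where "f = (\<lambda>x. \<Sum>i<n. c i * \<phi> i x)"
    have f: "f \<in> form_domain \<mu>" unfolding f_def using \<phi> sets_mu by (intro form_domain_sum) auto
    have "L2_eq (E {..<s} f) (\<lambda>x. 0)"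
      using Esum[of "{..<n}" c] z L2_eq_trans unfolding f_def A_def by blast
    then have "Re (form \<mu> f f) \<ge> s * nsq f" by (rule form_ge_of_proj_zero[OF f])
    then show False using neg[OF f_def] i by fastforce
  qed
  moreover have "\<forall>i<n. E A (\<phi> i) \<in> spectral_subspace E A"
    using L by (auto simp: spectral_subspace_def)
  ultimately have "enat n \<le> L2_dim (spectral_subspace E A)"
    unfolding L2_dim_def
    by (intro Sup_upper CollectI exI[of _ n] conjI[OF refl] exI[of _ "\<lambda>i. E A (\<phi> i)"]) simp
  then have "ennreal_of_enat (enat n) \<le> spectral_count s E"
    unfolding spectral_count_def A_def by (simp only: ennreal_of_enat_le_iff)
  then show ?thesis by (simp only: ennreal_of_enat_enat ennreal_of_nat_eq_real_of_nat)
qed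

text \<open>More independent spectral vectors than points would leave a nonzero combination
  vanishing on \<open>X\<close>. Its spectral support puts the form strictly below
  \<open>s * nsq f\<close>, against the assumption.\<close>

lemma spectral_count_le:
  assumes X: "finite X"
    and nonneg: "\<And>f. f \<in> form_domain \<mu> \<Longrightarrow> (\<And>x. x \<in> X \<Longrightarrow> f x = 0) \<Longrightarrow> Re (form \<mu> f f) \<ge> s * nsq f"
  shows "spectral_count s E \<le> ennreal (real (card X))"
proof -
  define A where "A = {..<s}"
  have A: "A \<in> sets borel" by (simp add: A_def)
  have "n \<le> card X"
    if v: "\<forall>i<n. v i \<in> spectral_subspace E A" and ind: "L2_independent n v" for n v
  proof (rule ccontr)
    assume "\<not> n \<le> card X"
    then have n: "card X < card {..<n}" by simp
    \<comment> \<open>Values at points are not invariant under equality almost everywhere, so each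
      \<open>v i\<close> is replaced by a representative in the form domain.\<close>
    have "\<exists>r h. r \<in> form_domain \<mu> \<and> (r, h) \<in> form_operator \<mu> \<and> h \<in> L2 \<and> L2_eq (v i) r \<and> L2_eq (E A r) r
        \<and> (\<forall>g\<in>form_domain \<mu>. form \<mu> r g = L2_inner h g)" if i: "i < n" for i
    proof -
      obtain f where f: "f \<in> L2" "v i = E A f"
        using v i by (auto simp: spectral_subspace_def)
      then have vi: "v i \<in> L2" "L2_eq (E A (v i)) (v i)"
        using A by (auto intro: proj_L2 proj_subset_fixed)
      then obtain h where h: "(v i, h) \<in> form_operator \<mu>"
        using low_in_domain[of "v i" s] by (auto simp: A_def)
      obtain r where r: "r \<in> form_domain \<mu>" "r \<in> L2" "L2_eq (v i) r"
        "\<And>g. g \<in> form_domain \<mu> \<Longrightarrow> form \<mu> r g = L2_inner h g"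
        using operator_representative[OF h] by metis
      have hL: "h \<in> L2" using h operator_L2 by blast
      have "L2_eq (E A r) (E A (v i))"
        using A r vi by (intro proj_cong) (auto simp: L2_eq_sym)
      then have "L2_eq (E A r) r"
        using vi(2) r(3) L2_eq_trans by blast
      moreover have "(r, h) \<in> form_operator \<mu>"
        using r hL unfolding form_operator_def by (auto intro!: bexI[of _ r])
      ultimately show ?thesis using r hL by blast
    qed
    then obtain r h where r: "\<And>i. i < n \<Longrightarrow> r i \<in> form_domain \<mu> \<and> (r i, h i) \<in> form_operator \<mu>
        \<and> L2_eq (v i) (r i) \<and> L2_eq (E A (r i)) (r i) \<and> h i \<in> L2
        \<and> (\<forall>g\<in>form_domain \<mu>. form \<mu> (r i) g = L2_inner (h i) g)"
      by metis
    obtain c where c: "\<exists>i\<in>{..<n}. c i \<noteq> 0" "\<forall>x\<in>X. (\<Sum>i<n. c i * r i x) = 0"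
      using homogeneous_system_nontrivial[OF X finite_lessThan n, of r] by blast
    \<comment> \<open>Domain membership, spectral support and the image under the operator are
      carried to combinations by one common induction.\<close>
    have comb: "(\<lambda>x. \<Sum>i\<in>I. c i * r i x) \<in> form_domain \<mu> \<and>
        ((\<lambda>x. \<Sum>i\<in>I. c i * r i x), (\<lambda>x. \<Sum>i\<in>I. c i * h i x)) \<in> form_operator \<mu> \<and>
        L2_eq (E A (\<lambda>x. \<Sum>i\<in>I. c i * r i x)) (\<lambda>x. \<Sum>i\<in>I. c i * r i x) \<and>
        (\<forall>g\<in>form_domain \<mu>. form \<mu> (\<lambda>x. \<Sum>i\<in>I. c i * r i x) g = L2_inner (\<lambda>x. \<Sum>i\<in>I. c i * h i x) g)"
      if "finite I" "I \<subseteq> {..<n}" for I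
      using that
    proof (induction rule: finite_induct)
      case empty
      then show ?case by (simp add: form_domain_zero operator_zero A proj_zero form_zero_left)
    next
      case (insert j I)
      let ?f = "\<lambda>x. \<Sum>i\<in>I. c i * r i x" and ?h = "\<lambda>x. \<Sum>i\<in>I. c i * h i x"
      have IH: "?f \<in> form_domain \<mu>" "(?f, ?h) \<in> form_operator \<mu>" "L2_eq (E A ?f) ?f"
        "\<And>g. g \<in> form_domain \<mu> \<Longrightarrow> form \<mu> ?f g = L2_inner ?h g"
        using insert by auto
      have j: "r j \<in> form_domain \<mu>" "(r j, h j) \<in> form_operator \<mu>" "L2_eq (E A (r j)) (r j)"
        "\<And>g. g \<in> form_domain \<mu> \<Longrightarrow> form \<mu> (r j) g = L2_inner (h j) g"
        using r insert by auto
      have "(\<lambda>x. c j * r j x + 1 * ?f x) \<in> form_domain \<mu>"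
        using IH j sets_mu by (intro form_domain_lincomb)
      moreover have "((\<lambda>x. c j * r j x + 1 * ?f x), (\<lambda>x. c j * h j x + 1 * ?h x)) \<in> form_operator \<mu>"
        using IH j by (intro operator_lincomb)
      moreover have "L2_eq (E A (\<lambda>x. c j * r j x + 1 * ?f x)) (\<lambda>x. c j * E A (r j) x + 1 * E A ?f x)"
        using IH j operator_L2 A by (intro proj_lincomb) auto
      then have "L2_eq (E A (\<lambda>x. c j * r j x + 1 * ?f x)) (\<lambda>x. c j * r j x + 1 * ?f x)"
        using L2_eq_trans L2_eq_lincomb[OF j(3) IH(3)] by blast
      moreover have "form \<mu> (\<lambda>x. c j * r j x + 1 * ?f x) g = L2_inner (\<lambda>x. c j * h j x + 1 * ?h x) g"
        if g: "g \<in> form_domain \<mu>" for g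
      proof -
        have "form \<mu> (\<lambda>x. c j * r j x + 1 * ?f x) g = c j * form \<mu> (r j) g + 1 * form \<mu> ?f g"
          using IH j g sets_mu by (intro form_lincomb_left)
        also have "\<dots> = c j * L2_inner (h j) g + 1 * L2_inner ?h g"
          using IH j g by simp
        also have "\<dots> = L2_inner (\<lambda>x. c j * h j x + 1 * ?h x) g"
          using operator_L2[OF IH(2)] operator_L2[OF j(2)] form_domain_sq[OF g sets_mu]
          by (intro L2_inner_lincomb_left[symmetric]) auto
        finally show ?thesis .
      qed
      ultimately show ?case using insert by simp
    qed
    define f where "f = (\<lambda>x. \<Sum>i<n. c i * r i x)"
    define k where "k = (\<lambda>x. \<Sum>i<n. c i * h i x)"
    have f: "f \<in> form_domain \<mu>" "(f, k) \<in> form_operator \<mu>" "L2_eq (E A f) f" "form \<mu> f f = L2_inner k f"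
      using comb[of "{..<n}"] by (auto simp: f_def k_def)
    have Lf: "f \<in> L2" using f operator_L2 by blast
    \<comment> \<open>Independence is known for the \<open>v i\<close> and transfers because each
      \<open>r i\<close> equals \<open>v i\<close> almost everywhere.\<close>
    have "nsq f \<noteq> 0"
    proof
      assume "nsq f = 0"
      then have "L2_eq f (\<lambda>x. 0)" using nsq_eq_0_iff Lf by blast
      moreover have "L2_eq (\<lambda>x. \<Sum>i<n. c i * v i x) f"
        unfolding f_def using r by (intro L2_eq_sum) auto
      ultimately have "L2_eq (\<lambda>x. \<Sum>i<n. c i * v i x) (\<lambda>x. 0)" using L2_eq_trans by blast
      then show False using ind c(1) unfolding L2_independent_def by blast
    qed
    then have "(LINT t|sm f. t) < s * nsq f"
      using integral_sm_less[OF A, of s f k] f by (simp add: A_def)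
    moreover have "form \<mu> f f = complex_of_real (LINT t|sm f. t)"
      using f(4) inner_eq_integral[OF f(2)] by simp
    ultimately show False
      using nonneg[OF f(1)] c(2) by (auto simp: f_def)
  qed
  then have "L2_dim (spectral_subspace E A) \<le> enat (card X)"
    unfolding L2_dim_def by (intro Sup_least) auto
  then have "spectral_count s E \<le> ennreal_of_enat (enat (card X))"
    unfolding spectral_count_def A_def by (simp only: ennreal_of_enat_le_iff)
  then show ?thesis by (simp only: ennreal_of_enat_enat ennreal_of_nat_eq_real_of_nat)
qed

end

section \<open>The Otelbaev function\<close>

text \<open>Continuity from above along compact intervals, which have finite mass: a strict bound
  leaves room to enlarge the interval.\<close>

lemma emeasure_Icc_outer:
  assumes M: "radon_measure \<mu>" and "emeasure \<mu> {a..b} < m"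
  obtains e where "e > 0" "emeasure \<mu> {a - e..b + e} < m"
proof -
  define A where "A n = {a - inverse (real (Suc n))..b + inverse (real (Suc n))}" for n
  have "(\<lambda>n. emeasure \<mu> (A n)) \<longlonglongrightarrow> emeasure \<mu> (\<Inter>n. A n)"
  proof (rule Lim_emeasure_decseq)
    show "range A \<subseteq> sets \<mu>" using M by (auto simp: A_def radon_measure_def)
    show "decseq A"
      unfolding decseq_def
    proof (intro allI impI)
      fix m n :: nat assume "m \<le> n"
      then have "inverse (real (Suc n)) \<le> inverse (real (Suc m))"
        by (intro le_imp_inverse_le) auto
      then show "A n \<subseteq> A m" by (auto simp: A_def)
    qed
    show "emeasure \<mu> (A n) \<noteq> \<infinity>" for n
    proof -
      have "emeasure \<mu> (A n) < \<infinity>"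
        using M compact_Icc unfolding radon_measure_def A_def by blast
      then show ?thesis by simp
    qed
  qed
  also have "(\<Inter>n. A n) = {a..b}"
  proof (intro set_eqI iffI)
    fix x assume "x \<in> (\<Inter>n. A n)"
    then have x: "a - inverse (real (Suc n)) \<le> x" "x \<le> b + inverse (real (Suc n))" for n
      by (auto simp: A_def)
    have "a \<le> x"
    proof (rule field_le_epsilon)
      fix e :: real assume "e > 0"
      then obtain n where "inverse (real (Suc n)) < e" using reals_Archimedean by blast
      then show "a \<le> x + e" using x(1)[of n] by linarith
    qed
    moreover have "x \<le> b"
    proof (rule field_le_epsilon)
      fix e :: real assume "e > 0"
      then obtain n where "inverse (real (Suc n)) < e" using reals_Archimedean by blast
      then show "x \<le> b + e" using x(2)[of n] by linarith
    qed
    ultimately show "x \<in> {a..b}" by simp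
  next
    fix x assume x: "x \<in> {a..b}"
    have "x \<in> A n" for n
    proof -
      have "0 \<le> inverse (real (Suc n))" by simp
      then show ?thesis using x unfolding A_def atLeastAtMost_iff by linarith
    qed
    then show "x \<in> (\<Inter>n. A n)" by blast
  qed
  finally have "eventually (\<lambda>n. emeasure \<mu> (A n) < m) sequentially"
    using assms(2) by (rule order_tendstoD)
  then obtain n where "emeasure \<mu> (A n) < m"
    by (auto simp: eventually_sequentially)
  then show thesis unfolding A_def by (intro that[of "inverse (real (Suc n))"]) simp_all
qed

text \<open>Continuity from below along an increasing union of closed intervals.\<close>

lemma emeasure_Ico_le:
  assumes M: "sets \<mu> = sets borel" and le: "\<And>e. e > 0 \<Longrightarrow> emeasure \<mu> {a..b - e} \<le> m"
  shows "emeasure \<mu> {a..<b::real} \<le> m"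
proof -
  define A where "A n = {a..b - inverse (real (Suc n))}" for n
  have "(SUP n. emeasure \<mu> (A n)) = emeasure \<mu> (\<Union>n. A n)"
  proof (rule SUP_emeasure_incseq)
    show "range A \<subseteq> sets \<mu>" unfolding M by (simp add: A_def image_subset_iff)
    show "incseq A"
      unfolding incseq_def
    proof (intro allI impI)
      fix m n :: nat assume "m \<le> n"
      then have "inverse (real (Suc n)) \<le> inverse (real (Suc m))"
        by (intro le_imp_inverse_le) auto
      then show "A m \<subseteq> A n" by (auto simp: A_def)
    qed
  qed
  also have "(\<Union>n. A n) = {a..<b}"
  proof (intro set_eqI iffI)
    fix x assume "x \<in> {a..<b}"
    then have x: "a \<le> x" "b - x > 0" by auto
    then obtain n where "inverse (real (Suc n)) < b - x" using reals_Archimedean by blast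
    then have "x \<in> A n" using x by (simp add: A_def)
    then show "x \<in> (\<Union>n. A n)" by blast
  next
    fix x assume "x \<in> (\<Union>n. A n)"
    then obtain n where x: "a \<le> x" "x \<le> b - inverse (real (Suc n))" by (auto simp: A_def)
    moreover have "inverse (real (Suc n)) > 0" by simp
    ultimately have "x < b" by linarith
    then show "x \<in> {a..<b}" using x by simp
  qed
  finally have "emeasure \<mu> {a..<b} = (SUP n. emeasure \<mu> (A n))" ..
  also have "\<dots> \<le> m" unfolding A_def by (intro SUP_least le) simp
  finally show ?thesis .
qed

lemma emeasure_Ioo_le:
  assumes M: "sets \<mu> = sets borel" and le: "\<And>e. e > 0 \<Longrightarrow> emeasure \<mu> {a + e..b - e} \<le> m"
  shows "emeasure \<mu> {a<..<b::real} \<le> m"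
proof -
  define A where "A n = {a + inverse (real (Suc n))..<b}" for n
  have An: "emeasure \<mu> (A n) \<le> m" for n
    unfolding A_def
  proof (rule emeasure_Ico_le[OF M])
    fix e :: real assume e: "e > 0"
    \<comment> \<open>The assumption only covers equal margins on both sides, so the smaller margin
      is used for both.\<close>
    have "emeasure \<mu> {a + inverse (real (Suc n))..b - e}
        \<le> emeasure \<mu> {a + min e (inverse (real (Suc n)))..b - min e (inverse (real (Suc n)))}"
      using M by (intro emeasure_mono) auto
    also have "\<dots> \<le> m" using e by (intro le) auto
    finally show "emeasure \<mu> {a + inverse (real (Suc n))..b - e} \<le> m" .
  qed
  have "(SUP n. emeasure \<mu> (A n)) = emeasure \<mu> (\<Union>n. A n)"
  proof (rule SUP_emeasure_incseq)
    show "range A \<subseteq> sets \<mu>" unfolding M by (simp add: A_def image_subset_iff)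
    show "incseq A"
      unfolding incseq_def
    proof (intro allI impI)
      fix m n :: nat assume "m \<le> n"
      then have "inverse (real (Suc n)) \<le> inverse (real (Suc m))"
        by (intro le_imp_inverse_le) auto
      then show "A m \<subseteq> A n" by (auto simp: A_def)
    qed
  qed
  also have "(\<Union>n. A n) = {a<..<b}"
  proof (intro set_eqI iffI)
    fix x assume "x \<in> {a<..<b}"
    then have x: "x < b" "x - a > 0" by auto
    then obtain n where "inverse (real (Suc n)) < x - a" using reals_Archimedean by blast
    then have "x \<in> A n" using x by (simp add: A_def)
    then show "x \<in> (\<Union>n. A n)" by blast
  next
    fix x assume "x \<in> (\<Union>n. A n)"
    then obtain n where x: "a + inverse (real (Suc n)) \<le> x" "x < b" by (auto simp: A_def)
    moreover have "inverse (real (Suc n)) > 0" by simp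
    ultimately have "a < x" by linarith
    then show "x \<in> {a<..<b}" using x by simp
  qed
  finally have "emeasure \<mu> {a<..<b} = (SUP n. emeasure \<mu> (A n))" ..
  also have "\<dots> \<le> m" by (intro SUP_least An)
  finally show ?thesis .
qed

section \<open>Semicontinuity and mass bounds for the Otelbaev function\<close>

context brinck_measure
begin

lemma emeasure_Delta_mono:
  assumes "\<bar>x - y\<bar> \<le> (d' - d) / 2"
  shows "emeasure \<mu> (Delta x d) \<le> emeasure \<mu> (Delta y d')"
proof (rule emeasure_mono)
  show "Delta x d \<subseteq> Delta y d'"
  proof
    fix z assume "z \<in> Delta x d"
    then have "x - d / 2 \<le> z" "z \<le> x + d / 2" by (auto simp: Delta_def)
    moreover have "x - y \<le> (d' - d) / 2" "y - x \<le> (d' - d) / 2"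
      using assms abs_ge_self[of "x - y"] abs_ge_minus_self[of "x - y"] by linarith+
    ultimately show "z \<in> Delta y d'"
      unfolding Delta_def atLeastAtMost_iff by (simp add: field_simps)
  qed
qed (simp add: sets_mu Delta_def)

context
  fixes \<alpha> :: real
  assumes \<alpha>: "\<alpha> > 0"
begin

text \<open>The Brinck condition makes the set of admissible lengths nonempty, so the real infimum
  unfolds into an existence statement.\<close>

lemma otelbaev_less_iff:
  "otelbaev \<mu> \<alpha> x < c \<longleftrightarrow> (\<exists>d>0. 1 / d\<^sup>2 < c \<and> emeasure \<mu> (Delta x d) < ennreal (1 / (\<alpha> * d)))"
proof -
  obtain d where "d > 0" "\<And>x. emeasure \<mu> (Delta x d) < ennreal (1 / (\<alpha> * d))"
    using otelbaev_uniform_length[OF radon brinck \<alpha>] by blast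
  then have "{1 / d\<^sup>2 | d. d > 0 \<and> emeasure \<mu> (Delta x d) < ennreal (1 / (\<alpha> * d))} \<noteq> {}"
    by blast
  then show ?thesis
    unfolding otelbaev_def by (subst cInf_less_iff[OF _ otelbaev_Inf_bdd_below]) auto
qed

text \<open>A length admissible at \<open>x\<close> stays admissible nearby, since intervals with
  nearby centres lie in a slight enlargement that still obeys the strict bound. This upper
  semicontinuity gives closed level sets and measurability.\<close>

lemma open_otelbaev_less: "open {x. otelbaev \<mu> \<alpha> x < c}"
  unfolding open_dist
proof (intro ballI)
  fix x assume "x \<in> {x. otelbaev \<mu> \<alpha> x < c}"
  then obtain d where d: "d > 0" "1 / d\<^sup>2 < c" "emeasure \<mu> (Delta x d) < ennreal (1 / (\<alpha> * d))"
    by (auto simp: otelbaev_less_iff)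
  obtain e where e: "e > 0" "emeasure \<mu> {x - d / 2 - e..x + d / 2 + e} < ennreal (1 / (\<alpha> * d))"
    using emeasure_Icc_outer[OF radon d(3)[unfolded Delta_def]] by blast
  have "otelbaev \<mu> \<alpha> y < c" if "dist y x < e" for y
  proof -
    have "emeasure \<mu> (Delta y d) \<le> emeasure \<mu> {x - d / 2 - e..x + d / 2 + e}"
      using that sets_mu unfolding Delta_def dist_real_def by (intro emeasure_mono) auto
    then show ?thesis using d(1,2) e(2) le_less_trans unfolding otelbaev_less_iff by blast
  qed
  then show "\<exists>e>0. \<forall>y. dist y x < e \<longrightarrow> y \<in> {x. otelbaev \<mu> \<alpha> x < c}" using e(1) by blast
qed

lemma closed_otelbaev_set: "closed (otelbaev_set \<mu> \<alpha> c)"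
proof -
  have "otelbaev_set \<mu> \<alpha> c = - {x. otelbaev \<mu> \<alpha> x < c}" by (auto simp: otelbaev_set_def)
  then show ?thesis using open_otelbaev_less by (simp add: closed_def)
qed

lemma otelbaev_measurable: "otelbaev \<mu> \<alpha> \<in> borel_measurable borel"
  using open_otelbaev_less by (intro borel_measurableI_less) auto

text \<open>Admissibility passes to shorter lengths: the mass decreases while the threshold
  increases.\<close>

lemma emeasure_Delta_less:
  assumes "d > 0" "otelbaev \<mu> \<alpha> x < 1 / d\<^sup>2"
  shows "emeasure \<mu> (Delta x d) < ennreal (1 / (\<alpha> * d))"
proof -
  obtain d' where d': "d' > 0" "1 / d'\<^sup>2 < 1 / d\<^sup>2" "emeasure \<mu> (Delta x d') < ennreal (1 / (\<alpha> * d'))"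
    using assms(2) by (auto simp: otelbaev_less_iff)
  have "d\<^sup>2 < d'\<^sup>2" using d'(1,2) assms(1) by (simp add: field_simps)
  then have "d < d'" using d'(1) by (rule power2_less_imp_less[OF _ less_imp_le])
  then have "emeasure \<mu> (Delta x d) \<le> emeasure \<mu> (Delta x d')"
    by (intro emeasure_Delta_mono) simp
  also have "\<dots> < ennreal (1 / (\<alpha> * d'))" by (rule d')
  also have "\<dots> \<le> ennreal (1 / (\<alpha> * d))"
    using \<open>d < d'\<close> assms(1) \<alpha> by (intro ennreal_leI) (simp add: field_simps)
  finally show ?thesis .
qed

text \<open>This covers the case of equality, where \<open>D\<close> itself may fail to be
  admissible. All shorter lengths are admissible, and their thresholds tend to
  \<open>1 / (\<alpha> * D)\<close> as they approach \<open>D\<close>.\<close>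

lemma emeasure_Delta_le:
  assumes "0 < d" "d < D" "otelbaev \<mu> \<alpha> x \<le> 1 / D\<^sup>2"
  shows "emeasure \<mu> (Delta x d) \<le> ennreal (1 / (\<alpha> * D))"
proof (rule ccontr)
  assume "\<not> ?thesis"
  then have gt: "ennreal (1 / (\<alpha> * D)) < emeasure \<mu> (Delta x d)" by simp
  have less: "emeasure \<mu> (Delta x d) < ennreal (1 / (\<alpha> * d'))" if "d \<le> d'" "d' < D" for d'
  proof -
    have "d'\<^sup>2 < D\<^sup>2" using that assms by (intro power_strict_mono) auto
    then have "otelbaev \<mu> \<alpha> x < 1 / d'\<^sup>2"
      using assms(1,3) that by (smt (verit) frac_less2 zero_less_power)
    then have "emeasure \<mu> (Delta x d') < ennreal (1 / (\<alpha> * d'))"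
      using that assms(1) by (intro emeasure_Delta_less) auto
    moreover have "emeasure \<mu> (Delta x d) \<le> emeasure \<mu> (Delta x d')"
      using that by (intro emeasure_Delta_mono) simp
    ultimately show ?thesis by (rule le_less_trans[rotated])
  qed
  have "emeasure \<mu> (Delta x d) < \<infinity>"
    using less[of d] assms by (auto intro: less_trans)
  then obtain m where m: "emeasure \<mu> (Delta x d) = ennreal m" "m \<ge> 0"
    by (cases "emeasure \<mu> (Delta x d)") auto
  have D: "D > 0" using assms by simp
  have mD: "1 / (\<alpha> * D) < m" using gt m \<alpha> D by (simp add: ennreal_less_iff)
  then have m0: "m > 0" using \<alpha> D by (smt (verit) divide_pos_pos mult_pos_pos)
  \<comment> \<open>The threshold at length \<open>1 / (\<alpha> * m)\<close> is exactly
    \<open>m\<close>; the maximum keeps the interval at least as long as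
    \<open>Delta x d\<close>.\<close>
  define d' where "d' = max d (1 / (\<alpha> * m))"
  have "1 / (\<alpha> * m) < D" using mD m0 \<alpha> D by (simp add: field_simps)
  then have "d' < D" "d \<le> d'" using assms by (auto simp: d'_def)
  then have "m < 1 / (\<alpha> * d')"
    using less m by (simp add: ennreal_less_iff)
  moreover have "1 / (\<alpha> * m) \<le> d'" by (simp add: d'_def)
  moreover have "d' > 0" using assms by (simp add: d'_def)
  ultimately show False using m0 \<alpha> by (simp add: field_simps)
qed

text \<open>If this failed, the strict bound would survive on a slightly longer interval, which
  would push the infimum strictly below \<open>1 / d\<^sup>2\<close>.\<close>

lemma emeasure_Delta_ge:
  assumes x: "x \<in> otelbaev_set \<mu> \<alpha> (1 / d\<^sup>2)" and d: "d > 0"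
  shows "ennreal (1 / (\<alpha> * d)) \<le> emeasure \<mu> (Delta x d)"
proof (rule ccontr)
  assume "\<not> ?thesis"
  then have less: "emeasure \<mu> (Delta x d) < ennreal (1 / (\<alpha> * d))" by simp
  then have "emeasure \<mu> (Delta x d) < \<infinity>" by (rule less_trans) simp
  then obtain m where m: "emeasure \<mu> (Delta x d) = ennreal m" "m \<ge> 0"
    by (cases "emeasure \<mu> (Delta x d)") auto
  define r where "r = (m + 1 / (\<alpha> * d)) / 2"
  have md: "m < 1 / (\<alpha> * d)" using less m by (simp add: ennreal_less_iff)
  then have r: "m < r" "r < 1 / (\<alpha> * d)" by (auto simp: r_def)
  then have r0: "r > 0" using m by simp
  have "emeasure \<mu> (Delta x d) < ennreal r" using m r by (simp add: ennreal_lessI)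
  then obtain e where e: "e > 0" "emeasure \<mu> {x - d / 2 - e..x + d / 2 + e} < ennreal r"
    using emeasure_Icc_outer[OF radon] unfolding Delta_def by blast
  \<comment> \<open>The first bound keeps \<open>Delta x d'\<close> inside the enlargement of mass
    less than \<open>r\<close>; the second keeps \<open>r\<close> at most the threshold for
    \<open>d'\<close>.\<close>
  define d' where "d' = min (d + 2 * e) (1 / (\<alpha> * r))"
  have "d < 1 / (\<alpha> * r)" using r r0 d \<alpha> by (simp add: field_simps)
  then have dd': "d < d'" using e by (simp add: d'_def)
  have "emeasure \<mu> (Delta x d') \<le> emeasure \<mu> {x - d / 2 - e..x + d / 2 + e}"
    using sets_mu unfolding Delta_def d'_def by (intro emeasure_mono) (auto simp: min_def field_simps)
  also have "\<dots> < ennreal r" by (rule e)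
  also have "r \<le> 1 / (\<alpha> * d')"
  proof -
    have "d' \<le> 1 / (\<alpha> * r)" by (simp add: d'_def)
    then show ?thesis using dd' d r0 \<alpha> by (simp add: field_simps)
  qed
  then have "ennreal r \<le> ennreal (1 / (\<alpha> * d'))" by (rule ennreal_leI)
  finally have "emeasure \<mu> (Delta x d') < ennreal (1 / (\<alpha> * d'))" .
  moreover have "d\<^sup>2 < d'\<^sup>2" using dd' d by (intro power_strict_mono) auto
  then have "1 / d'\<^sup>2 < 1 / d\<^sup>2" using d by (intro frac_less2) auto
  ultimately have "otelbaev \<mu> \<alpha> x < 1 / d\<^sup>2"
    using dd' d unfolding otelbaev_less_iff by (intro exI[of _ d']) auto
  then show False using x by (simp add: otelbaev_set_def)
qed

text \<open>In terms of \<open>d = 1 / sqrt q\<^sup>*\<close> this says that \<open>d\<close> is Lipschitz with constant 2.\<close>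

lemma otelbaev_Lipschitz:
  assumes "d > 0" "otelbaev \<mu> \<alpha> x = 1 / d\<^sup>2"
  shows "otelbaev \<mu> \<alpha> y \<ge> 1 / (d + 2 * \<bar>x - y\<bar>)\<^sup>2"
proof (rule ccontr)
  assume "\<not> ?thesis"
  then obtain D where D: "D > 0" "1 / D\<^sup>2 < 1 / (d + 2 * \<bar>x - y\<bar>)\<^sup>2"
    "emeasure \<mu> (Delta y D) < ennreal (1 / (\<alpha> * D))"
    by (auto simp: otelbaev_less_iff not_le)
  have "d + 2 * \<bar>x - y\<bar> > 0" using assms(1) by (intro add_pos_nonneg) auto
  then have "(d + 2 * \<bar>x - y\<bar>)\<^sup>2 < D\<^sup>2" using D(1,2) by (simp add: field_simps)
  then have less: "d + 2 * \<bar>x - y\<bar> < D" using D(1) by (rule power2_less_imp_less[OF _ less_imp_le])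
  define D' where "D' = D - 2 * \<bar>x - y\<bar>"
  have D': "d < D'" "D' \<le> D" using less by (auto simp: D'_def)
  have "emeasure \<mu> (Delta x D') \<le> emeasure \<mu> (Delta y D)"
    by (intro emeasure_Delta_mono) (simp add: D'_def)
  also have "\<dots> < ennreal (1 / (\<alpha> * D))" by (rule D)
  also have "\<dots> \<le> ennreal (1 / (\<alpha> * D'))"
    using D' assms(1) \<alpha> by (intro ennreal_leI) (simp add: field_simps)
  finally have "emeasure \<mu> (Delta x D') < ennreal (1 / (\<alpha> * D'))" .
  moreover have "d\<^sup>2 < D'\<^sup>2" using D' assms(1) by (intro power_strict_mono) auto
  then have "1 / D'\<^sup>2 < 1 / d\<^sup>2" using assms(1) by (intro frac_less2) auto
  ultimately have "otelbaev \<mu> \<alpha> x < 1 / d\<^sup>2"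
    using D' assms(1) unfolding otelbaev_less_iff by (intro exI[of _ D']) auto
  then show False using assms(2) by simp
qed

end

end

section \<open>Greedy coverings\<close>

definition separated :: "(real \<Rightarrow> real) \<Rightarrow> real set \<Rightarrow> bool" where
  "separated len X \<longleftrightarrow> (\<forall>x\<in>X. \<forall>y\<in>X. x < y \<longrightarrow> x + len x \<le> y)"

lemma separated_disjoint:
  "separated len X \<Longrightarrow> disjoint_family_on (\<lambda>x. {x..<x + len x}) X"
  by (force simp: separated_def disjoint_family_on_def neq_iff)

text \<open>Induction on \<open>n\<close>: the leftmost point of the closed set \<open>W\<close>
  starts the first interval, and the part of \<open>W\<close> from the end of that interval on
  admits only separated families with one point fewer.\<close>

lemma greedy_cover:
  assumes "closed W" "\<And>x. x \<in> W \<Longrightarrow> 0 < len x" "\<And>x. x \<in> W \<Longrightarrow> len x \<le> L"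
    and "\<And>X. finite X \<Longrightarrow> X \<subseteq> W \<Longrightarrow> separated len X \<Longrightarrow> card X \<le> n"
  shows "\<exists>X. finite X \<and> X \<subseteq> W \<and> separated len X \<and> W \<subseteq> (\<Union>x\<in>X. {x..<x + len x})"
  using assms
proof (induction n arbitrary: W)
  case 0
  have "W = {}"
  proof (rule ccontr)
    assume "W \<noteq> {}"
    then obtain x where "x \<in> W" by blast
    then have "card {x} \<le> 0" by (intro 0) (auto simp: separated_def)
    then show False by simp
  qed
  then show ?case by (intro exI[of _ "{}"]) (auto simp: separated_def)
next
  case (Suc n)
  show ?case
  proof (cases "W = {}")
    case True
    then show ?thesis by (intro exI[of _ "{}"]) (auto simp: separated_def)
  next
    case False
    \<comment> \<open>Otherwise separated families could be extended on the left without end;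
      \<open>L\<close> tells how far left the next point must be taken.\<close>
    have bdd: "bdd_below W"
    proof (rule ccontr)
      assume unb: "\<not> bdd_below W"
      have "\<exists>X. finite X \<and> X \<subseteq> W \<and> separated len X \<and> card X = k" for k
      proof (induction k)
        case 0
        then show ?case by (intro exI[of _ "{}"]) (auto simp: separated_def)
      next
        case (Suc k)
        then obtain X where X: "finite X" "X \<subseteq> W" "separated len X" "card X = k" by blast
        obtain m where m: "\<And>x. x \<in> X \<Longrightarrow> m \<le> x"
          using bdd_below_finite[OF X(1)] unfolding bdd_below_def by blast
        obtain y where y: "y \<in> W" "y < m - max 0 L"
          using unb unfolding bdd_below_def by (meson not_le)
        have less: "y + len y \<le> x" "y < x" if "x \<in> X" for x
          using y Suc.prems m[OF that] \<open>\<And>x. x \<in> W \<Longrightarrow> len x \<le> L\<close>[of y] by auto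
        have "y \<notin> X" using less(2) by blast
        then have "card (insert y X) = Suc k" using X by simp
        moreover have "separated len (insert y X)"
          using X(3) less unfolding separated_def by fastforce
        ultimately show ?case using X y by (intro exI[of _ "insert y X"]) auto
      qed
      then obtain X where "finite X" "X \<subseteq> W" "separated len X" "card X = Suc (Suc n)" by blast
      then show False using Suc.prems(4)[of X] by simp
    qed
    define x0 where "x0 = Inf W"
    have x0: "x0 \<in> W" unfolding x0_def using False bdd Suc.prems(1) by (rule closed_contains_Inf)
    have min: "x0 \<le> w" if "w \<in> W" for w unfolding x0_def using that bdd by (rule cInf_lower)
    define W' where "W' = W \<inter> {x0 + len x0..}"
    have pos: "len x0 > 0" using Suc.prems(2) x0 .
    have sep: "separated len (insert x0 X)" "x0 \<notin> X" if "X \<subseteq> W'" "separated len X" for X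
    proof -
      have gt: "x0 + len x0 \<le> x" "x0 < x" if "x \<in> X" for x
        using that \<open>X \<subseteq> W'\<close> pos by (auto simp: W'_def)
      then show "separated len (insert x0 X)"
        using \<open>separated len X\<close> unfolding separated_def by (metis insert_iff less_asym less_irrefl)
      show "x0 \<notin> X" using gt(2) by blast
    qed
    have "\<exists>X. finite X \<and> X \<subseteq> W' \<and> separated len X \<and> W' \<subseteq> (\<Union>x\<in>X. {x..<x + len x})"
    proof (rule Suc.IH)
      show "closed W'" unfolding W'_def using Suc.prems(1) by (intro closed_Int) auto
      fix X assume X: "finite X" "X \<subseteq> W'" "separated len X"
      have "card (insert x0 X) \<le> Suc n"
        using X x0 sep[OF X(2,3)] by (intro Suc.prems(4)) (auto simp: W'_def)
      then show "card X \<le> n" using sep[OF X(2,3)] X(1) by simp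
    qed (use Suc.prems in \<open>auto simp: W'_def\<close>)
    then obtain X where X: "finite X" "X \<subseteq> W'" "separated len X" "W' \<subseteq> (\<Union>x\<in>X. {x..<x + len x})"
      by blast
    have "W \<subseteq> (\<Union>x\<in>insert x0 X. {x..<x + len x})"
    proof
      fix w assume w: "w \<in> W"
      show "w \<in> (\<Union>x\<in>insert x0 X. {x..<x + len x})"
      proof (cases "w < x0 + len x0")
        case True
        then show ?thesis using min[OF w] by auto
      next
        case False
        then have "w \<in> W'" using w by (simp add: W'_def)
        then show ?thesis using X(4) by blast
      qed
    qed
    then show ?thesis
      using X x0 sep[OF X(2,3)] by (intro exI[of _ "insert x0 X"]) (auto simp: W'_def)
  qed
qed

text \<open>At each point at most one summand is nonzero.\<close>

lemma sum_nn_integral_disjoint_le: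
  assumes "finite X" "\<And>x. x \<in> X \<Longrightarrow> B x \<in> sets M" "disjoint_family_on B X"
    and "\<And>x. x \<in> X \<Longrightarrow> B x \<subseteq> C" "g \<in> borel_measurable M"
  shows "(\<Sum>x\<in>X. \<integral>\<^sup>+y\<in>B x. g y \<partial>M) \<le> (\<integral>\<^sup>+y\<in>C. g y \<partial>M)"
proof -
  have "(\<Sum>x\<in>X. \<integral>\<^sup>+y\<in>B x. g y \<partial>M) = (\<integral>\<^sup>+y. (\<Sum>x\<in>X. g y * indicator (B x) y) \<partial>M)"
    using assms by (intro nn_integral_sum[symmetric]) auto
  also have "\<dots> \<le> (\<integral>\<^sup>+y\<in>C. g y \<partial>M)"
  proof (rule nn_integral_mono)
    fix y
    show "(\<Sum>x\<in>X. g y * indicator (B x) y) \<le> g y * indicator C y"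
    proof (cases "\<exists>x\<in>X. y \<in> B x")
      case True
      then obtain x where x: "x \<in> X" "y \<in> B x" by blast
      have "(\<Sum>x\<in>X. g y * indicator (B x) y) = g y"
        using sum_indicator_disjoint_family[OF assms(3) x(2) assms(1) x(1), of "\<lambda>_. g y"] .
      moreover have "y \<in> C" using x assms(4) by blast
      ultimately show ?thesis by simp
    next
      case False
      then show ?thesis by (auto intro!: sum.neutral order.trans[OF eq_refl zero_le])
    qed
  qed
  finally show ?thesis .
qed

section \<open>Upper bounds\<close>

lemma sqrt_one_div_square: "0 < x \<Longrightarrow> sqrt (1 / x\<^sup>2) = 1 / x"
  by (simp add: real_sqrt_divide)

context brinck_measure
begin

section \<open>The light part of the line and the core\<close>

text \<open>The threshold is that of the Otelbaev function with parameter 2 at length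
  \<open>2 * h\<close>. Open intervals are used because they make this set closed.\<close>

definition low_mass :: "real \<Rightarrow> real set" where
  "low_mass h = {y. emeasure \<mu> {y - h<..<y + h} \<le> ennreal (1 / (4 * h))}"

text \<open>This is the complement of the union of all light open intervals; in terms of distances
  its closedness is immediate.\<close>

definition core :: "real \<Rightarrow> real set" where
  "core h = {x. \<forall>y\<in>low_mass h. h \<le> \<bar>x - y\<bar>}"

text \<open>The mass of an open interval is approximated from within by closed ones, and such a
  closed interval still lies in the open intervals around nearby centres.\<close>

lemma closed_low_mass: "closed (low_mass h)"
proof -
  have "open (- low_mass h)"
    unfolding open_dist
  proof (intro ballI)
    fix y assume "y \<in> - low_mass h"
    then have "\<not> emeasure \<mu> {y - h<..<y + h} \<le> ennreal (1 / (4 * h))" by (simp add: low_mass_def)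
    then obtain e where e: "e > 0" "\<not> emeasure \<mu> {y - h + e..y + h - e} \<le> ennreal (1 / (4 * h))"
      using emeasure_Ioo_le[OF sets_mu] by blast
    have "z \<in> - low_mass h" if "dist z y < e" for z
    proof -
      have "emeasure \<mu> {y - h + e..y + h - e} \<le> emeasure \<mu> {z - h<..<z + h}"
        using that sets_mu unfolding dist_real_def by (intro emeasure_mono) auto
      then show ?thesis using e(2) order_trans unfolding low_mass_def by blast
    qed
    then show "\<exists>e>0. \<forall>z. dist z y < e \<longrightarrow> z \<in> - low_mass h" using e(1) by blast
  qed
  then show ?thesis by (simp add: closed_def)
qed

lemma closed_core: "closed (core h)"
proof -
  have "core h = (\<Inter>y\<in>low_mass h. {x. h \<le> \<bar>x - y\<bar>})" by (auto simp: core_def)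
  moreover have "closed {x. h \<le> \<bar>x - y\<bar>}" for y
    by (intro closed_Collect_le continuous_intros)
  ultimately show ?thesis by auto
qed

text \<open>A point outside the level set would be a light centre, and those keep distance
  \<open>h\<close> from the core. This margin allows intervals attached to core points to be charged
  to the level set.\<close>

lemma core_margin:
  assumes "h > 0" "x \<in> core h" "\<bar>x - y\<bar> < h"
  shows "y \<in> otelbaev_set \<mu> 2 (1 / (2 * h)\<^sup>2)"
proof (rule ccontr)
  assume "\<not> ?thesis"
  then have "otelbaev \<mu> 2 y < 1 / (2 * h)\<^sup>2" by (simp add: otelbaev_set_def)
  then have "emeasure \<mu> (Delta y (2 * h)) < ennreal (1 / (2 * (2 * h)))"
    using assms(1) by (intro emeasure_Delta_less) auto
  moreover have "emeasure \<mu> {y - h<..<y + h} \<le> emeasure \<mu> (Delta y (2 * h))"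
    using sets_mu by (intro emeasure_mono) (auto simp: Delta_def)
  ultimately have "y \<in> low_mass h" by (simp add: low_mass_def)
  then show False using assms(2,3) unfolding core_def by fastforce
qed

text \<open>Inside a window of length \<open>h\<close>, the complement of the core is covered by two intervals
  around points of low mass, namely the nearest ones to the left and to the right of the window.\<close>

lemma emeasure_compl_core_window:
  assumes h: "h > 0"
  shows "emeasure \<mu> (- core h \<inter> {a..<a + h}) \<le> ennreal (1 / (2 * h))"
proof -
  let ?O = "\<lambda>y. {y - h<..<y + h}"
  have m2: "ennreal (1 / (4 * h)) + ennreal (1 / (4 * h)) = ennreal (1 / (2 * h))"
    using h by (simp add: ennreal_plus[symmetric] del: ennreal_plus)
  have mono: "ennreal (1 / (4 * h)) \<le> ennreal (1 / (2 * h))"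
    unfolding m2[symmetric] by simp
  show ?thesis
  proof (cases "\<exists>y\<in>low_mass h. a \<le> y \<and> y < a + h")
    \<comment> \<open>A light centre inside the window covers the whole window by its own
      interval.\<close>
    case True
    then obtain y where y: "y \<in> low_mass h" "a \<le> y" "y < a + h" by blast
    have "emeasure \<mu> (- core h \<inter> {a..<a + h}) \<le> emeasure \<mu> (?O y)"
      using y sets_mu by (intro emeasure_mono) auto
    also have "\<dots> \<le> ennreal (1 / (4 * h))" using y by (simp add: low_mass_def)
    finally show ?thesis using mono by (rule order_trans)
  next
    case False
    have "\<exists>U\<in>sets \<mu>. emeasure \<mu> U \<le> ennreal (1 / (4 * h)) \<and>
        (\<forall>x\<in>{a..<a + h}. \<forall>y\<in>low_mass h. y \<le> a \<and> \<bar>x - y\<bar> < h \<longrightarrow> x \<in> U)"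
    proof (cases "low_mass h \<inter> {..a} = {}")
      case True
      then show ?thesis by (intro bexI[of _ "{}"]) auto
    next
      case ne: False
      \<comment> \<open>The nearest light centre on the left is at least as close to every point of
        the window as the others on that side, so its interval suffices.\<close>
      define z where "z = Sup (low_mass h \<inter> {..a})"
      have bdd: "bdd_above (low_mass h \<inter> {..a})" by (intro bdd_above_Int2) simp
      have z: "z \<in> low_mass h \<inter> {..a}"
        unfolding z_def using ne bdd closed_low_mass by (intro closed_contains_Sup closed_Int) auto
      have "x \<in> ?O z" if "x \<in> {a..<a + h}" "y \<in> low_mass h" "y \<le> a" "\<bar>x - y\<bar> < h" for x y
      proof -
        have "y \<le> z" unfolding z_def using that bdd by (intro cSup_upper) auto
        then show ?thesis using that z by auto
      qed
      then show ?thesis using z sets_mu by (intro bexI[of _ "?O z"]) (auto simp: low_mass_def)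
    qed
    then obtain U where U: "U \<in> sets \<mu>" "emeasure \<mu> U \<le> ennreal (1 / (4 * h))"
      "\<And>x y. x \<in> {a..<a + h} \<Longrightarrow> y \<in> low_mass h \<Longrightarrow> y \<le> a \<Longrightarrow> \<bar>x - y\<bar> < h \<Longrightarrow> x \<in> U"
      by blast
    have "\<exists>V\<in>sets \<mu>. emeasure \<mu> V \<le> ennreal (1 / (4 * h)) \<and>
        (\<forall>x\<in>{a..<a + h}. \<forall>y\<in>low_mass h. a + h \<le> y \<and> \<bar>x - y\<bar> < h \<longrightarrow> x \<in> V)"
    proof (cases "low_mass h \<inter> {a + h..} = {}")
      case True
      then show ?thesis by (intro bexI[of _ "{}"]) auto
    next
      case ne: False
      define z where "z = Inf (low_mass h \<inter> {a + h..})"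
      have bdd: "bdd_below (low_mass h \<inter> {a + h..})" by (intro bdd_below_Int2) simp
      have z: "z \<in> low_mass h \<inter> {a + h..}"
        unfolding z_def using ne bdd closed_low_mass by (intro closed_contains_Inf closed_Int) auto
      have "x \<in> ?O z" if "x \<in> {a..<a + h}" "y \<in> low_mass h" "a + h \<le> y" "\<bar>x - y\<bar> < h" for x y
      proof -
        have "z \<le> y" unfolding z_def using that bdd by (intro cInf_lower) auto
        then show ?thesis using that z by auto
      qed
      then show ?thesis using z sets_mu by (intro bexI[of _ "?O z"]) (auto simp: low_mass_def)
    qed
    then obtain V where V: "V \<in> sets \<mu>" "emeasure \<mu> V \<le> ennreal (1 / (4 * h))"
      "\<And>x y. x \<in> {a..<a + h} \<Longrightarrow> y \<in> low_mass h \<Longrightarrow> a + h \<le> y \<Longrightarrow> \<bar>x - y\<bar> < h \<Longrightarrow> x \<in> V"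
      by blast
    have "- core h \<inter> {a..<a + h} \<subseteq> U \<union> V"
    proof
      fix x assume x: "x \<in> - core h \<inter> {a..<a + h}"
      then obtain y where y: "y \<in> low_mass h" "\<bar>x - y\<bar> < h" by (auto simp: core_def not_le)
      then have "y < a \<or> a + h \<le> y" using False by (meson not_le)
      then show "x \<in> U \<union> V" using U(3)[of x y] V(3)[of x y] x y by auto
    qed
    then have "emeasure \<mu> (- core h \<inter> {a..<a + h}) \<le> emeasure \<mu> (U \<union> V)"
      using U V by (intro emeasure_mono) auto
    also have "\<dots> \<le> emeasure \<mu> U + emeasure \<mu> V"
      using U V by (intro emeasure_subadditive) auto
    also have "\<dots> \<le> ennreal (1 / (4 * h)) + ennreal (1 / (4 * h))"
      using U V by (intro add_mono) auto
    finally show ?thesis unfolding m2 .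
  qed
qed

text \<open>Tiles of length \<open>h\<close> have mass at most \<open>1 / (2 * h)\<close> here,
  which turns the factors \<open>2 / h\<close> and \<open>h\<close> of the tile estimate into
  \<open>1 / h\<^sup>2\<close> and one half.\<close>

lemma energy_compl_core:
  assumes h: "h > 0" and f: "has_H1_deriv f f'"
  shows "energy \<mu> (- core h) f \<le> ennreal (1 / h\<^sup>2 * nsq f + 1 / 2 * nsq f')"
proof -
  have L: "f \<in> L2" "f' \<in> L2" using f by (auto simp: has_H1_deriv_def)
  have "energy \<mu> (- core h) f \<le> ennreal (1 / (2 * h)) *
      (ennreal (2 / h) * energy lborel UNIV f + ennreal h * energy lborel UNIV f')"
    using closed_core h by (intro energy_le_of_tiles[OF sets_mu f] emeasure_compl_core_window) auto
  also have "\<dots> = ennreal (1 / h\<^sup>2 * nsq f + 1 / 2 * nsq f')"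
    using h nsq_nonneg[of f] nsq_nonneg[of f'] unfolding L[THEN energy_UNIV_lborel]
    by (simp add: ennreal_mult[symmetric] ennreal_plus[symmetric] power2_eq_square field_simps del: ennreal_plus)
  finally show ?thesis .
qed

text \<open>A zero at the left end bounds the squared modulus of \<open>f\<close> on a piece by
  \<open>len x\<close> times the energy of \<open>f'\<close> there. Integrating brings in the mass
  of the piece, and disjointness lets the energies add up.\<close>

lemma energy_le_of_zeros:
  assumes f: "has_H1_deriv f f'" and X: "finite X" "separated len X"
    and cov: "W \<subseteq> (\<Union>x\<in>X. {x..<x + len x})"
    and len: "\<And>x. x \<in> X \<Longrightarrow> ennreal (len x) * emeasure \<mu> {x..<x + len x} \<le> ennreal (1 / 2)"
    and zero: "\<And>x. x \<in> X \<Longrightarrow> f x = 0"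
  shows "energy \<mu> W f \<le> ennreal (1 / 2 * nsq f')"
proof -
  let ?B = "\<lambda>x. {x..<x + len x}"
  have L: "f \<in> borel_measurable borel" "f' \<in> borel_measurable borel" "f' \<in> L2"
    using f by (auto simp: has_H1_deriv_def L2_def)
  have [measurable]: "f \<in> borel_measurable \<mu>"
    using L measurable_cong_sets[OF sets_mu refl] by auto
  have B[measurable]: "?B x \<in> sets \<mu>" for x by (simp add: sets_mu)
  have piece: "energy \<mu> (?B x) f \<le> ennreal (1 / 2) * energy lborel (?B x) f'" if x: "x \<in> X" for x
  proof -
    have "energy \<mu> (?B x) f \<le> (\<integral>\<^sup>+y. (ennreal (len x) * energy lborel (?B x) f') * indicator (?B x) y \<partial>\<mu>)"
      unfolding energy_def[of \<mu>]
    proof (rule nn_integral_mono)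
      fix y
      show "ennreal ((cmod (f y))\<^sup>2) * indicator (?B x) y
          \<le> (ennreal (len x) * energy lborel (?B x) f') * indicator (?B x) y"
      proof (cases "y \<in> ?B x")
        case True
        then have y: "x \<le> y" "{x..y} \<subseteq> ?B x" by auto
        have "ennreal ((cmod (f y))\<^sup>2) \<le> ennreal (y - x) * energy lborel (?B x) f'"
          using H1_increment[OF f y] zero[OF x] by simp
        also have "\<dots> \<le> ennreal (len x) * energy lborel (?B x) f'"
          using True by (intro mult_right_mono ennreal_leI) auto
        finally show ?thesis using True by simp
      qed simp
    qed
    also have "\<dots> = (ennreal (len x) * energy lborel (?B x) f') * emeasure \<mu> (?B x)"
      by (rule nn_integral_cmult_indicator) measurable
    also have "\<dots> = (ennreal (len x) * emeasure \<mu> (?B x)) * energy lborel (?B x) f'"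
      by (simp add: mult_ac)
    also have "\<dots> \<le> ennreal (1 / 2) * energy lborel (?B x) f'"
      using len[OF x] by (intro mult_right_mono) auto
    finally show ?thesis .
  qed
  have "energy \<mu> W f \<le> (\<integral>\<^sup>+y. (\<Sum>x\<in>X. ennreal ((cmod (f y))\<^sup>2) * indicator (?B x) y) \<partial>\<mu>)"
    unfolding energy_def
  proof (rule nn_integral_mono)
    fix y
    show "ennreal ((cmod (f y))\<^sup>2) * indicator W y \<le> (\<Sum>x\<in>X. ennreal ((cmod (f y))\<^sup>2) * indicator (?B x) y)"
    proof (cases "y \<in> W")
      case True
      then obtain x where x: "x \<in> X" "y \<in> ?B x" using cov by blast
      have "(\<Sum>x\<in>X. ennreal ((cmod (f y))\<^sup>2) * indicator (?B x) y) = ennreal ((cmod (f y))\<^sup>2)"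
        by (rule sum_indicator_disjoint_family[OF separated_disjoint[OF X(2)] x(2) X(1) x(1)])
      then show ?thesis using True by simp
    qed simp
  qed
  also have "\<dots> = (\<Sum>x\<in>X. energy \<mu> (?B x) f)"
    unfolding energy_def by (intro nn_integral_sum) measurable
  also have "\<dots> \<le> (\<Sum>x\<in>X. ennreal (1 / 2) * energy lborel (?B x) f')"
    by (intro sum_mono piece)
  also have "\<dots> = ennreal (1 / 2) * (\<Sum>x\<in>X. energy lborel (?B x) f')"
    by (simp add: sum_distrib_left)
  also have "(\<Sum>x\<in>X. energy lborel (?B x) f') \<le> energy lborel UNIV f'"
  proof -
    note L(2)[measurable]
    show ?thesis
      unfolding energy_def
      by (rule sum_nn_integral_disjoint_le[OF X(1) _ separated_disjoint[OF X(2)]]) (simp, simp, measurable)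
  qed
  finally have "energy \<mu> W f \<le> ennreal (1 / 2) * energy lborel UNIV f'"
    by (simp add: mult_left_mono)
  also have "\<dots> = ennreal (1 / 2 * nsq f')"
    unfolding energy_UNIV_lborel[OF L(3)] by (rule ennreal_mult[symmetric]) (simp_all add: nsq_nonneg)
  finally show ?thesis .
qed

end

section \<open>The two upper estimates\<close>

context form_spectral
begin

text \<open>Core and complement each use half of \<open>nsq f'\<close>, so the zeros force the form
  to be at least \<open>- (1 / h\<^sup>2) * nsq f\<close>. The bound \<open>R\<close> both stops the
  greedy covering and counts its points.\<close>

lemma spectral_count_le_core:
  assumes h: "h > 0"
    and len: "\<And>x. x \<in> core h \<Longrightarrow> 0 < len x" "\<And>x. x \<in> core h \<Longrightarrow> len x \<le> L"
      "\<And>x. x \<in> core h \<Longrightarrow> ennreal (len x) * emeasure \<mu> {x..<x + len x} \<le> ennreal (1 / 2)"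
    and R: "\<And>X. finite X \<Longrightarrow> X \<subseteq> core h \<Longrightarrow> separated len X \<Longrightarrow> ennreal (real (card X)) \<le> R"
  shows "spectral_count (- (1 / h\<^sup>2)) E \<le> R"
proof (cases "R = \<infinity>")
  \<comment> \<open>Only a finite \<open>R\<close> bounds the separated families as the greedy
    covering requires; for an infinite one the claim is trivial.\<close>
  case False
  then obtain r where r: "R = ennreal r" "r \<ge> 0" by (cases R) auto
  have "\<exists>X. finite X \<and> X \<subseteq> core h \<and> separated len X \<and> core h \<subseteq> (\<Union>x\<in>X. {x..<x + len x})"
  proof (rule greedy_cover[OF closed_core len(1,2)])
    fix X assume "finite X" "X \<subseteq> core h" "separated len X"
    then show "card X \<le> nat \<lfloor>r\<rfloor>" using R[of X] r by (simp add: le_nat_floor)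
  qed
  then obtain X where X: "finite X" "X \<subseteq> core h" "separated len X" "core h \<subseteq> (\<Union>x\<in>X. {x..<x + len x})"
    by blast
  have "spectral_count (- (1 / h\<^sup>2)) E \<le> ennreal (real (card X))"
  proof (rule spectral_count_le[OF X(1)])
    fix f assume f: "f \<in> form_domain \<mu>" and zero: "\<And>x. x \<in> X \<Longrightarrow> f x = 0"
    note F = form_domain_sq[OF f sets_mu]
    let ?f' = "H1_deriv f"
    have nn: "0 \<le> 1 / h\<^sup>2 * nsq f" "0 \<le> 1 / 2 * nsq ?f'" using nsq_nonneg by auto
    have "ennreal (LINT x|\<mu>. (cmod (f x))\<^sup>2) = energy \<mu> (- core h \<union> core h) f"
      using form_domain_energy[OF f sets_mu] by (simp add: Compl_partition2)
    also have "\<dots> \<le> energy \<mu> (- core h) f + energy \<mu> (core h) f"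
      using closed_core F(4) by (intro energy_Un_le sets_mu) (auto simp: L2_def)
    also have "\<dots> \<le> ennreal (1 / h\<^sup>2 * nsq f + 1 / 2 * nsq ?f') + ennreal (1 / 2 * nsq ?f')"
      using X len zero by (intro add_mono energy_compl_core[OF h F(2)] energy_le_of_zeros[OF F(2)]) auto
    also have "\<dots> = ennreal (1 / h\<^sup>2 * nsq f + nsq ?f')"
      using nn by (simp add: ennreal_plus[symmetric] del: ennreal_plus)
    finally have "(LINT x|\<mu>. (cmod (f x))\<^sup>2) \<le> 1 / h\<^sup>2 * nsq f + nsq ?f'"
      using nn by (subst (asm) ennreal_le_iff) auto
    then show "Re (form \<mu> f f) \<ge> - (1 / h\<^sup>2) * nsq f"
      using form_self[OF f sets_mu F(2)] by simp
  qed
  also have "\<dots> \<le> R" using R X by blast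
  finally show ?thesis .
qed simp

text \<open>The length is the constant \<open>D = 1 / s\<close> with \<open>s\<close> the supremum,
  and every interval of that length has mass at most \<open>1 / (2 * D)\<close>. Disjoint intervals
  of length \<open>D\<close> centred at the chosen points lie in \<open>M\<close>, so their number
  is at most \<open>s\<close> times its measure.\<close>

lemma spectral_count_le_SUP:
  assumes h: "h > 0" and M: "M = otelbaev_set \<mu> 2 (1 / (2 * h)\<^sup>2)"
  shows "spectral_count (- (1 / h\<^sup>2)) E
    \<le> (SUP y\<in>M. ennreal (sqrt (otelbaev \<mu> 2 y))) * emeasure lborel M"
proof (cases "M = {}")
  case True
  have "core h = {}" using core_margin[OF h, of x x for x] h M True by fastforce
  then show ?thesis by (intro spectral_count_le_core[OF h, of "\<lambda>_. 1" 1]) auto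
next
  case False
  define S where "S = (SUP y\<in>M. ennreal (sqrt (otelbaev \<mu> 2 y)))"
  obtain b where b: "\<And>x. otelbaev \<mu> 2 x \<le> b"
    using otelbaev_bounded[OF radon brinck, of 2] by (auto simp: bdd_above_def)
  have "S \<le> ennreal (sqrt b)"
    unfolding S_def using b by (intro SUP_least ennreal_leI) simp
  then have "S \<noteq> \<infinity>" by (auto simp: top_unique)
  then obtain s where s: "S = ennreal s" "s \<ge> 0" by (cases S) auto
  have s_ge: "sqrt (otelbaev \<mu> 2 y) \<le> s" if "y \<in> M" for y
  proof -
    have "ennreal (sqrt (otelbaev \<mu> 2 y)) \<le> ennreal s"
      unfolding s(1)[symmetric] S_def using that by (rule SUP_upper)
    then show ?thesis using s(2) by (simp add: ennreal_le_iff)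
  qed
  obtain y where "y \<in> M" using False by blast
  then have "sqrt (1 / (2 * h)\<^sup>2) \<le> s"
    using s_ge[of y] M by (intro order_trans[OF _ s_ge[of y]] real_sqrt_le_mono) (auto simp: otelbaev_set_def)
  then have sh: "1 / (2 * h) \<le> s" using h sqrt_one_div_square[of "2 * h"] by (simp only:)
  moreover have "0 < 1 / (2 * h)" using h by simp
  ultimately have s0: "s > 0" by linarith
  define D where "D = 1 / s"
  have D: "D > 0" "D \<le> 2 * h" using s0 sh h by (auto simp: D_def field_simps)
  \<comment> \<open>Outside \<open>M\<close> the function is below
    \<open>1 / (2 * h)\<^sup>2\<close>, hence below \<open>s\<^sup>2\<close> since \<open>M\<close>
    is nonempty; the supremum over \<open>M\<close> thus controls the whole line.\<close>
  have q: "otelbaev \<mu> 2 x \<le> 1 / D\<^sup>2" for x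
  proof -
    have "otelbaev \<mu> 2 x \<le> s\<^sup>2"
    proof (cases "x \<in> M")
      case True
      then show ?thesis using s_ge s(2) sqrt_le_D by blast
    next
      case False
      then have "otelbaev \<mu> 2 x < (1 / (2 * h))\<^sup>2" by (simp add: M otelbaev_set_def power_divide)
      also have "\<dots> \<le> s\<^sup>2" using sh h by (intro power_mono) auto
      finally show ?thesis by simp
    qed
    then show ?thesis by (simp add: D_def power_divide)
  qed
  show ?thesis
    unfolding S_def[symmetric]
  proof (rule spectral_count_le_core[OF h])
    fix x assume "x \<in> core h"
    show "0 < D" by (rule D)
    show "D \<le> D" by simp
    have "emeasure \<mu> {x..<x + D} \<le> ennreal (1 / (2 * D))"
    proof (rule emeasure_Ico_le[OF sets_mu])
      fix e :: real assume e: "e > 0"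
      \<comment> \<open>The mass bound holds for lengths strictly below \<open>D\<close>; capping
        \<open>e\<close> at \<open>D / 2\<close> keeps \<open>d\<close> positive.\<close>
      define d where "d = D - min e (D / 2)"
      have d: "0 < d" "d < D" using e D by (auto simp: d_def min_def)
      have "{x..x + D - e} \<subseteq> Delta (x + d / 2) d" by (auto simp: Delta_def d_def)
      then have "emeasure \<mu> {x..x + D - e} \<le> emeasure \<mu> (Delta (x + d / 2) d)"
        by (intro emeasure_mono) (auto simp: sets_mu Delta_def)
      also have "\<dots> \<le> ennreal (1 / (2 * D))"
        using d q by (intro emeasure_Delta_le) auto
      finally show "emeasure \<mu> {x..x + D - e} \<le> ennreal (1 / (2 * D))" .
    qed
    then have "ennreal D * emeasure \<mu> {x..<x + D} \<le> ennreal D * ennreal (1 / (2 * D))"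
      by (rule mult_left_mono) simp
    also have "\<dots> = ennreal (1 / 2)" using D by (simp add: ennreal_mult[symmetric])
    finally show "ennreal D * emeasure \<mu> {x..<x + D} \<le> ennreal (1 / 2)" .
  next
    fix X assume X: "finite X" "X \<subseteq> core h" "separated (\<lambda>_. D) X"
    \<comment> \<open>Centring matters: the radius \<open>D / 2\<close> is at most the margin
      \<open>h\<close>, while the one-sided intervals of length up to \<open>2 * h\<close> might
      leave \<open>M\<close>.\<close>
    let ?A = "\<lambda>x. {x - D / 2<..<x + D / 2}"
    have "?A x \<subseteq> M" if "x \<in> X" for x
      using core_margin[OF h, of x] X(2) that D unfolding M by (force simp: abs_less_iff)
    moreover have "disjoint_family_on ?A X"
      using X(3) by (force simp: separated_def disjoint_family_on_def neq_iff)
    ultimately have "(\<Sum>x\<in>X. \<integral>\<^sup>+y\<in>?A x. 1 \<partial>lborel) \<le> (\<integral>\<^sup>+y\<in>M. 1 \<partial>lborel)"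
      using X(1) by (intro sum_nn_integral_disjoint_le) simp_all
    moreover have "M \<in> sets borel" using closed_otelbaev_set M by simp
    moreover have "(\<integral>\<^sup>+y\<in>?A x. 1 \<partial>lborel) = ennreal D" for x
      using D by simp
    ultimately have "ennreal (real (card X)) * ennreal D \<le> emeasure lborel M"
      by (simp add: ennreal_of_nat_eq_real_of_nat)
    then have "S * (ennreal (real (card X)) * ennreal D) \<le> S * emeasure lborel M"
      by (rule mult_left_mono) simp
    moreover have "S * (ennreal (real (card X)) * ennreal D) = ennreal (real (card X))"
      using s0 by (simp add: s(1) D_def ennreal_mult[symmetric])
    ultimately show "ennreal (real (card X)) \<le> S * emeasure lborel M" by simp
  qed
qed

text \<open>On the one-sided interval of length \<open>d x / 2\<close> the Lipschitz bound keeps the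
  square root of the Otelbaev function at least \<open>1 / (2 * d x)\<close>. Each interval thus
  contributes at least 1/4 to the integral, which is the origin of the factor 4.\<close>

lemma spectral_count_le_integral:
  assumes h: "h > 0" and M: "M = otelbaev_set \<mu> 2 (1 / (2 * h)\<^sup>2)"
  shows "spectral_count (- (1 / h\<^sup>2)) E \<le> 4 * (\<integral>\<^sup>+y\<in>M. ennreal (sqrt (otelbaev \<mu> 2 y)) \<partial>lborel)"
proof -
  define d where "d x = 1 / sqrt (otelbaev \<mu> 2 x)" for x
  have d: "0 < d x" "d x \<le> 2 * h" "otelbaev \<mu> 2 x = 1 / (d x)\<^sup>2" if "x \<in> core h" for x
  proof -
    have "x \<in> M" using core_margin[OF h that, of x] h M by simp
    then have q: "1 / (2 * h)\<^sup>2 \<le> otelbaev \<mu> 2 x" by (simp add: M otelbaev_set_def)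
    then have q0: "otelbaev \<mu> 2 x > 0" using h by (smt (verit) zero_less_divide_1_iff zero_less_power)
    then show "0 < d x" "otelbaev \<mu> 2 x = 1 / (d x)\<^sup>2" by (auto simp: d_def power_divide)
    have "sqrt (1 / (2 * h)\<^sup>2) \<le> sqrt (otelbaev \<mu> 2 x)" using q by (rule real_sqrt_le_mono)
    then have "1 / (2 * h) \<le> sqrt (otelbaev \<mu> 2 x)" using h sqrt_one_div_square[of "2 * h"] by (simp only:)
    then show "d x \<le> 2 * h" using h q0 by (simp add: d_def field_simps)
  qed
  have sq[measurable]: "(\<lambda>y. ennreal (sqrt (otelbaev \<mu> 2 y))) \<in> borel_measurable borel"
    using otelbaev_measurable[of 2] by measurable
  show ?thesis
  proof (rule spectral_count_le_core[OF h, of "\<lambda>x. d x / 2" h])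
    fix x assume x: "x \<in> core h"
    note dx = d[OF x]
    show "0 < d x / 2" "d x / 2 \<le> h" using dx by auto
    \<comment> \<open>This is the right half of the centred interval of length \<open>d x\<close>,
      so the product with the length is at most 1/4, half of what is allowed.\<close>
    have "emeasure \<mu> {x..<x + d x / 2} \<le> ennreal (1 / (2 * d x))"
    proof (rule emeasure_Ico_le[OF sets_mu])
      fix e :: real assume e: "e > 0"
      define c where "c = d x - 2 * min e (d x / 4)"
      have c: "0 < c" "c < d x" using e dx by (auto simp: c_def min_def)
      have "{x..x + d x / 2 - e} \<subseteq> Delta x c"
        using c by (auto simp: Delta_def c_def)
      then have "emeasure \<mu> {x..x + d x / 2 - e} \<le> emeasure \<mu> (Delta x c)"
        by (intro emeasure_mono) (auto simp: sets_mu Delta_def)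
      also have "\<dots> \<le> ennreal (1 / (2 * d x))"
        using c dx by (intro emeasure_Delta_le) auto
      finally show "emeasure \<mu> {x..x + d x / 2 - e} \<le> ennreal (1 / (2 * d x))" .
    qed
    then have "ennreal (d x / 2) * emeasure \<mu> {x..<x + d x / 2} \<le> ennreal (d x / 2) * ennreal (1 / (2 * d x))"
      by (rule mult_left_mono) simp
    also have "\<dots> = ennreal (1 / 4)" using dx by (simp add: ennreal_mult[symmetric])
    also have "\<dots> \<le> ennreal (1 / 2)" by (rule ennreal_leI) simp
    finally show "ennreal (d x / 2) * emeasure \<mu> {x..<x + d x / 2} \<le> ennreal (1 / 2)" .
  next
    fix X assume X: "finite X" "X \<subseteq> core h" "separated (\<lambda>x. d x / 2) X"
    let ?B = "\<lambda>x. {x..<x + d x / 2}"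
    have sub: "?B x \<subseteq> M" if "x \<in> X" for x
    proof
      fix y assume y: "y \<in> ?B x"
      have x: "x \<in> core h" using X(2) that by blast
      have "\<bar>x - y\<bar> < h" using y d[OF x] by auto
      then show "y \<in> M" using core_margin[OF h x] M by blast
    qed
    have one: "ennreal 1 \<le> (\<integral>\<^sup>+y\<in>?B x. 4 * ennreal (sqrt (otelbaev \<mu> 2 y)) \<partial>lborel)" if "x \<in> X" for x
    proof -
      have x: "x \<in> core h" using X(2) that by blast
      note dx = d[OF x]
      have "ennreal 1 = ennreal (2 / d x) * ennreal (d x / 2)"
        using dx by (simp add: ennreal_mult[symmetric])
      also have "ennreal (d x / 2) = emeasure lborel (?B x)" using dx by simp
      also have "ennreal (2 / d x) * \<dots> = (\<integral>\<^sup>+y. ennreal (2 / d x) * indicator (?B x) y \<partial>lborel)"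
        by (simp add: nn_integral_cmult_indicator)
      also have "\<dots> \<le> (\<integral>\<^sup>+y\<in>?B x. 4 * ennreal (sqrt (otelbaev \<mu> 2 y)) \<partial>lborel)"
      proof (rule nn_integral_mono)
        fix y
        show "ennreal (2 / d x) * indicator (?B x) y \<le> 4 * ennreal (sqrt (otelbaev \<mu> 2 y)) * indicator (?B x) y"
        proof (cases "y \<in> ?B x")
          case True
          then have "d x + 2 * \<bar>x - y\<bar> \<le> 2 * d x" by auto
          then have "(d x + 2 * \<bar>x - y\<bar>)\<^sup>2 \<le> (2 * d x)\<^sup>2" using dx by (intro power_mono) auto
          moreover have "0 < (d x + 2 * \<bar>x - y\<bar>)\<^sup>2" using dx by (intro zero_less_power add_pos_nonneg) auto
          ultimately have "1 / (2 * d x)\<^sup>2 \<le> 1 / (d x + 2 * \<bar>x - y\<bar>)\<^sup>2"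
            by (intro divide_left_mono) (auto intro!: mult_pos_pos)
          also have "\<dots> \<le> otelbaev \<mu> 2 y" using dx by (intro otelbaev_Lipschitz) auto
          finally have "sqrt (1 / (2 * d x)\<^sup>2) \<le> sqrt (otelbaev \<mu> 2 y)" by (rule real_sqrt_le_mono)
          then have "1 / (2 * d x) \<le> sqrt (otelbaev \<mu> 2 y)" using dx sqrt_one_div_square[of "2 * d x"] by (simp only:)
          then have "2 / d x \<le> 4 * sqrt (otelbaev \<mu> 2 y)" by simp
          then have "ennreal (2 / d x) \<le> ennreal (4 * sqrt (otelbaev \<mu> 2 y))" by (rule ennreal_leI)
          then show ?thesis using True by (simp add: ennreal_mult')
        qed simp
      qed
      finally show ?thesis .
    qed
    have "ennreal (real (card X)) = (\<Sum>x\<in>X. ennreal 1)"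
      by (simp add: ennreal_of_nat_eq_real_of_nat)
    also have "\<dots> \<le> (\<Sum>x\<in>X. \<integral>\<^sup>+y\<in>?B x. 4 * ennreal (sqrt (otelbaev \<mu> 2 y)) \<partial>lborel)"
      by (intro sum_mono one)
    also have "\<dots> \<le> (\<integral>\<^sup>+y\<in>M. 4 * ennreal (sqrt (otelbaev \<mu> 2 y)) \<partial>lborel)"
      by (rule sum_nn_integral_disjoint_le[OF X(1) _ separated_disjoint[OF X(3)] sub]) (simp, simp, measurable)
    also have "\<dots> = 4 * (\<integral>\<^sup>+y\<in>M. ennreal (sqrt (otelbaev \<mu> 2 y)) \<partial>lborel)"
    proof -
      have [measurable]: "M \<in> sets borel" using closed_otelbaev_set M by simp
      show ?thesis by (subst nn_integral_cmult[symmetric]) (auto simp: mult.assoc)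
    qed
    finally show "ennreal (real (card X)) \<le> 4 * (\<integral>\<^sup>+y\<in>M. ennreal (sqrt (otelbaev \<mu> 2 y)) \<partial>lborel)" .
  qed
qed

end

section \<open>Lower bounds\<close>

text \<open>The half-angle formula gives \<open>(sin (pi / 12))\<^sup>2 = (2 - sqrt 3) / 4\<close>,
  to be compared with \<open>(pi / 12)\<^sup>2\<close>. The constant is what makes
  \<open>pi\<^sup>2 + 3 / 4\<close> exceed 10.\<close>

lemma pi_squared_gt: "pi\<^sup>2 > 37 / 4"
proof -
  have "cos (pi / 6) = 1 - 2 * (sin (pi / 12))\<^sup>2"
    using cos_double_sin[of "pi / 12"] by simp
  then have "(sin (pi / 12))\<^sup>2 = (2 - sqrt 3) / 4"
    by (simp add: cos_30)
  moreover have "\<bar>sin (pi / 12)\<bar> \<le> \<bar>pi / 12\<bar>" by (rule abs_sin_x_le_abs_x)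
  then have "(sin (pi / 12))\<^sup>2 \<le> (pi / 12)\<^sup>2" by (simp only: abs_le_square_iff)
  moreover have "sqrt 3 \<le> 1.74" by (rule real_le_lsqrt) (auto simp: power2_eq_square)
  ultimately show ?thesis by (simp add: power_divide)
qed

section \<open>Tent functions and their derivatives\<close>

definition tent :: "real \<Rightarrow> real \<Rightarrow> real \<Rightarrow> complex" where
  "tent r x y = complex_of_real (max 0 (r - \<bar>y - x\<bar>))"

definition tent_deriv :: "real \<Rightarrow> real \<Rightarrow> real \<Rightarrow> complex" where
  "tent_deriv r x y = complex_of_real (indicator {x - r..<x} y - indicator {x..<x + r} y)"

lemma fmeasurable_Icc_Int_Ico:
  fixes a b u v :: real
  shows "{a..b} \<inter> {u..<v} \<in> fmeasurable lborel"
  by (rule fmeasurable_Int_fmeasurable) (auto simp: fmeasurable_def emeasure_lborel_Icc_eq)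

text \<open>The explicit value reduces integrals of the tent derivative to a case distinction in
  linear arithmetic.\<close>

lemma measure_Icc_Int_Ico:
  fixes a b u v :: real
  shows "measure lborel ({a..b} \<inter> {u..<v}) = max 0 (min b v - max a u)"
proof (rule antisym)
  have "measure lborel ({a..b} \<inter> {u..<v}) \<le> measure lborel {max a u..min b v}"
    by (rule measure_mono_fmeasurable) (auto simp: fmeasurable_def emeasure_lborel_Icc_eq)
  then show "measure lborel ({a..b} \<inter> {u..<v}) \<le> max 0 (min b v - max a u)"
    by (cases "max a u \<le> min b v") (simp_all add: not_le)
  have "measure lborel {max a u..<min b v} \<le> measure lborel ({a..b} \<inter> {u..<v})"
    using fmeasurable_Icc_Int_Ico by (intro measure_mono_fmeasurable) auto
  then show "max 0 (min b v - max a u) \<le> measure lborel ({a..b} \<inter> {u..<v})"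
    by (cases "max a u \<le> min b v") (auto simp: max_def)
qed

lemma cmod_tent_squared_le:
  assumes "r > 0"
  shows "(cmod (tent r x y))\<^sup>2 \<le> r\<^sup>2 * indicator {x - r..x + r} y"
proof (cases "y \<in> {x - r..x + r}")
  case True
  have "\<bar>max 0 (r - \<bar>y - x\<bar>)\<bar> \<le> r" using assms by auto
  then have "\<bar>max 0 (r - \<bar>y - x\<bar>)\<bar>\<^sup>2 \<le> r\<^sup>2" by (rule power_mono) simp
  then show ?thesis using True by (simp add: tent_def)
next
  case False
  then have "\<bar>y - x\<bar> > r" by auto
  then show ?thesis using False by (simp add: tent_def)
qed

text \<open>Bounding the tent by its height on its support loses a factor 3 in the squared norm,
  which is affordable.\<close>

lemma tent_L2: "r > 0 \<Longrightarrow> tent r x \<in> L2"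
  and nsq_tent: "r > 0 \<Longrightarrow> nsq (tent r x) \<le> 2 * r ^ 3"
proof -
  assume r: "r > 0"
  have [measurable]: "tent r x \<in> borel_measurable borel"
    unfolding tent_def by measurable
  have int: "integrable lborel (\<lambda>y. r\<^sup>2 * indicator {x - r..x + r} y)"
    by (auto intro!: integrable_real_indicator simp: emeasure_lborel_Icc_eq)
  have "integrable lborel (\<lambda>y. (cmod (tent r x y))\<^sup>2)"
    by (rule Bochner_Integration.integrable_bound[OF int])
      (use cmod_tent_squared_le[OF r] in \<open>auto intro!: AE_I2\<close>)
  then show "tent r x \<in> L2" by (simp add: L2_def)
  have "nsq (tent r x) \<le> (LINT y|lborel. r\<^sup>2 * indicator {x - r..x + r} y)"
    unfolding nsq_def using cmod_tent_squared_le[OF r] \<open>integrable lborel (\<lambda>y. (cmod (tent r x y))\<^sup>2)\<close> int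
    by (intro integral_mono) auto
  also have "\<dots> = 2 * r ^ 3"
    using r by (simp add: power3_eq_cube power2_eq_square)
  finally show "nsq (tent r x) \<le> 2 * r ^ 3" .
qed

lemma tent_deriv_L2: "r > 0 \<Longrightarrow> tent_deriv r x \<in> L2"
  and nsq_tent_deriv: "r > 0 \<Longrightarrow> nsq (tent_deriv r x) = 2 * r"
proof -
  assume r: "r > 0"
  have "(\<lambda>y. (cmod (tent_deriv r x y))\<^sup>2) = indicat_real {x - r..<x + r}"
    using r by (auto simp: tent_deriv_def indicator_def fun_eq_iff simp flip: of_real_diff)
  then show "tent_deriv r x \<in> L2" "nsq (tent_deriv r x) = 2 * r"
    using r by (auto simp: L2_def nsq_def tent_deriv_def[abs_def] intro!: integrable_real_indicator)
qed

lemma has_H1_deriv_tent: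
  assumes r: "r > 0"
  shows "has_H1_deriv (tent r x) (tent_deriv r x)"
  unfolding has_H1_deriv_def
proof (intro conjI tent_L2[OF r] tent_deriv_L2[OF r] allI impI)
  fix a b :: real assume ab: "a \<le> b"
  let ?A = "{a..b} \<inter> {x - r..<x}" and ?B = "{a..b} \<inter> {x..<x + r}"
  have int: "integrable lborel (indicat_real ({a..b} \<inter> {u..<v}))" for u v
    using fmeasurable_Icc_Int_Ico[of a b u v]
    by (intro integrable_real_indicator) (simp_all add: fmeasurable_def)
  have "(LINT y:{a..b}|lborel. tent_deriv r x y)
      = (LINT y|lborel. complex_of_real (indicat_real ?A y - indicat_real ?B y))"
    unfolding set_lebesgue_integral_def tent_deriv_def
    by (intro Bochner_Integration.integral_cong) (auto simp: indicator_def)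
  also have "\<dots> = complex_of_real (LINT y|lborel. indicat_real ?A y - indicat_real ?B y)"
    by (rule integral_complex_of_real)
  also have "(LINT y|lborel. indicat_real ?A y - indicat_real ?B y) = measure lborel ?A - measure lborel ?B"
    using int[of "x - r" x] int[of x "x + r"] by simp
  also have "\<dots> = max 0 (r - \<bar>b - x\<bar>) - max 0 (r - \<bar>a - x\<bar>)"
    unfolding measure_Icc_Int_Ico max_def min_def using ab r by (smt (verit))
  finally show "tent r x b - tent r x a = (LINT y:{a..b}|lborel. tent_deriv r x y)"
    by (simp add: tent_def)
qed

lemma has_H1_deriv_sum:
  assumes "finite I" "\<And>i. i \<in> I \<Longrightarrow> has_H1_deriv (f i) (g i)"
  shows "has_H1_deriv (\<lambda>x. \<Sum>i\<in>I. c i * f i x) (\<lambda>x. \<Sum>i\<in>I. c i * g i x)"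
  using assms
proof (induction rule: finite_induct)
  case empty
  then show ?case by (simp add: has_H1_deriv_def L2_zero set_lebesgue_integral_def)
next
  case (insert i I)
  then show ?case
    using has_H1_deriv_lincomb[of "f i" "g i" "\<lambda>x. \<Sum>i\<in>I. c i * f i x" "\<lambda>x. \<Sum>i\<in>I. c i * g i x" "c i" 1]
    by simp
qed

section \<open>Sums with pointwise vanishing products\<close>

text \<open>At most one \<open>g i\<close> is nonzero, so there are no cross terms. Being pointwise,
  the identity can be integrated against any measure.\<close>

lemma cmod_sum_orthogonal:
  fixes c g :: "'i \<Rightarrow> complex"
  assumes "finite I" "\<And>i j. i \<in> I \<Longrightarrow> j \<in> I \<Longrightarrow> i \<noteq> j \<Longrightarrow> g i * g j = 0"
  shows "(cmod (\<Sum>i\<in>I. c i * g i))\<^sup>2 = (\<Sum>i\<in>I. (cmod (c i))\<^sup>2 * (cmod (g i))\<^sup>2)"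
proof (cases "\<exists>k\<in>I. g k \<noteq> 0")
  case True
  then obtain k where k: "k \<in> I" "g k \<noteq> 0" by blast
  then have zero: "g i = 0" if "i \<in> I - {k}" for i using assms(2)[of i k] that by auto
  have "(\<Sum>i\<in>I. c i * g i) = c k * g k"
    using k assms(1) zero by (subst sum.remove[of I k]) auto
  moreover have "(\<Sum>i\<in>I. (cmod (c i))\<^sup>2 * (cmod (g i))\<^sup>2) = (cmod (c k))\<^sup>2 * (cmod (g k))\<^sup>2"
    using k assms(1) zero by (subst sum.remove[of I k]) auto
  ultimately show ?thesis by (simp add: norm_mult power_mult_distrib)
qed simp

lemma integral_cmod_sum_orthogonal:
  fixes c :: "'i \<Rightarrow> complex"
  assumes "finite I" "\<And>i j x. i \<in> I \<Longrightarrow> j \<in> I \<Longrightarrow> i \<noteq> j \<Longrightarrow> g i x * g j x = 0"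
    and "\<And>i. i \<in> I \<Longrightarrow> integrable M (\<lambda>x. (cmod (g i x))\<^sup>2)"
  shows "(LINT x|M. (cmod (\<Sum>i\<in>I. c i * g i x))\<^sup>2) = (\<Sum>i\<in>I. (cmod (c i))\<^sup>2 * (LINT x|M. (cmod (g i x))\<^sup>2))"
proof -
  have "(LINT x|M. (cmod (\<Sum>i\<in>I. c i * g i x))\<^sup>2) = (LINT x|M. (\<Sum>i\<in>I. (cmod (c i))\<^sup>2 * (cmod (g i x))\<^sup>2))"
    using assms(1,2) by (subst cmod_sum_orthogonal) auto
  also have "\<dots> = (\<Sum>i\<in>I. (cmod (c i))\<^sup>2 * (LINT x|M. (cmod (g i x))\<^sup>2))"
    using assms(3) by (subst Bochner_Integration.integral_sum) auto
  finally show ?thesis .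
qed

lemma tent_orthogonal:
  assumes "2 * r \<le> \<bar>x - y\<bar>"
  shows "tent r x z * tent r y z = 0" "tent_deriv r x z * tent_deriv r y z = 0"
proof -
  have "r - \<bar>z - x\<bar> \<le> 0 \<or> r - \<bar>z - y\<bar> \<le> 0" using assms by linarith
  then show "tent r x z * tent r y z = 0" by (auto simp: tent_def max_def)
  show "tent_deriv r x z * tent_deriv r y z = 0"
    using assms unfolding tent_deriv_def indicator_def atLeastLessThan_iff by (smt (verit) of_bool_eq_0_iff of_real_0 diff_0_right mult_zero_left mult_zero_right)
qed

section \<open>Counting tents\<close>

context form_spectral
begin

text \<open>On \<open>Delta x r\<close>, the middle half of its support, the tent is at least
  \<open>r / 2\<close>, so the mass term exceeds \<open>r\<^sup>2 / 4 * (10 / r)\<close>, that is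
  \<open>5 / 2 * r\<close>. The derivative contributes \<open>2 * r\<close> and the remaining term
  at most \<open>r / 2\<close>.\<close>

lemma tent_bracket_negative:
  assumes r: "r > 0" and x: "x \<in> otelbaev_set \<mu> (inverse (pi\<^sup>2 + 3 / 4)) (1 / r\<^sup>2)"
  shows "nsq (tent_deriv r x) + 1 / (4 * r\<^sup>2) * nsq (tent r x) < (LINT y|\<mu>. (cmod (tent r x y))\<^sup>2)"
proof -
  have fd: "tent r x \<in> form_domain \<mu>"
    by (rule H1_subset_form_domain[OF radon brinck has_H1_deriv_tent[OF r]])
  define p where "p = pi\<^sup>2 + 3 / 4"
  have p: "p > 10" using pi_squared_gt by (simp add: p_def)
  have "emeasure \<mu> (Delta x r) < \<infinity>"
    using radon compact_Icc unfolding radon_measure_def Delta_def by blast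
  then have fin: "emeasure \<mu> (Delta x r) \<noteq> \<infinity>" by simp
  have "ennreal (1 / (inverse p * r)) \<le> emeasure \<mu> (Delta x r)"
    using x r p unfolding p_def by (intro emeasure_Delta_ge) auto
  then have "ennreal (1 / (inverse p * r)) \<le> ennreal (measure \<mu> (Delta x r))"
    using fin by (simp add: emeasure_eq_ennreal_measure)
  then have m: "p / r \<le> measure \<mu> (Delta x r)"
    using p r by (subst (asm) ennreal_le_iff) (auto simp: field_simps)
  have "r\<^sup>2 / 4 * measure \<mu> (Delta x r) = (LINT y|\<mu>. r\<^sup>2 / 4 * indicator (Delta x r) y)"
    using sets_mu by (simp add: Delta_def sets_eq_imp_space_eq[OF sets_mu])
  also have "\<dots> \<le> (LINT y|\<mu>. (cmod (tent r x y))\<^sup>2)"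
  proof (rule integral_mono)
    show "integrable \<mu> (\<lambda>y. r\<^sup>2 / 4 * indicator (Delta x r) y)"
      using fin sets_mu by (intro integrable_mult_right integrable_real_indicator)
        (auto simp: Delta_def less_top)
    show "integrable \<mu> (\<lambda>y. (cmod (tent r x y))\<^sup>2)" using fd by (simp add: form_domain_def)
    fix y
    show "r\<^sup>2 / 4 * indicator (Delta x r) y \<le> (cmod (tent r x y))\<^sup>2"
    proof (cases "y \<in> Delta x r")
      case True
      then have "r / 2 \<le> r - \<bar>y - x\<bar>" by (auto simp: Delta_def abs_if)
      then have "(r / 2)\<^sup>2 \<le> (max 0 (r - \<bar>y - x\<bar>))\<^sup>2" using r by (intro power_mono) auto
      then show ?thesis using True by (simp add: tent_def power_divide)
    qed simp
  qed
  finally have "r\<^sup>2 / 4 * (p / r) \<le> (LINT y|\<mu>. (cmod (tent r x y))\<^sup>2)"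
    using m by (meson mult_left_mono order_trans zero_le_power2 divide_nonneg_nonneg zero_le_numeral)
  moreover have "r\<^sup>2 / 4 * (p / r) > 5 / 2 * r"
    using r p by (simp add: power2_eq_square)
  moreover have "1 / (4 * r\<^sup>2) * nsq (tent r x) \<le> 1 / (4 * r\<^sup>2) * (2 * r ^ 3)"
    using nsq_tent[OF r, of x] by (intro mult_left_mono) auto
  moreover have "1 / (4 * r\<^sup>2) * (2 * r ^ 3) = r / 2"
    using r by (simp add: power2_eq_square power3_eq_cube)
  ultimately show ?thesis using nsq_tent_deriv[OF r, of x] by linarith
qed

text \<open>Tents with vanishing products diagonalise all three quadratic quantities, so the strict
  inequality for single tents passes to every nontrivial combination.\<close>

lemma spectral_count_ge_separated:
  assumes r: "r > 0" and s: "- (1 / (4 * r\<^sup>2)) \<le> s"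
    and X: "finite X" "X \<subseteq> otelbaev_set \<mu> (inverse (pi\<^sup>2 + 3 / 4)) (1 / r\<^sup>2)" "separated (\<lambda>_. 2 * r) X"
  shows "ennreal (real (card X)) \<le> spectral_count s E"
proof -
  define n where "n = card X"
  obtain p where "bij_betw p {0..<n} X"
    using ex_bij_betw_nat_finite[OF X(1)] by (auto simp: n_def)
  then have p: "\<And>i. i < n \<Longrightarrow> p i \<in> X" "\<And>i j. i < n \<Longrightarrow> j < n \<Longrightarrow> i \<noteq> j \<Longrightarrow> p i \<noteq> p j"
    by (auto simp: bij_betw_def inj_on_def)
  have dist: "2 * r \<le> \<bar>p i - p j\<bar>" if "i < n" "j < n" "i \<noteq> j" for i j
  proof -
    have "p i < p j \<Longrightarrow> p i + 2 * r \<le> p j" "p j < p i \<Longrightarrow> p j + 2 * r \<le> p i"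
      using p(1) that X(3) unfolding separated_def by blast+
    then show ?thesis using p(2)[OF that] by linarith
  qed
  have D: "has_H1_deriv (tent r (p i)) (tent_deriv r (p i))" for i
    by (rule has_H1_deriv_tent[OF r])
  have fd: "tent r (p i) \<in> form_domain \<mu>" for i
    by (rule H1_subset_form_domain[OF radon brinck D])
  have "ennreal (real n) \<le> spectral_count s E"
  proof (rule spectral_count_ge[OF fd])
    fix c f assume f: "f = (\<lambda>x. \<Sum>i<n. c i * tent r (p i) x)" and c: "\<exists>i<n. c i \<noteq> (0 :: complex)"
    define f' where "f' = (\<lambda>x. \<Sum>i<n. c i * tent_deriv r (p i) x)"
    have H: "has_H1_deriv f f'" unfolding f f'_def using D by (intro has_H1_deriv_sum) auto
    have F: "f \<in> form_domain \<mu>" by (rule H1_subset_form_domain[OF radon brinck H])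
    have 1: "nsq f' = (\<Sum>i<n. (cmod (c i))\<^sup>2 * nsq (tent_deriv r (p i)))"
      unfolding f'_def nsq_def using tent_orthogonal(2)[OF dist] tent_deriv_L2[OF r]
      by (intro integral_cmod_sum_orthogonal) (auto simp: L2_def)
    have 2: "nsq f = (\<Sum>i<n. (cmod (c i))\<^sup>2 * nsq (tent r (p i)))"
      unfolding f nsq_def using tent_orthogonal(1)[OF dist] tent_L2[OF r]
      by (intro integral_cmod_sum_orthogonal) (auto simp: L2_def)
    have 3: "(LINT x|\<mu>. (cmod (f x))\<^sup>2) = (\<Sum>i<n. (cmod (c i))\<^sup>2 * (LINT x|\<mu>. (cmod (tent r (p i) x))\<^sup>2))"
      unfolding f using tent_orthogonal(1)[OF dist] fd
      by (intro integral_cmod_sum_orthogonal) (auto simp: form_domain_def)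
    have neg: "nsq (tent_deriv r (p i)) + 1 / (4 * r\<^sup>2) * nsq (tent r (p i))
        < (LINT x|\<mu>. (cmod (tent r (p i) x))\<^sup>2)" if "i < n" for i
      using X(2) p(1)[OF that] by (intro tent_bracket_negative r) auto
    obtain k where k: "k < n" "c k \<noteq> 0" using c by blast
    have "nsq f' + 1 / (4 * r\<^sup>2) * nsq f
        = (\<Sum>i<n. (cmod (c i))\<^sup>2 * (nsq (tent_deriv r (p i)) + 1 / (4 * r\<^sup>2) * nsq (tent r (p i))))"
      unfolding 1 2 by (simp add: sum_distrib_left sum.distrib distrib_left mult_ac)
    also have "\<dots> < (LINT x|\<mu>. (cmod (f x))\<^sup>2)"
      unfolding 3
    proof (rule sum_strict_mono_ex1)
      show "\<forall>i\<in>{..<n}. (cmod (c i))\<^sup>2 * (nsq (tent_deriv r (p i)) + 1 / (4 * r\<^sup>2) * nsq (tent r (p i)))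
          \<le> (cmod (c i))\<^sup>2 * (LINT x|\<mu>. (cmod (tent r (p i) x))\<^sup>2)"
        using neg by (intro ballI mult_left_mono) (auto intro: less_imp_le)
      show "\<exists>i\<in>{..<n}. (cmod (c i))\<^sup>2 * (nsq (tent_deriv r (p i)) + 1 / (4 * r\<^sup>2) * nsq (tent r (p i)))
          < (cmod (c i))\<^sup>2 * (LINT x|\<mu>. (cmod (tent r (p i) x))\<^sup>2)"
        using neg[OF k(1)] k by (intro bexI[of _ k] mult_strict_left_mono) auto
    qed simp
    finally have "nsq f' - (LINT x|\<mu>. (cmod (f x))\<^sup>2) < - (1 / (4 * r\<^sup>2)) * nsq f" by simp
    also have "\<dots> \<le> s * nsq f" using s nsq_nonneg by (rule mult_right_mono)
    finally show "Re (form \<mu> f f) < s * nsq f"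
      using form_self[OF F sets_mu H] by simp
  qed
  then show ?thesis by (simp add: n_def)
qed

text \<open>A finite count bounds all separated families, so the greedy covering of \<open>M\<close>
  by intervals of length \<open>2 * r\<close> has at most that many members, and subadditivity
  bounds the measure of \<open>M\<close>.\<close>

lemma spectral_count_ge_measure:
  assumes l: "0 < l" "l \<le> \<eta>"
  shows "ennreal (sqrt \<eta>) * emeasure lborel (otelbaev_set \<mu> (inverse (pi\<^sup>2 + 3 / 4)) (4 * \<eta>))
    \<le> spectral_count (- l) E"
proof (rule ccontr)
  define M where "M = otelbaev_set \<mu> (inverse (pi\<^sup>2 + 3 / 4)) (4 * \<eta>)"
  assume "\<not> ?thesis"
  then have less: "spectral_count (- l) E < ennreal (sqrt \<eta>) * emeasure lborel M" by (simp add: M_def)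
  then have "spectral_count (- l) E \<noteq> \<infinity>" by auto
  then obtain t where t: "spectral_count (- l) E = ennreal t" "t \<ge> 0"
    by (cases "spectral_count (- l) E") auto
  \<comment> \<open>This makes \<open>1 / r\<^sup>2\<close> the level \<open>4 * \<eta>\<close> of
    the set, \<open>1 / (4 * r\<^sup>2)\<close> the spectral threshold \<eta>, and
    \<open>2 * r\<close> the reciprocal of \<open>sqrt \<eta>\<close>.\<close>
  define r where "r = 1 / (2 * sqrt \<eta>)"
  have \<eta>: "\<eta> > 0" using l by simp
  then have r: "r > 0" "1 / r\<^sup>2 = 4 * \<eta>" "1 / (4 * r\<^sup>2) = \<eta>" "sqrt \<eta> * (2 * r) = 1"
    by (auto simp: r_def power_divide power_mult_distrib)
  have \<alpha>: "inverse (pi\<^sup>2 + 3 / 4) > 0" using pi_squared_gt by simp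
  have closed: "closed M" unfolding M_def by (rule closed_otelbaev_set[OF \<alpha>])
  have card: "card X \<le> nat \<lfloor>t\<rfloor>" if X: "finite X" "X \<subseteq> M" "separated (\<lambda>_. 2 * r) X" for X
  proof -
    have "ennreal (real (card X)) \<le> ennreal t"
      unfolding t(1)[symmetric] using X l r by (intro spectral_count_ge_separated[OF r(1)]) (auto simp: M_def)
    then show ?thesis using t(2) by (simp add: le_nat_floor)
  qed
  have "\<exists>X. finite X \<and> X \<subseteq> M \<and> separated (\<lambda>_. 2 * r) X \<and> M \<subseteq> (\<Union>x\<in>X. {x..<x + 2 * r})"
    using r card by (intro greedy_cover[OF closed, of _ "2 * r"]) auto
  then obtain X where X: "finite X" "X \<subseteq> M" "separated (\<lambda>_. 2 * r) X" "M \<subseteq> (\<Union>x\<in>X. {x..<x + 2 * r})"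
    by blast
  have "emeasure lborel M \<le> emeasure lborel (\<Union>x\<in>X. {x..<x + 2 * r})"
    using X by (intro emeasure_mono) auto
  also have "\<dots> \<le> (\<Sum>x\<in>X. emeasure lborel {x..<x + 2 * r})"
    using X(1) by (intro emeasure_subadditive_finite) auto
  also have "\<dots> = ennreal (real (card X) * (2 * r))"
    using r by (simp add: ennreal_of_nat_eq_real_of_nat ennreal_mult)
  also have "\<dots> \<le> ennreal (t * (2 * r))"
  proof -
    have "real (card X) \<le> t" using card[OF X(1-3)] t(2) by linarith
    then show ?thesis using r by (intro ennreal_leI mult_right_mono) auto
  qed
  finally have "ennreal (sqrt \<eta>) * emeasure lborel M \<le> ennreal (sqrt \<eta>) * ennreal (t * (2 * r))"
    by (rule mult_left_mono) simp
  also have "\<dots> = ennreal (t * (sqrt \<eta> * (2 * r)))"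
    using r t \<eta> by (simp add: ennreal_mult[symmetric] mult_ac)
  also have "\<dots> = spectral_count (- l) E" by (simp add: r(4) t(1))
  finally show False using less by simp
qed

end

section \<open>Assembly of the six estimates\<close>

theorem theorem4p8:
  fixes \<mu> :: "real measure"
    and E :: "real set \<Rightarrow> (real \<Rightarrow> complex) \<Rightarrow> real \<Rightarrow> complex"
    and \<alpha> \<beta> l :: real
  assumes "radon_measure \<mu>"
    and "brinck_condition \<mu>"
    and "spectral_measure_of (form_operator \<mu>) E"
    and "\<alpha> = inverse (pi\<^sup>2 + 3 / 4)"
    and "\<beta> = 2"
    and "l > 0"
  shows "ennreal (1 / 2)
             * (INF y\<in>otelbaev_set \<mu> \<alpha> (4 * l). ennreal (sqrt (otelbaev \<mu> \<alpha> y)))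
             * emeasure lborel (otelbaev_set \<mu> \<alpha> (4 * l))
           \<le> spectral_count (- l) E
       \<and> spectral_count (- l) E
           \<le> (SUP y\<in>otelbaev_set \<mu> \<beta> (l / 4). ennreal (sqrt (otelbaev \<mu> \<beta> y)))
             * emeasure lborel (otelbaev_set \<mu> \<beta> (l / 4))
       \<and> ennreal (sqrt l) * emeasure lborel (otelbaev_set \<mu> \<alpha> (4 * l))
           \<le> spectral_count (- l) E
       \<and> spectral_count (- l) E
           \<le> ennreal (sqrt (SUP y. \<bar>otelbaev \<mu> \<beta> y\<bar>))
             * emeasure lborel (otelbaev_set \<mu> \<beta> (l / 4))
       \<and> (SUP \<eta>\<in>{l..}. ennreal (sqrt \<eta>) * emeasure lborel (otelbaev_set \<mu> \<alpha> (4 * \<eta>)))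
           \<le> spectral_count (- l) E
       \<and> spectral_count (- l) E
           \<le> 4 * (\<integral>\<^sup>+ y\<in>otelbaev_set \<mu> \<beta> (l / 4). ennreal (sqrt (otelbaev \<mu> \<beta> y)) \<partial>lborel)"
proof -
  interpret form_spectral \<mu> E
    using assms by unfold_locales
  define N where "N = spectral_count (- l) E"
  define M where "M = otelbaev_set \<mu> \<alpha> (4 * l)"
  define S where "S = (INF y\<in>M. ennreal (sqrt (otelbaev \<mu> \<alpha> y)))"
  have \<alpha>: "\<alpha> > 0" using pi_squared_gt assms(4) by simp
  have lower: "ennreal (sqrt \<eta>) * emeasure lborel (otelbaev_set \<mu> \<alpha> (4 * \<eta>)) \<le> N" if "l \<le> \<eta>" for \<eta>
    unfolding N_def assms(4) using assms(6) that by (rule spectral_count_ge_measure)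
  have low1: "ennreal (1 / 2) * S * emeasure lborel M \<le> N"
  proof (cases "M = {}")
    \<comment> \<open>The infimum over the empty set is infinite, but the measure is 0 and so is the
      product.\<close>
    case True
    then show ?thesis by simp
  next
    case False
    then obtain y0 where y0: "y0 \<in> M" by blast
    have S_le: "S \<le> ennreal (sqrt (otelbaev \<mu> \<alpha> y))" if "y \<in> M" for y
      unfolding S_def using that by (rule INF_lower)
    have "S \<noteq> \<infinity>" using S_le[OF y0] by (auto simp: top_unique)
    then obtain m where m: "S = ennreal m" "m \<ge> 0" by (cases S) auto
    \<comment> \<open>With \<open>4 * \<eta> = m\<^sup>2\<close> the set \<open>M\<close> is
      contained in the level set for \<eta>, since \<open>m\<close> is the infimum;
      \<open>sqrt \<eta> = m / 2\<close> accounts for the factor one half.\<close>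
    define \<eta> where "\<eta> = m\<^sup>2 / 4"
    have "ennreal (sqrt (4 * l)) \<le> S"
      unfolding S_def by (intro INF_greatest ennreal_leI real_sqrt_le_mono) (simp add: M_def otelbaev_set_def)
    then have "sqrt (4 * l) \<le> m" using m by simp
    then have "(sqrt (4 * l))\<^sup>2 \<le> m\<^sup>2" using assms(6) by (intro power_mono) auto
    then have l: "l \<le> \<eta>" using assms(6) by (simp add: \<eta>_def)
    have "M \<subseteq> otelbaev_set \<mu> \<alpha> (4 * \<eta>)"
    proof
      fix y assume y: "y \<in> M"
      have "otelbaev \<mu> \<alpha> y \<ge> 0" using otelbaev_bounded[OF radon brinck \<alpha>] by blast
      moreover have "m \<le> sqrt (otelbaev \<mu> \<alpha> y)"
        using S_le[OF y] m \<open>otelbaev \<mu> \<alpha> y \<ge> 0\<close> by (simp add: ennreal_le_iff)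
      then have "m\<^sup>2 \<le> (sqrt (otelbaev \<mu> \<alpha> y))\<^sup>2" using m(2) by (intro power_mono)
      ultimately show "y \<in> otelbaev_set \<mu> \<alpha> (4 * \<eta>)" by (simp add: otelbaev_set_def \<eta>_def)
    qed
    then have "emeasure lborel M \<le> emeasure lborel (otelbaev_set \<mu> \<alpha> (4 * \<eta>))"
      using closed_otelbaev_set[OF \<alpha>] by (intro emeasure_mono) auto
    moreover have "ennreal (1 / 2) * S = ennreal (sqrt \<eta>)"
      using m(2) ennreal_mult[of "1 / 2" m] unfolding m(1) \<eta>_def real_sqrt_divide by simp
    ultimately have "ennreal (1 / 2) * S * emeasure lborel M
        \<le> ennreal (sqrt \<eta>) * emeasure lborel (otelbaev_set \<mu> \<alpha> (4 * \<eta>))"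
      by (simp add: mult_left_mono)
    then show ?thesis using lower[OF l] by (rule order_trans)
  qed
  \<comment> \<open>The spectral threshold \<open>1 / h\<^sup>2\<close> becomes \<open>l\<close> and
    the level \<open>1 / (2 * h)\<^sup>2\<close> becomes \<open>l / 4\<close>.\<close>
  define h where "h = 1 / sqrt l"
  define K where "K = otelbaev_set \<mu> \<beta> (l / 4)"
  have h: "h > 0" "1 / h\<^sup>2 = l" "1 / (2 * h)\<^sup>2 = l / 4"
    using assms(6) by (auto simp: h_def power_divide power_mult_distrib)
  have K: "K = otelbaev_set \<mu> 2 (1 / (2 * h)\<^sup>2)" by (simp only: K_def h(3) assms(5))
  have up1: "N \<le> (SUP y\<in>K. ennreal (sqrt (otelbaev \<mu> \<beta> y))) * emeasure lborel K"
    using spectral_count_le_SUP[OF h(1) K] unfolding N_def h(2) assms(5) .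
  \<comment> \<open>The supremum on the right is taken in the reals, so the boundedness of the
    Otelbaev function enters here.\<close>
  have "(SUP y\<in>K. ennreal (sqrt (otelbaev \<mu> \<beta> y))) \<le> ennreal (sqrt (SUP y. \<bar>otelbaev \<mu> \<beta> y\<bar>))"
  proof (intro SUP_least ennreal_leI real_sqrt_le_mono)
    fix y
    have b: "\<forall>x. otelbaev \<mu> \<beta> x \<ge> 0" "bdd_above (range (otelbaev \<mu> \<beta>))"
      using otelbaev_bounded[OF radon brinck, of \<beta>] assms(5) by auto
    then have "bdd_above (range (\<lambda>y. \<bar>otelbaev \<mu> \<beta> y\<bar>))" by simp
    then have "\<bar>otelbaev \<mu> \<beta> y\<bar> \<le> (SUP y. \<bar>otelbaev \<mu> \<beta> y\<bar>)" by (intro cSUP_upper) auto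
    then show "otelbaev \<mu> \<beta> y \<le> (SUP y. \<bar>otelbaev \<mu> \<beta> y\<bar>)" by linarith
  qed
  then have up2: "N \<le> ennreal (sqrt (SUP y. \<bar>otelbaev \<mu> \<beta> y\<bar>)) * emeasure lborel K"
    by (intro order_trans[OF up1] mult_right_mono) auto
  have up3: "N \<le> 4 * (\<integral>\<^sup>+ y\<in>K. ennreal (sqrt (otelbaev \<mu> \<beta> y)) \<partial>lborel)"
    using spectral_count_le_integral[OF h(1) K] unfolding N_def h(2) assms(5) .
  have low3: "(SUP \<eta>\<in>{l..}. ennreal (sqrt \<eta>) * emeasure lborel (otelbaev_set \<mu> \<alpha> (4 * \<eta>))) \<le> N"
    by (intro SUP_least lower) simp
  show ?thesis
    using low1 up1 lower[OF order_refl] up2 low3 up3 unfolding N_def S_def M_def K_def by blast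
qed

end
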